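(* Let $G=(V,E)$ be a finite graph with a Schrödinger operator $\mathcal H$. Then for every $\theta\in\mathbb R$, $$\mu_{G^{\mathrm{ab}}}(\{\theta\})=\frac1{|V|}\min_{\gamma\in\mathcal C(G)}\operatorname{mult}_\theta(G\setminus\gamma).$$
   Context: Graphs are multigraphs: parallel edges and loops are allowed. $\vec E(G)$ is the set of edges with both orientations (a loop also has two distinct orientations); $\bar e$ is the reverse of $e$, and $o(e),t(e)$ are its origin and terminus. A Schrödinger operator on a finite graph $G=(V,E)$ is $\mathcal H=\sum_{e\in\vec E}w_eA_e+\mathcal V$ on $\ell^2(V)$, where $A_e$ is the matrix with $1$ in entry $(o(e),t(e))$ and $0$ elsewhere (so a loop contributes twice to its diagonal entry), $w_{\bar e}=\overline{w_e}\neq0$, and $\mathcal V=\mathrm{diag}(\mathcal V_v)_{v\in V}$ is real. Subgraphs carry the restricted operator. For a covering $\pi:\tilde G\to G$, $\mathcal H$ lifts to $\ell^2(V(\tilde G))$ by $(\mathcal H_{\tilde G}f)(x)=\sum_{\tilde e\in\vec E(\tilde G):\,o(\tilde e)=x}w_{\pi(\tilde e)}f(t(\tilde e))+\mathcal V_{\pi(x)}f(x)$. The maximal abelian cover $G^{\mathrm{ab}}$ of a connected graph $G$ is the connected normal cover with fundamental group $[\pi_1(G),\pi_1(G)]$ (deck group $H_1(G;\mathbb Z)$); for disconnected $G$, $G^{\mathrm{ab}}$ is the disjoint union of the maximal abelian covers of the components. The spectral measure is $\mu_{G^{\mathrm{ab}}}(B)=\frac1{|V|}\sum_{v\in V}\langle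 \mathbf 1_B(\mathcal H_{G^{\mathrm{ab}}})\delta_{\tilde v},\delta_{\tilde v}\rangle$ for Borel $B\subseteq\mathbb R$, where $\tilde v$ is any chosen lift of $v$. A matching $M$ of $G$ is a set of pairwise vertex-disjoint non-loop edges (the empty matching is allowed), $V(M)$ its set of covered vertices, $\vec E(M)$ its edges with both orientations; $\mathcal M_G$ is the set of matchings. The generalised matching polynomial is $m_G(x)=\sum_{M\in\mathcal M_G}(-1)^{|E(M)|}\prod_{e\in\vec E(M)}w_e\prod_{u\in V\setminus V(M)}(x-\mathcal V_u)$; it equals $1$ for the empty graph. $\operatorname{mult}_\theta(G)$ is the multiplicity ($\ge0$) of $\theta$ as a zero of $m_G$. $\mathcal C(G)$ is the set of $2$-regular subgraphs of $G$, including the empty one (a loop is a cycle of length one, two parallel edges form a cycle of length two). $G\setminus\gamma$ is obtained by deleting all vertices of $\gamma$ and all edges incident to them. *)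

theory Defs
  imports
    "HOL-Analysis.Analysis"
    "HOL-Computational_Algebra.Polynomial"
    "HOL-Algebra.Generated_Groups"
    "Graph_Theory.Graph_Theory"
begin

text \<open>
  A multigraph is a \<^locale>\<open>bidirected_digraph\<close>: \<^term>\<open>arcs G\<close> is the set of edges taken with both
  orientations, \<^term>\<open>tail G\<close> and \<^term>\<open>head G\<close> are origin and terminus, and \<^term>\<open>arev\<close> is the
  orientation reversal. It has no fixed point on \<^term>\<open>arcs G\<close>, so a loop consists of two arcs.
\<close>

section \<open>Schroedinger operators\<close>

definition schrodinger_data ::
  "('v, 'e) pre_digraph \<Rightarrow> ('e \<Rightarrow> 'e) \<Rightarrow> ('e \<Rightarrow> complex) \<Rightarrow> bool" where
  "schrodinger_data G arev w \<longleftrightarrow> (\<forall>e\<in>arcs G. w (arev e) = cnj (w e) \<and> w e \<noteq> 0)"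

definition schrodinger_op ::
  "('v, 'e) pre_digraph \<Rightarrow> ('e \<Rightarrow> complex) \<Rightarrow> ('v \<Rightarrow> real) \<Rightarrow> ('v \<Rightarrow> complex) \<Rightarrow> 'v \<Rightarrow> complex" where
  "schrodinger_op G w V f = (\<lambda>x. (\<Sum>e\<in>out_arcs G x. w e * f (head G e)) + of_real (V x) * f x)"

section \<open>Coverings and the maximal abelian cover\<close>

definition graph_covering ::
  "('v, 'e) pre_digraph \<Rightarrow> ('e \<Rightarrow> 'e) \<Rightarrow> ('x, 'a) pre_digraph \<Rightarrow> ('a \<Rightarrow> 'a) \<Rightarrow>
    ('x \<Rightarrow> 'v) \<Rightarrow> ('a \<Rightarrow> 'e) \<Rightarrow> bool" where
  "graph_covering G arev G' arev' pV pE \<longleftrightarrow>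
    bidirected_digraph G arev \<and> bidirected_digraph G' arev' \<and>
    pV ` verts G' = verts G \<and>
    (\<forall>e\<in>arcs G'. pE e \<in> arcs G \<and> tail G (pE e) = pV (tail G' e) \<and>
       head G (pE e) = pV (head G' e) \<and> pE (arev' e) = arev (pE e)) \<and>
    (\<forall>x\<in>verts G'. bij_betw pE (out_arcs G' x) (out_arcs G (pV x)))"

text \<open>
  The fundamental group at \<open>u\<close>: closed walks at \<open>u\<close> modulo insertion and deletion of backtracks.
\<close>

definition backtracks ::
  "('v, 'e) pre_digraph \<Rightarrow> ('e \<Rightarrow> 'e) \<Rightarrow> 'v \<Rightarrow> ('e list \<times> 'e list) set" where
  "backtracks G arev u =
    {(p @ [e, arev e] @ q, p @ q) | p e q. pre_digraph.awalk G u (p @ [e, arev e] @ q) u}"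

definition walk_homotopy ::
  "('v, 'e) pre_digraph \<Rightarrow> ('e \<Rightarrow> 'e) \<Rightarrow> 'v \<Rightarrow> ('e list \<times> 'e list) set" where
  "walk_homotopy G arev u =
    {(p, q). pre_digraph.awalk G u p u \<and> pre_digraph.awalk G u q u \<and>
       (p, q) \<in> (backtracks G arev u \<union> (backtracks G arev u)\<inverse>)\<^sup>*}"

definition fundamental_group ::
  "('v, 'e) pre_digraph \<Rightarrow> ('e \<Rightarrow> 'e) \<Rightarrow> 'v \<Rightarrow> 'e list set monoid" where
  "fundamental_group G arev u =
    \<lparr> carrier = {p. pre_digraph.awalk G u p u} // walk_homotopy G arev u,
      mult = (\<lambda>A B. \<Union>p\<in>A. \<Union>q\<in>B. walk_homotopy G arev u `` {p @ q}),
      one = walk_homotopy G arev u `` {[]} \<rparr>"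

text \<open>The map on homotopy classes induced by \<open>pE\<close>; \<open>u\<close> is the base point in the target \<open>G\<close>.\<close>

definition induced_hom ::
  "('v, 'e) pre_digraph \<Rightarrow> ('e \<Rightarrow> 'e) \<Rightarrow> 'v \<Rightarrow> ('a \<Rightarrow> 'e) \<Rightarrow> 'a list set \<Rightarrow> 'e list set" where
  "induced_hom G arev u pE A = walk_homotopy G arev u `` (map pE ` A)"

text \<open>
  The second conjunct says that the preimage of every connected component of \<open>G\<close> is connected
  (reachability is symmetric here, as every arc has a reverse). The third says that the cover has
  fundamental group $[\pi_1,\pi_1]$ at every base point; this subgroup is normal, so that the
  cover is normal. Since the fundamental group at a vertex only sees the component of that vertex,
  for disconnected \<open>G\<close> this describes the disjoint union of the maximal abelian covers of the
  components.
\<close>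

definition max_abelian_cover ::
  "('v, 'e) pre_digraph \<Rightarrow> ('e \<Rightarrow> 'e) \<Rightarrow> ('x, 'a) pre_digraph \<Rightarrow> ('a \<Rightarrow> 'a) \<Rightarrow>
    ('x \<Rightarrow> 'v) \<Rightarrow> ('a \<Rightarrow> 'e) \<Rightarrow> bool" where
  "max_abelian_cover G arev G' arev' pV pE \<longleftrightarrow>
    graph_covering G arev G' arev' pV pE \<and>
    (\<forall>x\<in>verts G'. \<forall>y\<in>verts G'. pV x \<rightarrow>\<^sup>*\<^bsub>G\<^esub> pV y \<longrightarrow> x \<rightarrow>\<^sup>*\<^bsub>G'\<^esub> y) \<and>
    (\<forall>x\<in>verts G'.
       induced_hom G arev (pV x) pE ` carrier (fundamental_group G' arev' x) =
       derived (fundamental_group G arev (pV x)) (carrier (fundamental_group G arev (pV x))))"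

section \<open>The Hilbert space $\ell^2(X)$ and spectral measures\<close>

text \<open>Elements of $\ell^2(X)$ are functions on the ambient type that vanish outside \<open>X\<close>.\<close>

definition ell2 :: "'x set \<Rightarrow> ('x \<Rightarrow> complex) set" where
  "ell2 X = {f. (\<forall>x. x \<notin> X \<longrightarrow> f x = 0) \<and> (\<lambda>x. (cmod (f x))\<^sup>2) summable_on X}"

definition ell2_inner :: "'x set \<Rightarrow> ('x \<Rightarrow> complex) \<Rightarrow> ('x \<Rightarrow> complex) \<Rightarrow> complex" where
  "ell2_inner X f g = (\<Sum>\<^sub>\<infinity>x\<in>X. f x * cnj (g x))"

definition delta :: "'x \<Rightarrow> 'x \<Rightarrow> complex" where
  "delta y = (\<lambda>x. if x = y then 1 else 0)"

definition ell2_projection :: "'x set \<Rightarrow> (('x \<Rightarrow> complex) \<Rightarrow> 'x \<Rightarrow> complex) \<Rightarrow> bool" where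
  "ell2_projection X P \<longleftrightarrow>
    (\<forall>f\<in>ell2 X. P f \<in> ell2 X \<and> P (P f) = P f) \<and>
    (\<forall>f\<in>ell2 X. \<forall>g\<in>ell2 X. \<forall>a b. P (\<lambda>x. a * f x + b * g x) = (\<lambda>x. a * P f x + b * P g x)) \<and>
    (\<forall>f\<in>ell2 X. \<forall>g\<in>ell2 X. ell2_inner X (P f) g = ell2_inner X f (P g))"

definition projection_valued_measure ::
  "'x set \<Rightarrow> (real set \<Rightarrow> ('x \<Rightarrow> complex) \<Rightarrow> 'x \<Rightarrow> complex) \<Rightarrow> bool" where
  "projection_valued_measure X E \<longleftrightarrow>
    (\<forall>B\<in>sets borel. ell2_projection X (E B)) \<and>
    (\<forall>f\<in>ell2 X. E UNIV f = f) \<and>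
    (\<forall>A\<in>sets borel. \<forall>B\<in>sets borel. \<forall>f\<in>ell2 X. E (A \<inter> B) f = E A (E B f)) \<and>
    (\<forall>B :: nat \<Rightarrow> real set. range B \<subseteq> sets borel \<longrightarrow> disjoint_family B \<longrightarrow>
       (\<forall>f\<in>ell2 X. \<forall>g\<in>ell2 X.
          (\<lambda>n. ell2_inner X (E (B n) f) g) sums ell2_inner X (E (\<Union>n. B n) f) g))"

definition scalar_spectral_measure ::
  "'x set \<Rightarrow> (real set \<Rightarrow> ('x \<Rightarrow> complex) \<Rightarrow> 'x \<Rightarrow> complex) \<Rightarrow> ('x \<Rightarrow> complex) \<Rightarrow> real measure" where
  "scalar_spectral_measure X E f =
    measure_of UNIV (sets borel) (\<lambda>B. ennreal (Re (ell2_inner X (E B f) f)))"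

text \<open>
  \<open>E\<close> is the spectral resolution of the bounded self-adjoint operator \<open>H\<close> on $\ell^2(X)$, i.e.
  $H = \int t\,dE(t)$, stated through quadratic forms (polarization gives the sesquilinear form).
  By the spectral theorem it exists and is unique on Borel sets and $\ell^2(X)$;
  \<open>E B\<close> is what is usually written $\mathbf 1_B(H)$.
\<close>

definition spectral_resolution ::
  "'x set \<Rightarrow> (('x \<Rightarrow> complex) \<Rightarrow> 'x \<Rightarrow> complex) \<Rightarrow>
    (real set \<Rightarrow> ('x \<Rightarrow> complex) \<Rightarrow> 'x \<Rightarrow> complex) \<Rightarrow> bool" where
  "spectral_resolution X H E \<longleftrightarrow>
    projection_valued_measure X E \<and>
    (\<forall>f\<in>ell2 X. integrable (scalar_spectral_measure X E f) (\<lambda>t. t) \<and>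
       ell2_inner X (H f) f = of_real (\<integral>t. t \<partial>scalar_spectral_measure X E f))"

text \<open>
  The spectral measure of the cover: an average over the finite vertex set \<open>V\<close> of the base;
  \<open>lft v\<close> is the chosen lift of \<open>v\<close> to the vertex set \<open>X\<close> of the cover.
\<close>

definition cover_spectral_measure ::
  "'v set \<Rightarrow> ('v \<Rightarrow> 'x) \<Rightarrow> 'x set \<Rightarrow> (real set \<Rightarrow> ('x \<Rightarrow> complex) \<Rightarrow> 'x \<Rightarrow> complex) \<Rightarrow>
    real set \<Rightarrow> real" where
  "cover_spectral_measure V lft X E B =
    1 / real (card V) * (\<Sum>v\<in>V. Re (ell2_inner X (E B (delta (lft v))) (delta (lft v))))"

section \<open>Matching polynomials and 2-regular subgraphs\<close>

text \<open>An unoriented edge is the set of its two orientations, and a matching is a set of edges.\<close>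

definition edges :: "('v, 'e) pre_digraph \<Rightarrow> ('e \<Rightarrow> 'e) \<Rightarrow> 'e set set" where
  "edges G arev = (\<lambda>e. {e, arev e}) ` arcs G"

definition matchings :: "('v, 'e) pre_digraph \<Rightarrow> ('e \<Rightarrow> 'e) \<Rightarrow> 'e set set set" where
  "matchings G arev =
    {M. M \<subseteq> edges G arev \<and> (\<forall>s\<in>M. \<forall>e\<in>s. tail G e \<noteq> head G e) \<and>
        (\<forall>s\<in>M. \<forall>t\<in>M. s \<noteq> t \<longrightarrow> tail G ` s \<inter> tail G ` t = {})}"

definition matching_poly ::
  "('v, 'e) pre_digraph \<Rightarrow> ('e \<Rightarrow> 'e) \<Rightarrow> ('e \<Rightarrow> complex) \<Rightarrow> ('v \<Rightarrow> real) \<Rightarrow> complex poly" where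
  "matching_poly G arev w V =
    (\<Sum>M\<in>matchings G arev.
       smult ((-1) ^ card M * (\<Prod>e\<in>\<Union>M. w e))
         (\<Prod>u\<in>verts G - tail G ` \<Union>M. [:- of_real (V u), 1:]))"

text \<open>\<open>Polynomial.order\<close> is the root multiplicity; \<open>order\<close> alone is the order of a group here.\<close>

definition mult_theta ::
  "real \<Rightarrow> ('v, 'e) pre_digraph \<Rightarrow> ('e \<Rightarrow> 'e) \<Rightarrow> ('e \<Rightarrow> complex) \<Rightarrow> ('v \<Rightarrow> real) \<Rightarrow> nat" where
  "mult_theta \<theta> G arev w V = Polynomial.order (of_real \<theta>) (matching_poly G arev w V)"

text \<open>A loop contributes both of its orientations to the out-degree of its vertex.\<close>

definition two_regular_subgraphs ::
  "('v, 'e) pre_digraph \<Rightarrow> ('e \<Rightarrow> 'e) \<Rightarrow> ('v, 'e) pre_digraph set" where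
  "two_regular_subgraphs G arev =
    {C. subgraph C G \<and> arev ` arcs C \<subseteq> arcs C \<and> (\<forall>v\<in>verts C. out_degree C v = 2)}"

end

theory Submission
  imports Defs
    "HOL-Probability.Infinite_Product_Measure"
    "Jordan_Normal_Form.Schur_Decomposition"
    "Jordan_Normal_Form.Jordan_Normal_Form_Uniqueness"
begin

text \<open>
  The mass of $\{\theta\}$ at a vector $f$ is the limit of $\langle A^k f, f\rangle$ for
  $A = 1 - (\mathcal H - \theta)^2 / R$ with $R$ large. A closed walk of the base lifts to a closed
  walk of the maximal abelian cover iff it traverses every edge equally often in both directions.
  Hence, with independent uniform phases on the arcs, $\langle A^k \delta, \delta\rangle$ at a lift
  of $v$ is the average over the phases of the diagonal entry at $v$ of the same power for the finite
  operator whose weights are twisted by the phases. Summing over $v$ gives traces, which converge to the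
  multiplicity of $\theta$ as a root of the characteristic polynomial of the twisted operator.
  Expanding that determinant over oriented 2-regular subgraphs $\gamma$ gives a Laurent polynomial in
  the phases whose coefficients are nonzero multiples of $m_{G \setminus \gamma}$, at pairwise distinct
  monomials. So for almost all phases the multiplicity is the least one among the
  $m_{G \setminus \gamma}$.
\<close>

section \<open>The determinant of a weighted multigraph\<close>

text \<open>The spectral resolution is given through quadratic forms, so no functional calculus of
  \<open>H\<close> is at hand. The square of \<open>H - \<theta>\<close> gives a polynomial of the
  operator whose powers isolate \<theta> by norm estimates alone. Its constant \<open>R\<close>
  exceeds 2 C + 2 \<theta>^2, where C bounds the squared norm of the lifted operator and of every
  twisted finite operator at once. On the finite side the eigenvalues of the polynomial then lie in
  (0, 1], so the traces of its powers are bounded by the number of vertices, and dominated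
  convergence puts the limit under the average over the phases.

  The twists of an arc and of its reverse multiply to 1. A directed 2-cycle along one edge back and
  forth therefore carries no phase, and its transposition gives a sign: these 2-cycles produce the
  matchings in m_G. All other cycles keep their phases, and the two orientations of a cycle give
  different monomials. Genericity is reduced to one variable: the i-th arc carries the power 3^i of
  a common phase, and exponents in {-1, 0, 1} can be recovered from such a ternary sum.\<close>

locale arc_system =
  fixes S :: "'v set" and A :: "'e set" and tl hd :: "'e \<Rightarrow> 'v" and rev :: "'e \<Rightarrow> 'e"
  assumes finite_S: "finite S" and finite_A: "finite A"
    and tl_S: "e \<in> A \<Longrightarrow> tl e \<in> S"
    and rev_A: "e \<in> A \<Longrightarrow> rev e \<in> A"
    and rev_rev: "e \<in> A \<Longrightarrow> rev (rev e) = e"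
    and rev_neq: "e \<in> A \<Longrightarrow> rev e \<noteq> e"
    and tl_rev: "e \<in> A \<Longrightarrow> tl (rev e) = hd e"
begin

lemma hd_rev: "e \<in> A \<Longrightarrow> hd (rev e) = tl e"
  by (metis rev_A rev_rev tl_rev)

lemma hd_S: "e \<in> A \<Longrightarrow> hd e \<in> S"
  by (metis rev_A tl_S tl_rev)

text \<open>These are the disjoint unions of directed cycles. Working with arcs instead of vertex
  permutations keeps parallel arcs apart; one orientation of a loop is a cycle of length one, and an
  arc with its reverse may form a cycle of length two.\<close>

definition cycle_sets :: "'e set set" where
  "cycle_sets = {F. F \<subseteq> A \<and> inj_on tl F \<and> hd ` F = tl ` F}"

definition successor :: "'e set \<Rightarrow> 'v \<Rightarrow> 'v" where
  "successor F v = (if v \<in> tl ` F then hd (the_inv_into F tl v) else v)"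

lemma cycle_sets_subset: "F \<in> cycle_sets \<Longrightarrow> F \<subseteq> A"
  and cycle_sets_inj: "F \<in> cycle_sets \<Longrightarrow> inj_on tl F"
  and cycle_sets_hd: "F \<in> cycle_sets \<Longrightarrow> hd ` F = tl ` F"
  by (auto simp: cycle_sets_def)

lemma finite_cycle_sets: "finite cycle_sets"
  by (rule finite_subset[of _ "Pow A"]) (auto simp: cycle_sets_def finite_A)

lemma finite_in_cycle_sets: "F \<in> cycle_sets \<Longrightarrow> finite F"
  using cycle_sets_subset finite_A finite_subset by blast

lemma successor_tl: "F \<in> cycle_sets \<Longrightarrow> e \<in> F \<Longrightarrow> successor F (tl e) = hd e"
  by (simp add: successor_def cycle_sets_inj the_inv_into_f_f)

lemma inj_on_hd: "F \<in> cycle_sets \<Longrightarrow> inj_on hd F"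
  by (rule eq_card_imp_inj_on)
    (auto simp: finite_in_cycle_sets cycle_sets_hd card_image cycle_sets_inj)

lemma successor_permutes:
  assumes F: "F \<in> cycle_sets"
  shows "successor F permutes S"
proof -
  have 1: "inj_on (successor F) (tl ` F)"
    using inj_on_hd[OF F] by (auto simp: inj_on_def successor_tl[OF F])
  have 2: "successor F ` (tl ` F) = tl ` F"
    unfolding cycle_sets_hd[OF F, symmetric] image_image[of _ tl, folded cycle_sets_hd[OF F]]
    by (simp add: cycle_sets_hd[OF F] image_image successor_tl[OF F] cong: image_cong)
  have "successor F permutes (tl ` F)"
    by (rule bij_imp_permutes) (auto simp: bij_betw_def 1 2, simp add: successor_def)
  then show ?thesis
    by (rule permutes_subset) (use cycle_sets_subset[OF F] tl_S in auto)
qed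

text \<open>Expanding the product chooses at every vertex either the diagonal term or an outgoing
  arc. A choice determines the permutation that it contributes to, so the sum over \<open>p\<close>
  collapses; the choices that do yield a permutation are the cycle sets.\<close>

lemma permutation_sum_cycle_sets:
  fixes a :: "'v \<Rightarrow> 'r::comm_ring_1" and b :: "'e \<Rightarrow> 'r"
  shows "(\<Sum>p | p permutes S. of_int (sign p) *
      (\<Prod>v\<in>S. (if p v = v then a v else 0) + (\<Sum>e | e \<in> A \<and> tl e = v \<and> hd e = p v. b e)))
    = (\<Sum>F\<in>cycle_sets. of_int (sign (successor F)) * ((\<Prod>e\<in>F. b e) * (\<Prod>v\<in>S - tl ` F. a v)))"
proof -
  \<comment> \<open>\<open>None\<close> stands for the term \<open>a v\<close>, which keeps
    \<open>v\<close> fixed, and \<open>Some e\<close> for leaving \<open>v\<close> along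
    \<open>e\<close>. So a loop at \<open>v\<close> is told apart from the diagonal term.\<close>
  define C where "C v = insert None (Some ` {e \<in> A. tl e = v})" for v
  define f where "f p v c = (case c of None \<Rightarrow> if p v = v then a v else 0
      | Some e \<Rightarrow> if hd e = p v then b e else 0)" for p :: "'v \<Rightarrow> 'v" and v c
  define wt where "wt v c = (case c of None \<Rightarrow> a v | Some e \<Rightarrow> b e)" for v c
  define \<tau> where "\<tau> g v = (if v \<in> S then (case g v of None \<Rightarrow> v | Some e \<Rightarrow> hd e) else v)" for g v
  have fC: "finite (C v)" for v by (simp add: C_def finite_A)
  have fP: "finite (Pi\<^sub>E S C)" by (simp add: finite_PiE finite_S fC)
  have fperm: "finite {p. p permutes S}" by (simp add: finite_S finite_permutations)
  have entry: "(if p v = v then a v else 0) + (\<Sum>e | e \<in> A \<and> tl e = v \<and> hd e = p v. b e)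
      = (\<Sum>c\<in>C v. f p v c)" for p v
  proof -
    have "(\<Sum>c\<in>Some ` {e \<in> A. tl e = v}. f p v c) = (\<Sum>e | e \<in> A \<and> tl e = v. if hd e = p v then b e else 0)"
      by (subst sum.reindex) (auto simp: f_def)
    also have "\<dots> = (\<Sum>e | e \<in> A \<and> tl e = v \<and> hd e = p v. b e)"
      by (subst sum.inter_filter[symmetric]) (auto simp: finite_A intro!: sum.cong)
    finally show ?thesis
      unfolding C_def by (subst sum.insert) (auto simp: finite_A f_def)
  qed
  have prodf: "(\<Prod>v\<in>S. f p v (g v)) = (if p = \<tau> g then \<Prod>v\<in>S. wt v (g v) else 0)"
    if "p permutes S" for p g
  proof (cases "p = \<tau> g")
    case True
    have "f p v (g v) = wt v (g v)" if "v \<in> S" for v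
      using that True by (cases "g v") (auto simp: f_def wt_def \<tau>_def)
    then show ?thesis using True by simp
  next
    case False
    then obtain v where v: "p v \<noteq> \<tau> g v" by auto
    have "v \<in> S" using v that by (auto simp: \<tau>_def permutes_def split: if_splits)
    moreover have "f p v (g v) = 0"
      using v \<open>v \<in> S\<close> by (cases "g v") (auto simp: f_def \<tau>_def)
    ultimately have "(\<Prod>v\<in>S. f p v (g v)) = 0" using finite_S by (meson prod_zero)
    then show ?thesis using False by simp
  qed
  have "(\<Sum>p | p permutes S. of_int (sign p) *
      (\<Prod>v\<in>S. (if p v = v then a v else 0) + (\<Sum>e | e \<in> A \<and> tl e = v \<and> hd e = p v. b e)))
    = (\<Sum>p | p permutes S. \<Sum>g\<in>Pi\<^sub>E S C. of_int (sign p) * (if p = \<tau> g then \<Prod>v\<in>S. wt v (g v) else 0))"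
    by (intro sum.cong refl) (simp add: entry prod_sum_PiE finite_S fC prodf sum_distrib_left)
  also have "\<dots> = (\<Sum>g\<in>Pi\<^sub>E S C. \<Sum>p | p permutes S. of_int (sign p) * (if p = \<tau> g then \<Prod>v\<in>S. wt v (g v) else 0))"
    by (rule sum.swap)
  also have "\<dots> = (\<Sum>g\<in>Pi\<^sub>E S C. if \<tau> g permutes S then of_int (sign (\<tau> g)) * (\<Prod>v\<in>S. wt v (g v)) else 0)"
    by (intro sum.cong refl) (simp add: if_distrib fperm sum.delta' cong: if_cong)
  also have "\<dots> = (\<Sum>g | g \<in> Pi\<^sub>E S C \<and> \<tau> g permutes S. of_int (sign (\<tau> g)) * (\<Prod>v\<in>S. wt v (g v)))"
    using fP by (simp add: sum.inter_filter)
  also have "\<dots> = (\<Sum>F\<in>cycle_sets. of_int (sign (successor F)) * ((\<Prod>e\<in>F. b e) * (\<Prod>v\<in>S - tl ` F. a v)))"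
  proof -
    \<comment> \<open>\<open>gF\<close> and \<open>Fg\<close> are mutually inverse between cycle
      sets and the choices whose \<open>\<tau>\<close> is a permutation.\<close>
    define gF where "gF F = (\<lambda>v\<in>S. if v \<in> tl ` F then Some (the_inv_into F tl v) else None)" for F
    define Fg where "Fg g = {e \<in> A. g (tl e) = Some e}" for g
    have gF1: "gF F (tl e) = Some e" if "F \<in> cycle_sets" "e \<in> F" for F e
      using that by (auto simp: gF_def cycle_sets_inj the_inv_into_f_f dest: cycle_sets_subset intro: tl_S)
    have gF2: "gF F v = None" if "v \<in> S" "v \<notin> tl ` F" for F v
      using that by (auto simp: gF_def)
    have gFP: "gF F \<in> Pi\<^sub>E S C" if F: "F \<in> cycle_sets" for F
    proof (rule PiE_I)
      fix v assume v: "v \<in> S"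
      show "gF F v \<in> C v"
      proof (cases "v \<in> tl ` F")
        case True
        then obtain e where "e \<in> F" "v = tl e" by auto
        then show ?thesis using gF1[OF F] cycle_sets_subset[OF F] by (auto simp: C_def)
      qed (auto simp: gF2 v C_def)
    qed (auto simp: gF_def)
    have tgF: "\<tau> (gF F) = successor F" if F: "F \<in> cycle_sets" for F
    proof
      fix v
      consider "v \<notin> S" | "v \<in> S" "v \<notin> tl ` F" | e where "v = tl e" "e \<in> F" by auto
      then show "\<tau> (gF F) v = successor F v"
      proof cases
        case 1 then show ?thesis
          using successor_permutes[OF F] by (auto simp: \<tau>_def permutes_def)
      next
        case 2 then show ?thesis by (simp add: \<tau>_def gF2 successor_def)
      next
        case 3 then show ?thesis
          using cycle_sets_subset[OF F] tl_S by (auto simp: \<tau>_def gF1[OF F] successor_tl[OF F])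
      qed
    qed
    have FgF: "Fg (gF F) = F" if F: "F \<in> cycle_sets" for F
    proof -
      have "e \<in> F" if "e \<in> A" "gF F (tl e) = Some e" for e
      proof -
        have "tl e \<in> tl ` F" by (rule ccontr) (use that gF2[OF tl_S[OF that(1)]] in auto)
        then obtain e' where "e' \<in> F" "tl e = tl e'" by auto
        then show ?thesis using that gF1[OF F] by simp
      qed
      then show ?thesis using gF1[OF F] cycle_sets_subset[OF F] by (auto simp: Fg_def)
    qed
    have g_Some: "e \<in> A \<and> tl e = v" if "g \<in> Pi\<^sub>E S C" "v \<in> S" "g v = Some e" for g v e
      using PiE_mem[OF that(1,2)] that(3) by (auto simp: C_def)
    have tlFg: "v \<in> tl ` Fg g \<longleftrightarrow> g v \<noteq> None" if "g \<in> Pi\<^sub>E S C" "v \<in> S" for g v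
      using g_Some[OF that] by (force simp: Fg_def)
    have Fg_cyc: "Fg g \<in> cycle_sets" if g: "g \<in> Pi\<^sub>E S C" and p: "\<tau> g permutes S" for g
    proof -
      have 1: "Fg g \<subseteq> A" by (auto simp: Fg_def)
      have inj1: "inj_on tl (Fg g)" by (rule inj_onI) (metis (mono_tags, lifting) Fg_def mem_Collect_eq option.inject)
      have 2: "\<tau> g (tl e) = hd e" if "e \<in> Fg g" for e
        using that tl_S by (auto simp: Fg_def \<tau>_def)
      have 3: "hd ` Fg g = \<tau> g ` tl ` Fg g" using 2 by (force simp: image_image)
      have "inj_on (\<tau> g) (tl ` Fg g)" using permutes_inj[OF p] by (meson inj_on_subset subset_UNIV)
      then have c: "card (hd ` Fg g) = card (tl ` Fg g)" using 3 card_image by metis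
      \<comment> \<open>If the head \<open>x\<close> of a chosen arc had no chosen arc of its own,
        then \<open>\<tau> g\<close> would fix \<open>x\<close> and also send the tail of that arc
        to \<open>x\<close>; injectivity makes this tail equal to \<open>x\<close>.\<close>
      have "hd ` Fg g \<subseteq> tl ` Fg g"
      proof
        fix x assume "x \<in> hd ` Fg g"
        then obtain e where e: "e \<in> Fg g" "x = hd e" by auto
        have xS: "x \<in> S" using e hd_S 1 by auto
        show "x \<in> tl ` Fg g"
        proof (rule ccontr)
          assume "x \<notin> tl ` Fg g"
          then have "g x = None" using tlFg[OF g xS] by auto
          then have "\<tau> g x = x" by (simp add: \<tau>_def)
          moreover have "\<tau> g (tl e) = x" using 2 e by auto
          ultimately have "tl e = x" using injD[OF permutes_inj[OF p], of x "tl e"] by simp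
          moreover have "tl e \<in> tl ` Fg g" using e(1) by (rule imageI)
          ultimately show False using \<open>x \<notin> tl ` Fg g\<close> by simp
        qed
      qed
      moreover have "finite (tl ` Fg g)" using finite_A finite_subset[OF 1] by auto
      ultimately have "hd ` Fg g = tl ` Fg g" using c card_subset_eq by blast
      then show ?thesis using 1 inj1 by (simp add: cycle_sets_def)
    qed
    have gFg: "gF (Fg g) = g" if g: "g \<in> Pi\<^sub>E S C" and p: "\<tau> g permutes S" for g
    proof
      fix v
      consider "v \<notin> S" | "v \<in> S" "g v = None" | e where "v \<in> S" "g v = Some e" by (cases "g v") auto
      then show "gF (Fg g) v = g v"
      proof cases
        case 1 then show ?thesis using g by (auto simp: gF_def PiE_def extensional_def)
      next
        case 2 then show ?thesis using tlFg[OF g] gF2 by metis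
      next
        case 3
        then have "e \<in> Fg g" "v = tl e" using g_Some[OF g] by (auto simp: Fg_def)
        then show ?thesis using gF1[OF Fg_cyc[OF g p]] 3 by auto
      qed
    qed
    have prd: "(\<Prod>v\<in>S. wt v (gF F v)) = (\<Prod>e\<in>F. b e) * (\<Prod>v\<in>S - tl ` F. a v)"
      if F: "F \<in> cycle_sets" for F
    proof -
      have sub: "tl ` F \<subseteq> S" using cycle_sets_subset[OF F] tl_S by auto
      have "(\<Prod>v\<in>S. wt v (gF F v)) = (\<Prod>v\<in>S - tl ` F. wt v (gF F v)) * (\<Prod>v\<in>tl ` F. wt v (gF F v))"
        by (rule prod.subset_diff[OF sub finite_S])
      also have "(\<Prod>v\<in>tl ` F. wt v (gF F v)) = (\<Prod>e\<in>F. b e)"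
        by (subst prod.reindex[OF cycle_sets_inj[OF F]]) (auto simp: gF1[OF F] wt_def intro!: prod.cong)
      also have "(\<Prod>v\<in>S - tl ` F. wt v (gF F v)) = (\<Prod>v\<in>S - tl ` F. a v)"
        by (intro prod.cong) (auto simp: gF2 wt_def)
      finally show ?thesis by (simp add: mult.commute)
    qed
    have succ: "successor (Fg g) = \<tau> g" if "g \<in> Pi\<^sub>E S C" "\<tau> g permutes S" for g
      using tgF[OF Fg_cyc[OF that]] gFg[OF that] by simp
    have prd': "(\<Prod>v\<in>S. wt v (g v)) = (\<Prod>e\<in>Fg g. b e) * (\<Prod>v\<in>S - tl ` Fg g. a v)"
      if "g \<in> Pi\<^sub>E S C" "\<tau> g permutes S" for g
      using prd[OF Fg_cyc[OF that]] gFg[OF that] by simp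
    show ?thesis
      by (rule sum.reindex_bij_witness[where i = gF and j = Fg])
        (use succ prd' gFg FgF gFP tgF successor_permutes Fg_cyc prd in \<open>simp_all\<close>)
  qed
  finally show ?thesis .
qed

section \<open>Splitting cycle sets into oriented cycles and matchings\<close>

lemma finite_Pow_edges: "finite {M. M \<subseteq> (\<lambda>e. {e, rev e}) ` A}"
  by (simp add: finite_A)

text \<open>By \<open>matchings_restrict\<close> these are the matchings of the subgraph induced on
  \<open>X\<close>, described without forming a subgraph.\<close>

definition edge_matchings :: "'v set \<Rightarrow> 'e set set set" where
  "edge_matchings X = {M. M \<subseteq> (\<lambda>e. {e, rev e}) ` {e \<in> A. tl e \<in> X \<and> hd e \<in> X} \<and>
     (\<forall>s\<in>M. \<forall>e\<in>s. tl e \<noteq> hd e) \<and> (\<forall>s\<in>M. \<forall>t\<in>M. s \<noteq> t \<longrightarrow> tl ` s \<inter> tl ` t = {})}"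

text \<open>A 2-regular subgraph with an orientation of each of its cycles. Excluded are the cycles
  that run back and forth along one edge; a loop in one orientation and a cycle through two parallel
  edges remain.\<close>

definition oriented_cycle_sets :: "'e set set" where
  "oriented_cycle_sets = {F \<in> cycle_sets. \<forall>e\<in>F. rev e \<notin> F}"

lemma finite_edge_matchings: "finite (edge_matchings X)"
  by (rule finite_subset[OF _ finite_Pow_edges]) (auto simp: edge_matchings_def)

lemma finite_in_edge_matchings: "M \<in> edge_matchings X \<Longrightarrow> finite M"
  by (rule finite_subset[of _ "(\<lambda>e. {e, rev e}) ` A"]) (auto simp: edge_matchings_def finite_A)

lemma edge_matchings_mem:
  assumes "M \<in> edge_matchings X" "s \<in> M" "e \<in> s"
  shows "e \<in> A" "s = {e, rev e}" "tl e \<in> X" "hd e \<in> X" "tl e \<noteq> hd e"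
proof -
  from assms obtain e' where e': "e' \<in> A" "s = {e', rev e'}" "tl e' \<in> X" "hd e' \<in> X"
    by (auto simp: edge_matchings_def)
  show "e \<in> A" "s = {e, rev e}" "tl e \<in> X" "hd e \<in> X"
    using assms(3) e' rev_A rev_rev tl_rev hd_rev by auto
  show "tl e \<noteq> hd e" using assms by (auto simp: edge_matchings_def)
qed

text \<open>Arcs of a matching with a common tail belong to the same edge, and the two orientations
  of a non-loop have different tails.\<close>

lemma edge_matchings_disjoint:
  assumes "M \<in> edge_matchings X" "s \<in> M" "t \<in> M" "e \<in> s" "e' \<in> t" "tl e = tl e'"
  shows "e = e'"
proof -
  have "tl e \<in> tl ` s \<inter> tl ` t" using assms(4-6) by (metis IntI imageI)
  then have "s = t" using assms(1-3) unfolding edge_matchings_def by blast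
  then show ?thesis using assms edge_matchings_mem[OF assms(1)] tl_rev
    by (metis empty_iff insertE)
qed

text \<open>Each edge of \<open>M\<close>, in both orientations, is a directed 2-cycle, and it
  avoids the vertices of \<open>F\<close>.\<close>

lemma cycle_sets_Un_matching:
  assumes F: "F \<in> cycle_sets" and M: "M \<in> edge_matchings (S - tl ` F)"
  shows "F \<union> \<Union>M \<in> cycle_sets"
proof -
  note m = edge_matchings_mem[OF M]
  have "\<Union>M \<subseteq> A" using m by auto
  moreover have "inj_on tl (\<Union>M)"
    by (intro inj_onI) (meson UnionE edge_matchings_disjoint[OF M])
  moreover have "tl ` F \<inter> tl ` \<Union>M = {}"
  proof (intro equals0I)
    fix x assume x: "x \<in> tl ` F \<inter> tl ` \<Union>M"
    then obtain e s where "s \<in> M" "e \<in> s" "x = tl e" by blast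
    with m(3)[of s e] x show False by simp
  qed
  moreover have "hd ` \<Union>M = tl ` \<Union>M"
  proof -
    have r: "rev e \<in> \<Union>M" if "e \<in> \<Union>M" for e using m that by blast
    have "hd e \<in> tl ` \<Union>M" if "e \<in> \<Union>M" for e
      using r[OF that] m that tl_rev by (metis UnionE image_eqI)
    moreover have "tl e \<in> hd ` \<Union>M" if "e \<in> \<Union>M" for e
      using r[OF that] m that hd_rev by (metis UnionE image_eqI)
    ultimately show ?thesis by auto
  qed
  ultimately show ?thesis
    using cycle_sets_subset[OF F] cycle_sets_inj[OF F] cycle_sets_hd[OF F]
    unfolding cycle_sets_def by (auto simp: image_Un inj_on_Un)
qed

text \<open>The two arcs of the new edge exchange its ends, so the permutation is multiplied by a
  transposition. This is the source of the sign in the matching polynomial.\<close>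

lemma sign_successor_insert_edge:
  assumes F: "F \<in> cycle_sets" and F': "insert e (insert (rev e) F) \<in> cycle_sets"
    and e: "e \<in> A" "tl e \<notin> tl ` F" "hd e \<notin> tl ` F" "tl e \<noteq> hd e"
  shows "sign (successor (insert e (insert (rev e) F))) = - sign (successor F)"
proof -
  let ?F = "insert e (insert (rev e) F)"
  have "successor ?F v = (successor F \<circ> Transposition.transpose (tl e) (hd e)) v" for v
  proof -
    consider "v = tl e" | "v = hd e" | f where "v = tl f" "f \<in> F" | "v \<noteq> tl e" "v \<noteq> hd e" "v \<notin> tl ` F" by auto
    then show ?thesis
    proof cases
      case 1 then show ?thesis using successor_tl[OF F', of e] e by (simp add: successor_def[of F])
    next
      case 2 then show ?thesis using successor_tl[OF F', of "rev e"] e tl_rev hd_rev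
        by (simp add: successor_def[of F])
    next
      case 3
      then have "v \<noteq> tl e" "v \<noteq> hd e" using e(2,3) by (metis imageI)+
      then show ?thesis using 3 successor_tl[OF F', of f] successor_tl[OF F, of f] by simp
    next
      case 4 then show ?thesis using tl_rev e by (simp add: successor_def)
    qed
  qed
  then have eq: "successor ?F = successor F \<circ> Transposition.transpose (tl e) (hd e)" by auto
  have "permutation (successor F)" using successor_permutes[OF F] finite_S permutation_permutes by blast
  then show ?thesis unfolding eq using e by (simp add: sign_compose sign_swap_id permutation_swap_id)
qed

lemma sign_successor_Un_matching:
  assumes F: "F \<in> cycle_sets" and M: "M \<in> edge_matchings (S - tl ` F)"
  shows "sign (successor (F \<union> \<Union>M)) = (-1) ^ card M * sign (successor F)"
proof -
  have "finite M" using M finite_in_edge_matchings by auto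
  then show ?thesis using M
  proof (induction M rule: finite_induct)
    case (insert s M)
    have M: "M \<in> edge_matchings (S - tl ` F)" using insert.prems by (auto simp: edge_matchings_def)
    have "s \<noteq> {}" using insert.prems by (auto simp: edge_matchings_def)
    then obtain e where e: "e \<in> s" by auto
    note m = edge_matchings_mem[OF insert.prems insertI1 e]
    have disj: "tl ` s \<inter> tl ` t = {}" if "t \<in> M" for t
      using insert.prems that insert.hyps by (auto simp: edge_matchings_def)
    have "tl e \<in> tl ` s" "hd e \<in> tl ` s"
      using imageI[of e s tl] imageI[of "rev e" s tl] m(1,2) tl_rev[of e] by auto
    then have d: "tl e \<notin> tl ` (F \<union> \<Union>M)" "hd e \<notin> tl ` (F \<union> \<Union>M)"
      using disj m by auto
    have eq: "F \<union> \<Union>(insert s M) = insert e (insert (rev e) (F \<union> \<Union>M))" using m by auto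
    have "sign (successor (F \<union> \<Union>(insert s M))) = - sign (successor (F \<union> \<Union>M))"
      unfolding eq
      by (rule sign_successor_insert_edge[OF cycle_sets_Un_matching[OF F M] _ m(1) d m(5)])
        (use cycle_sets_Un_matching[OF F insert.prems] eq in simp)
    then show ?case using insert.IH[OF M] insert.hyps by simp
  qed simp
qed

text \<open>In a cycle set, the arcs whose reverse is also present form isolated 2-cycles, since
  \<open>tl\<close> is injective there; they are a matching, and the remaining arcs are an oriented
  cycle set. The decomposition is unique.\<close>

lemma sum_cycle_sets_split:
  fixes h :: "'e set \<Rightarrow> 'r::comm_ring_1"
  shows "(\<Sum>F\<in>cycle_sets. h F) =
    (\<Sum>F\<in>oriented_cycle_sets. \<Sum>M\<in>edge_matchings (S - tl ` F). h (F \<union> \<Union>M))"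
proof -
  define Fo where "Fo F = {e \<in> F. rev e \<notin> F}" for F
  define Mo where "Mo F = (\<lambda>e. {e, rev e}) ` {e \<in> F. rev e \<in> F}" for F
  have fin: "finite oriented_cycle_sets" using finite_cycle_sets by (auto simp: oriented_cycle_sets_def)
  have UMo: "\<Union>(Mo F) = {e \<in> F. rev e \<in> F}" if "F \<in> cycle_sets" for F
    using cycle_sets_subset[OF that] rev_rev by (auto simp: Mo_def)
  have 1: "Fo F \<union> \<Union>(Mo F) = F" if "F \<in> cycle_sets" for F
    unfolding UMo[OF that] by (auto simp: Fo_def)
  have 2: "Fo F \<in> oriented_cycle_sets" if F: "F \<in> cycle_sets" for F
  proof -
    let ?R = "{e \<in> F. rev e \<in> F}"
    have h: "hd ` ?R = tl ` ?R"
    proof -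
      have "hd e \<in> tl ` ?R" "tl e \<in> hd ` ?R" if "e \<in> ?R" for e
        using that cycle_sets_subset[OF F] tl_rev hd_rev rev_rev
        by (auto intro!: image_eqI[of _ _ "rev e"])
      then show ?thesis by auto
    qed
    have FR: "Fo F = F - ?R" by (auto simp: Fo_def)
    have "hd ` Fo F = hd ` F - hd ` ?R"
      unfolding FR by (rule inj_on_image_set_diff[OF inj_on_hd[OF F]]) auto
    also have "\<dots> = tl ` F - tl ` ?R" using h cycle_sets_hd[OF F] by simp
    also have "\<dots> = tl ` Fo F"
      unfolding FR by (rule inj_on_image_set_diff[OF cycle_sets_inj[OF F], symmetric]) auto
    finally show ?thesis
      using cycle_sets_subset[OF F] cycle_sets_inj[OF F]
      by (auto simp: oriented_cycle_sets_def cycle_sets_def Fo_def intro: inj_on_subset)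
  qed
  have 3: "Mo F \<in> edge_matchings (S - tl ` Fo F)" if F: "F \<in> cycle_sets" for F
  proof -
    have A: "F \<subseteq> A" by (rule cycle_sets_subset[OF F])
    have inj: "tl e = tl f \<longleftrightarrow> e = f" if "e \<in> F" "f \<in> F" for e f
      using cycle_sets_inj[OF F] that by (auto simp: inj_on_def)
    have a: "tl e \<notin> tl ` Fo F" if "e \<in> F" "rev e \<in> F" for e
      using that inj by (auto simp: Fo_def)
    have b: "hd e \<notin> tl ` Fo F" if "e \<in> F" "rev e \<in> F" for e
      using a[of "rev e"] that A tl_rev rev_rev by auto
    have c: "tl e \<noteq> hd e" if "e \<in> F" "rev e \<in> F" for e
    proof -
      have "e \<in> A" using that A by blast
      then show ?thesis using inj[OF that] rev_neq[of e] tl_rev[of e] by metis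
    qed
    show ?thesis
      unfolding edge_matchings_def
    proof (intro CollectI conjI ballI impI)
      show "Mo F \<subseteq> (\<lambda>e. {e, rev e}) ` {e \<in> A. tl e \<in> S - tl ` Fo F \<and> hd e \<in> S - tl ` Fo F}"
        using a b A tl_S hd_S by (auto simp: Mo_def)
    next
      fix s e assume "s \<in> Mo F" "e \<in> s"
      then have "e \<in> F" "rev e \<in> F" using UMo[OF F] by auto
      then show "tl e \<noteq> hd e" by (rule c)
    next
      fix s t assume st: "s \<in> Mo F" "t \<in> Mo F" "s \<noteq> t"
      then obtain e f where ef: "e \<in> F" "rev e \<in> F" "f \<in> F" "rev f \<in> F" "s = {e, rev e}" "t = {f, rev f}"
        unfolding Mo_def by blast
      have "rev (rev e) = e" "rev (rev f) = f" using ef A rev_rev by blast+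
      then have "e \<noteq> f" "e \<noteq> rev f" "rev e \<noteq> f" "rev e \<noteq> rev f"
        using st(3) ef(5,6) by (metis insert_commute)+
      then show "tl ` s \<inter> tl ` t = {}" using inj ef by auto
    qed
  qed
  have 4: "Fo (F \<union> \<Union>M) = F" "Mo (F \<union> \<Union>M) = M"
    if F: "F \<in> oriented_cycle_sets" and M: "M \<in> edge_matchings (S - tl ` F)" for F M
  proof -
    note m = edge_matchings_mem[OF M]
    have FA: "F \<subseteq> A" "\<And>e. e \<in> F \<Longrightarrow> rev e \<notin> F" "hd ` F = tl ` F"
      using F by (auto simp: oriented_cycle_sets_def cycle_sets_def)
    have r: "rev e \<in> \<Union>M" if "e \<in> \<Union>M" for e using m that by blast
    have d: "e \<notin> F" if "e \<in> \<Union>M" for e using m that by blast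
    have r': "rev e \<notin> \<Union>M" if "e \<in> F" for e
    proof
      assume "rev e \<in> \<Union>M"
      from r[OF this] d that FA rev_rev show False by (metis subsetD)
    qed
    show "Fo (F \<union> \<Union>M) = F" unfolding Fo_def using FA r r' by blast
    have s: "{e \<in> F \<union> \<Union>M. rev e \<in> F \<union> \<Union>M} = \<Union>M" using FA r r' by blast
    have "(\<lambda>e. {e, rev e}) ` \<Union>M = M"
    proof (intro equalityI subsetI)
      fix s assume "s \<in> (\<lambda>e. {e, rev e}) ` \<Union>M" then show "s \<in> M" using m by auto
    next
      fix s assume s: "s \<in> M"
      then have "s \<noteq> {}" using M by (auto simp: edge_matchings_def)
      then obtain e where "e \<in> s" by blast
      then show "s \<in> (\<lambda>e. {e, rev e}) ` \<Union>M" using m(2)[OF s] s by (intro image_eqI[of _ _ e]) auto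
    qed
    then show "Mo (F \<union> \<Union>M) = M" unfolding Mo_def s .
  qed
  have "(\<Sum>F\<in>oriented_cycle_sets. \<Sum>M\<in>edge_matchings (S - tl ` F). h (F \<union> \<Union>M))
    = (\<Sum>(F, M)\<in>(SIGMA F:oriented_cycle_sets. edge_matchings (S - tl ` F)). h (F \<union> \<Union>M))"
    by (rule sum.Sigma) (auto simp: fin finite_edge_matchings)
  also have "\<dots> = (\<Sum>F\<in>cycle_sets. h F)"
    by (rule sum.reindex_bij_witness[where i = "\<lambda>F. (Fo F, Mo F)" and j = "\<lambda>(F, M). F \<union> \<Union>M"])
      (use 1 2 3 4 cycle_sets_Un_matching in \<open>auto simp: oriented_cycle_sets_def\<close>)
  finally show ?thesis by simp
qed

text \<open>A matching contains each edge in both orientations, so only the products over the two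
  orientations matter. This removes both the phases and the minus signs of the matrix
  entries.\<close>

lemma prod_matching_cong:
  fixes b c :: "'e \<Rightarrow> 'r::comm_ring_1"
  assumes M: "M \<in> edge_matchings X" and eq: "\<And>e. e \<in> A \<Longrightarrow> b e * b (rev e) = c e * c (rev e)"
  shows "(\<Prod>e\<in>\<Union>M. b e) = (\<Prod>e\<in>\<Union>M. c e)"
proof -
  note m = edge_matchings_mem[OF M]
  have fin: "\<forall>s\<in>M. finite s" using m by (metis all_not_in_conv finite.simps)
  have disj: "\<forall>s\<in>M. \<forall>t\<in>M. s \<noteq> t \<longrightarrow> s \<inter> t = {}" using M unfolding edge_matchings_def by blast
  have eq': "prod b s = prod c s" if s: "s \<in> M" for s
  proof (cases "s = {}")
    case False
    then obtain e where e: "e \<in> s" by auto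
    show ?thesis using eq m[OF s e] rev_neq[of e] by (simp add: m(2)[OF s e])
  qed simp
  show ?thesis
    unfolding prod.Union_disjoint[OF fin disj] comp_def by (intro prod.cong refl eq')
qed

text \<open>Regrouped in this way, the inner sum involves \<open>F\<close> only through its vertex
  set; it becomes the matching polynomial of the graph off the cycles.\<close>

lemma permutation_sum_oriented:
  fixes a :: "'v \<Rightarrow> 'r::comm_ring_1" and b :: "'e \<Rightarrow> 'r"
  shows "(\<Sum>p | p permutes S. of_int (sign p) *
      (\<Prod>v\<in>S. (if p v = v then a v else 0) + (\<Sum>e | e \<in> A \<and> tl e = v \<and> hd e = p v. b e)))
    = (\<Sum>F\<in>oriented_cycle_sets. of_int (sign (successor F)) * (\<Prod>e\<in>F. b e) *
        (\<Sum>M\<in>edge_matchings (S - tl ` F).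
          (-1) ^ card M * (\<Prod>e\<in>\<Union>M. b e) * (\<Prod>v\<in>S - tl ` F - tl ` \<Union>M. a v)))"
proof -
  have "of_int (sign (successor (F \<union> \<Union>M))) * ((\<Prod>e\<in>F \<union> \<Union>M. b e) * (\<Prod>v\<in>S - tl ` (F \<union> \<Union>M). a v))
      = of_int (sign (successor F)) * (\<Prod>e\<in>F. b e) *
        ((-1) ^ card M * (\<Prod>e\<in>\<Union>M. b e) * (\<Prod>v\<in>S - tl ` F - tl ` \<Union>M. a v))"
    if F: "F \<in> oriented_cycle_sets" and M: "M \<in> edge_matchings (S - tl ` F)" for F M
  proof -
    have Fc: "F \<in> cycle_sets" using F by (simp add: oriented_cycle_sets_def)
    have "finite (F \<union> \<Union>M)" by (rule finite_in_cycle_sets[OF cycle_sets_Un_matching[OF Fc M]])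
    then have "(\<Prod>e\<in>F \<union> \<Union>M. b e) = (\<Prod>e\<in>F. b e) * (\<Prod>e\<in>\<Union>M. b e)"
      by (intro prod.union_disjoint) (use edge_matchings_mem(3)[OF M] in auto)
    moreover have "S - tl ` (F \<union> \<Union>M) = S - tl ` F - tl ` \<Union>M" by auto
    ultimately show ?thesis by (simp add: sign_successor_Un_matching[OF Fc M] ac_simps)
  qed
  then show ?thesis
    unfolding permutation_sum_cycle_sets sum_cycle_sets_split sum_distrib_left
    by (intro sum.cong refl) auto
qed

end

section \<open>Orientations of 2-regular subgraphs\<close>

context arc_system begin

text \<open>With \<open>\<tau> e\<close> the other arc leaving \<open>tl e\<close>, the map \<open>\<phi> = \<tau> \<circ> rev\<close> walks along a cycle.
  As \<open>\<tau>\<close> and \<open>rev\<close> are fixed-point free involutions, the orbit of \<open>e\<close> never meets \<open>rev e\<close>.\<close>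

lemma two_regular_orientation:
  assumes C: "C \<subseteq> A" and rC: "rev ` C \<subseteq> C" and deg: "\<And>v. v \<in> tl ` C \<Longrightarrow> card {e \<in> C. tl e = v} = 2"
  obtains F where "F \<in> oriented_cycle_sets" "tl ` F = tl ` C"
proof -
  have "\<exists>e'. e' \<in> C \<and> e' \<noteq> e \<and> tl e' = tl e \<and> {f \<in> C. tl f = tl e} = {e, e'}" if e: "e \<in> C" for e
  proof -
    obtain x y where xy: "{f \<in> C. tl f = tl e} = {x, y}" "x \<noteq> y"
      using deg[of "tl e"] e by (auto simp: card_2_iff)
    moreover have "e \<in> {f \<in> C. tl f = tl e}" using e by simp
    moreover have "x \<in> C \<and> tl x = tl e" "y \<in> C \<and> tl y = tl e" using xy(1) by blast+
    ultimately show ?thesis by (metis insertE insert_commute singletonD)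
  qed
  then obtain \<tau> where \<tau>: "\<And>e. e \<in> C \<Longrightarrow> \<tau> e \<in> C \<and> \<tau> e \<noteq> e \<and> tl (\<tau> e) = tl e \<and> {f \<in> C. tl f = tl e} = {e, \<tau> e}"
    by metis
  have \<tau>_other: "f = \<tau> e" if "e \<in> C" "f \<in> C" "tl f = tl e" "f \<noteq> e" for e f
    using \<tau>[OF that(1)] that by blast
  have \<tau>\<tau>: "\<tau> (\<tau> e) = e" if "e \<in> C" for e
    using \<tau>_other[of "\<tau> e" e] \<tau>[OF that] that by metis
  have rev: "rev e \<in> C" "rev (rev e) = e" "rev e \<noteq> e" "tl (rev e) = hd e" if "e \<in> C" for e
    using that C rC rev_rev rev_neq tl_rev by blast+
  define \<phi> where "\<phi> e = \<tau> (rev e)" for e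
  have \<phi>C: "\<phi> e \<in> C" if "e \<in> C" for e using \<tau> rev that by (simp add: \<phi>_def)
  have \<phi>rev: "\<phi> (rev (\<phi> e)) = rev e" if "e \<in> C" for e
    using \<tau>\<tau> rev \<phi>C[OF that] that by (simp add: \<phi>_def)
  have \<phi>inj: "e = f" if "e \<in> C" "f \<in> C" "\<phi> e = \<phi> f" for e f
    using \<phi>rev that rev by metis
  have tl\<phi>: "tl (\<phi> e) = hd e" if "e \<in> C" for e
    using \<tau> rev that by (simp add: \<phi>_def)
  have pow: "(\<phi> ^^ k) e \<in> C" if "e \<in> C" for k e
    by (induction k) (auto simp: that \<phi>C)
  \<comment> \<open>By \<open>\<phi>rev\<close>, walking on from the reverse of an arc is walking
    backwards. An equation for \<open>e\<close> with exponent k + 2 thus becomes one for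
    \<open>\<phi> e\<close> with exponent k, and the exponents 0 and 1 are excluded because
    \<open>rev\<close> and \<open>\<tau>\<close> have no fixed points.\<close>
  have norev: "(\<phi> ^^ k) e \<noteq> rev e" if "e \<in> C" for k e
    using that
  proof (induction k arbitrary: e rule: induct_nat_012)
    case 0 then show ?case using rev by (metis funpow_0)
  next
    case 1 then show ?case using \<tau>[of "rev e"] rev by (simp add: \<phi>_def)
  next
    case (ge2 k)
    show ?case
    proof
      assume "(\<phi> ^^ Suc (Suc k)) e = rev e"
      then have "\<phi> ((\<phi> ^^ Suc k) e) = \<phi> (rev (\<phi> e))" using \<phi>rev ge2.prems by simp
      then have "(\<phi> ^^ Suc k) e = rev (\<phi> e)"
        using \<phi>inj[OF pow[OF ge2.prems] rev(1)[OF \<phi>C[OF ge2.prems]]] by blast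
      then have "(\<phi> ^^ k) (\<phi> e) = rev (\<phi> e)" by (simp add: funpow_swap1)
      then show False using ge2.IH(1)[OF \<phi>C[OF ge2.prems]] by simp
    qed
  qed
  have orb: "(\<phi> ^^ i) e \<noteq> rev ((\<phi> ^^ j) e)" if e: "e \<in> C" for i j e
  proof (induction j arbitrary: i)
    case 0 then show ?case using norev[OF e] by simp
  next
    case (Suc j)
    show ?case
    proof
      assume "(\<phi> ^^ i) e = rev ((\<phi> ^^ Suc j) e)"
      then have "(\<phi> ^^ Suc i) e = rev ((\<phi> ^^ j) e)" using \<phi>rev[OF pow[OF e, of j]] by simp
      then show False using Suc by blast
    qed
  qed
  \<comment> \<open>A largest \<open>\<phi>\<close>-invariant set without opposite arcs contains one
    orientation of every arc of \<open>C\<close>: otherwise the orbit of a missing arc could be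
    added.\<close>
  define P where "P F \<longleftrightarrow> F \<subseteq> C \<and> F \<inter> rev ` F = {} \<and> \<phi> ` F \<subseteq> F" for F
  have finC: "finite C" using C finite_A finite_subset by blast
  have "P {}" by (simp add: P_def)
  moreover have "\<forall>F. P F \<longrightarrow> card F < Suc (card C)" using finC by (auto simp: P_def less_Suc_eq_le intro: card_mono)
  ultimately obtain F where PF: "P F" and max: "\<And>F'. P F' \<Longrightarrow> card F' \<le> card F"
    using ex_has_greatest_nat[of P "{}" card "Suc (card C)"] by (metis (no_types))
  have F: "F \<subseteq> C" "F \<inter> rev ` F = {}" "\<phi> ` F \<subseteq> F" using PF by (auto simp: P_def)
  have finF: "finite F" using F finC finite_subset by blast
  have cover: "e \<in> F \<or> e \<in> rev ` F" if e: "e \<in> C" for e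
  proof (rule ccontr)
    assume ne: "\<not> (e \<in> F \<or> e \<in> rev ` F)"
    define Orb where "Orb = range (\<lambda>k. (\<phi> ^^ k) e)"
    have OC: "Orb \<subseteq> C" using pow[OF e] by (auto simp: Orb_def)
    have no: "(\<phi> ^^ i) e \<noteq> rev f" if "f \<in> F" for i f
      using that
    proof (induction i arbitrary: f)
      case 0 then show ?case using ne by auto
    next
      case (Suc i)
      show ?case
      proof
        assume "(\<phi> ^^ Suc i) e = rev f"
        then have "\<phi> ((\<phi> ^^ i) e) = \<phi> (rev (\<phi> f))" using \<phi>rev Suc.prems F by auto
        then have "(\<phi> ^^ i) e = rev (\<phi> f)"
          using \<phi>inj[OF pow[OF e] rev(1)[OF \<phi>C[of f]]] Suc.prems F(1) by blast
        moreover have "\<phi> f \<in> F" using F Suc.prems by blast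
        ultimately show False using Suc.IH by blast
      qed
    qed
    have disj: "x \<noteq> rev y" if xy: "x \<in> F \<union> Orb" "y \<in> F \<union> Orb" for x y
    proof
      assume eq: "x = rev y"
      have "y \<in> C" using xy(2) F(1) OC by blast
      then have eq': "y = rev x" using eq rev by simp
      consider "x \<in> F" "y \<in> F" | "x \<in> F" "y \<in> Orb" | "x \<in> Orb" "y \<in> F" | "x \<in> Orb" "y \<in> Orb"
        using xy by blast
      then show False
      proof cases
        case 1 then show ?thesis using F(2) eq by blast
      next
        case 2 then show ?thesis using no[OF 2(1)] eq' unfolding Orb_def by (metis rangeE)
      next
        case 3 then show ?thesis using no[OF 3(2)] eq unfolding Orb_def by (metis rangeE)
      next
        case 4
        then obtain i j where "x = (\<phi> ^^ i) e" "y = (\<phi> ^^ j) e" by (auto simp: Orb_def)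
        then show ?thesis using orb[OF e] eq by metis
      qed
    qed
    have "\<phi> x \<in> Orb" if x: "x \<in> Orb" for x
    proof -
      obtain i where "x = (\<phi> ^^ i) e" using x by (auto simp: Orb_def)
      then have "\<phi> x = (\<phi> ^^ Suc i) e" by simp
      then show ?thesis unfolding Orb_def by (metis rangeI)
    qed
    then have "\<phi> ` (F \<union> Orb) \<subseteq> F \<union> Orb" using F(3) by blast
    moreover have "(F \<union> Orb) \<inter> rev ` (F \<union> Orb) = {}" using disj by blast
    ultimately have "P (F \<union> Orb)" unfolding P_def using F(1) OC by simp
    then have "card (F \<union> Orb) \<le> card F" by (rule max)
    moreover have "finite (F \<union> Orb)" using finC F OC by (meson finite_subset le_sup_iff)
    ultimately have "F \<union> Orb = F" by (metis card_seteq sup_ge1)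
    moreover have "(\<phi> ^^ 0) e \<in> Orb" unfolding Orb_def by blast
    ultimately show False using ne by auto
  qed
  have surj: "\<phi> ` F = F"
    by (rule endo_inj_surj[OF finF F(3)]) (use \<phi>inj F(1) in \<open>auto intro!: inj_onI\<close>)
  \<comment> \<open>Two arcs with the same tail are exchanged by \<open>\<tau>\<close>. If one of
    them is \<open>\<phi> g\<close>, then the other is \<open>rev g\<close>, which \<open>F\<close>
    does not contain.\<close>
  have inj: "inj_on tl F"
  proof (rule inj_onI, rule ccontr)
    fix e f assume ef: "e \<in> F" "f \<in> F" "tl e = tl f" "e \<noteq> f"
    then have efC: "e \<in> C" "f \<in> C" using F(1) by auto
    have "f = \<tau> e" by (rule \<tau>_other) (use ef efC in auto)
    obtain g where g: "g \<in> F" "e = \<phi> g" using surj ef by blast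
    have "f = \<phi> (rev e)" using \<open>f = \<tau> e\<close> rev efC by (simp add: \<phi>_def)
    also have "\<dots> = rev g" using g F(1) \<phi>rev by blast
    finally show False using g ef F(2) by blast
  qed
  have hdtl: "hd ` F = tl ` F"
  proof -
    have "hd ` F = tl ` \<phi> ` F" using F(1) tl\<phi> by (force simp: image_image)
    then show ?thesis using surj by simp
  qed
  have "tl ` C = tl ` F"
  proof (intro equalityI subsetI)
    fix x assume "x \<in> tl ` C"
    then obtain e where e: "e \<in> C" "x = tl e" by auto
    show "x \<in> tl ` F"
    proof (cases "e \<in> F")
      case False
      then obtain f where "f \<in> F" "e = rev f" using cover e by blast
      then show ?thesis using e rev F(1) hdtl by (metis imageI subsetD)
    qed (use e in auto)
  qed (use F(1) in auto)
  then show ?thesis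
    using inj hdtl F C by (intro that[of F]) (auto simp: oriented_cycle_sets_def cycle_sets_def)
qed

text \<open>The arcs at \<open>v\<close> are the outgoing arc of its cycle and the reverse of the
  incoming one. They differ because \<open>F\<close> has no opposite arcs; this covers the loop as
  well.\<close>

lemma oriented_two_regular:
  assumes F: "F \<in> oriented_cycle_sets" and v: "v \<in> tl ` F"
  shows "card {e \<in> F \<union> rev ` F. tl e = v} = 2"
proof -
  have Fc: "F \<in> cycle_sets" and nr: "\<And>e. e \<in> F \<Longrightarrow> rev e \<notin> F"
    using F by (auto simp: oriented_cycle_sets_def)
  note FA = cycle_sets_subset[OF Fc]
  obtain e where e: "e \<in> F" "tl e = v" using v by auto
  obtain f where f: "f \<in> F" "hd f = v" using v cycle_sets_hd[OF Fc] by (metis imageE)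
  have "{x \<in> F \<union> rev ` F. tl x = v} = {e, rev f}"
  proof (intro equalityI subsetI)
    fix x assume "x \<in> {x \<in> F \<union> rev ` F. tl x = v}"
    then consider "x \<in> F" "tl x = v" | g where "g \<in> F" "x = rev g" "tl x = v" by auto
    then show "x \<in> {e, rev f}"
    proof cases
      case 1 then show ?thesis using e cycle_sets_inj[OF Fc] by (auto simp: inj_on_def)
    next
      case 2
      then have "hd g = v" using FA tl_rev by auto
      then have "g = f" using 2 f inj_on_hd[OF Fc] by (auto simp: inj_on_def)
      then show ?thesis using 2 by simp
    qed
  next
    fix x assume "x \<in> {e, rev f}"
    then show "x \<in> {x \<in> F \<union> rev ` F. tl x = v}" using e f FA tl_rev by auto
  qed
  moreover have "e \<noteq> rev f" using nr e f by auto
  ultimately show ?thesis by simp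
qed

end

section \<open>The fundamental group and its abelianization\<close>

text \<open>For an involution \<open>rv\<close>, this is the coefficient at \<open>e\<close> of the
  1-chain of the walk \<open>p\<close>: traversals of \<open>e\<close> minus traversals of its
  reverse.\<close>

definition net_count :: "('e \<Rightarrow> 'e) \<Rightarrow> 'e list \<Rightarrow> 'e \<Rightarrow> int" where
  "net_count rv p e = int (count_list p e) - int (count_list p (rv e))"

lemma net_count_Nil [simp]: "net_count rv [] e = 0"
  by (simp add: net_count_def)

lemma net_count_append [simp]: "net_count rv (p @ q) e = net_count rv p e + net_count rv q e"
  by (simp add: net_count_def)

definition rev_walk :: "('e \<Rightarrow> 'e) \<Rightarrow> 'e list \<Rightarrow> 'e list" where
  "rev_walk rv p = rev (map rv p)"

lemma rev_walk_simps [simp]: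
  "rev_walk rv [] = []" "rev_walk rv (e # p) = rev_walk rv p @ [rv e]"
  "rev_walk rv (p @ q) = rev_walk rv q @ rev_walk rv p"
  by (simp_all add: rev_walk_def)

definition list_mult :: "('g, 'm) monoid_scheme \<Rightarrow> ('e \<Rightarrow> 'g) \<Rightarrow> 'e list \<Rightarrow> 'g" where
  "list_mult A f p = foldr (\<lambda>e x. f e \<otimes>\<^bsub>A\<^esub> x) p \<one>\<^bsub>A\<^esub>"

lemma list_mult_simps [simp]:
  "list_mult A f [] = \<one>\<^bsub>A\<^esub>" "list_mult A f (e # p) = f e \<otimes>\<^bsub>A\<^esub> list_mult A f p"
  by (simp_all add: list_mult_def)

context comm_group begin

lemma list_mult_closed: "f \<in> set p \<rightarrow> carrier G \<Longrightarrow> list_mult G f p \<in> carrier G"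
  by (induction p) auto

lemma list_mult_remove:
  "f \<in> set (a @ e # b) \<rightarrow> carrier G \<Longrightarrow> list_mult G f (a @ e # b) = f e \<otimes> list_mult G f (a @ b)"
  by (induction a) (auto simp: list_mult_closed m_lcomm)

text \<open>The first letter must be balanced by a later occurrence of its reverse. Commutativity
  moves that one to the front, where the two factors cancel, and the shorter list still has net
  counts zero.\<close>

lemma list_mult_net_zero:
  assumes "f \<in> set p \<rightarrow> carrier G"
    and "\<And>e. e \<in> set p \<Longrightarrow> rv e \<noteq> e \<and> f (rv e) = inv (f e)"
    and "\<And>e. rv (rv e) = e"
    and "\<And>e. net_count rv p e = 0"
  shows "list_mult G f p = \<one>"
  using assms
proof (induction "length p" arbitrary: p rule: less_induct)
  case less
  show ?case
  proof (cases p)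
    case (Cons e p')
    have ne: "rv e \<noteq> e" "f (rv e) = inv (f e)" using less.prems(2) Cons by auto
    have "count_list p (rv e) > 0"
      using less.prems(4)[of e] Cons by (simp add: net_count_def)
    then have "count_list p' (rv e) > 0" using Cons ne by simp
    then have "rv e \<in> set p'" by (metis count_list_0_iff less_irrefl)
    then obtain a b where p': "p' = a @ rv e # b" by (meson split_list)
    have fe: "f e \<in> carrier G" using less.prems(1) Cons by auto
    have fp': "f \<in> set (a @ rv e # b) \<rightarrow> carrier G" using less.prems(1) Cons p' by auto
    have fab: "f \<in> set (a @ b) \<rightarrow> carrier G" using fp' by auto
    have IH: "list_mult G f (a @ b) = \<one>"
    proof (rule less.hyps)
      show "length (a @ b) < length p" using Cons p' by simp
      fix e'
      have "net_count rv p e' = net_count rv (a @ b) e'"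
        using Cons p' ne less.prems(3)[of e] less.prems(3)[of e'] by (auto simp: net_count_def)
      then show "net_count rv (a @ b) e' = 0" using less.prems(4) by simp
    qed (use fab less.prems Cons p' in auto)
    have "list_mult G f p = f e \<otimes> (inv (f e) \<otimes> list_mult G f (a @ b))"
      unfolding Cons p' list_mult_simps list_mult_remove[OF fp'] ne ..
    then show ?thesis using fe IH by simp
  qed simp
qed

end

section \<open>Homotopy classes of closed walks and their group structure\<close>

context bidirected_digraph begin

declare awalk_append_iff [simp del]

abbreviation "homotopy u \<equiv> walk_homotopy G arev u"
abbreviation "\<pi>\<^sub>1 u \<equiv> fundamental_group G arev u"
abbreviation "walk_class u p \<equiv> homotopy u `` {p}"

lemma awalk_rev_walk: "awalk x p y \<Longrightarrow> awalk y (rev_walk arev p) x"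
proof (induction p arbitrary: x)
  case (Cons e p)
  then have "awalk (head G e) p y" "e \<in> arcs G" "tail G e = x" by (auto simp: awalk_Cons_iff)
  then show ?case
    using Cons.IH by (auto intro!: awalk_appendI simp: awalk_Cons_iff awalk_Nil_iff)
qed (auto simp: awalk_Nil_iff)

lemma rev_walk_rev_walk [simp]: "rev_walk arev (rev_walk arev p) = p"
  by (simp add: rev_walk_def rev_map comp_def)

lemma net_count_rev_walk [simp]: "net_count arev (rev_walk arev p) e = - net_count arev p e"
proof -
  have "count_list (map arev p) e = count_list p (arev e)" for e
    by (induction p) (auto simp: arev_eq_iff)
  then show ?thesis by (simp add: net_count_def rev_walk_def)
qed

lemma backtracks_awalk:
  assumes "(p, q) \<in> backtracks G arev u"
  shows "awalk u p u \<and> awalk u q u"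
proof -
  obtain a e b where *: "p = a @ [e, arev e] @ b" "q = a @ b" "awalk u (a @ [e, arev e] @ b) u"
    using assms by (auto simp: backtracks_def)
  define x where "x = awlast u a"
  have 1: "awalk u a x" "awalk x ([e, arev e] @ b) u"
    using *(3) unfolding awalk_append_iff[of u a] x_def by auto
  have "awalk x b u" using 1(2) by (auto simp: awalk_Cons_iff)
  then show ?thesis using * 1(1) awalk_appendI by blast
qed

abbreviation "backtrack_step u \<equiv> backtracks G arev u \<union> (backtracks G arev u)\<inverse>"

lemma homotopy_iff:
  "(p, q) \<in> homotopy u \<longleftrightarrow> awalk u p u \<and> awalk u q u \<and> (p, q) \<in> (backtrack_step u)\<^sup>*"
  by (simp add: walk_homotopy_def)

lemma homotopy_refl: "awalk u p u \<Longrightarrow> (p, p) \<in> homotopy u"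
  by (simp add: homotopy_iff)

lemma homotopy_sym: "(p, q) \<in> homotopy u \<Longrightarrow> (q, p) \<in> homotopy u"
  unfolding homotopy_iff by (metis sym_Un_converse sym_rtrancl symD)

lemma homotopy_trans: "(p, q) \<in> homotopy u \<Longrightarrow> (q, r) \<in> homotopy u \<Longrightarrow> (p, r) \<in> homotopy u"
  unfolding homotopy_iff by auto

lemma homotopy_equiv: "equiv {p. awalk u p u} (homotopy u)"
  by (intro equivI refl_onI symI transI)
    (auto simp: homotopy_refl intro: homotopy_sym homotopy_trans, auto simp: homotopy_iff)

lemma walk_class_eq_iff:
  "awalk u p u \<Longrightarrow> awalk u q u \<Longrightarrow> walk_class u p = walk_class u q \<longleftrightarrow> (p, q) \<in> homotopy u"
  using eq_equiv_class_iff[OF homotopy_equiv] by blast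

lemma homotopy_backtrack:
  assumes "awalk u (a @ [e, arev e] @ b) u"
  shows "(a @ [e, arev e] @ b, a @ b) \<in> homotopy u"
proof -
  have "(a @ [e, arev e] @ b, a @ b) \<in> backtracks G arev u"
    using assms by (auto simp: backtracks_def)
  then show ?thesis using backtracks_awalk by (auto simp: homotopy_iff)
qed

lemma backtracks_append:
  assumes "(p, q) \<in> backtracks G arev u" "awalk u r u"
  shows "(p @ r, q @ r) \<in> backtracks G arev u" "(r @ p, r @ q) \<in> backtracks G arev u"
proof -
  obtain a e b where *: "p = a @ [e, arev e] @ b" "q = a @ b"
    using assms by (auto simp: backtracks_def)
  have "awalk u (p @ r) u" "awalk u (r @ p) u"
    using backtracks_awalk[OF assms(1)] assms(2) awalk_appendI by blast+
  moreover have "p @ r = a @ [e, arev e] @ (b @ r)" "q @ r = a @ (b @ r)"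
    "r @ p = (r @ a) @ [e, arev e] @ b" "r @ q = (r @ a) @ b" using * by auto
  ultimately show "(p @ r, q @ r) \<in> backtracks G arev u" "(r @ p, r @ q) \<in> backtracks G arev u"
    unfolding backtracks_def mem_Collect_eq by (metis)+
qed

lemma homotopy_append_right:
  assumes "(p, q) \<in> homotopy u" "awalk u r u"
  shows "(p @ r, q @ r) \<in> homotopy u"
proof -
  have "(p, q) \<in> (backtrack_step u)\<^sup>*" using assms by (simp add: homotopy_iff)
  then have "(p @ r, q @ r) \<in> (backtrack_step u)\<^sup>*"
    by induction (use backtracks_append(1)[OF _ assms(2)] in \<open>auto intro: rtrancl_into_rtrancl\<close>)
  then show ?thesis using assms awalk_appendI unfolding homotopy_iff by blast
qed

lemma homotopy_append_left:
  assumes "(p, q) \<in> homotopy u" "awalk u r u"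
  shows "(r @ p, r @ q) \<in> homotopy u"
proof -
  have "(p, q) \<in> (backtrack_step u)\<^sup>*" using assms by (simp add: homotopy_iff)
  then have "(r @ p, r @ q) \<in> (backtrack_step u)\<^sup>*"
    by induction (use backtracks_append(2)[OF _ assms(2)] in \<open>auto intro: rtrancl_into_rtrancl\<close>)
  then show ?thesis using assms awalk_appendI unfolding homotopy_iff by blast
qed

lemma homotopy_append:
  "(p, p') \<in> homotopy u \<Longrightarrow> (q, q') \<in> homotopy u \<Longrightarrow> (p @ q, p' @ q') \<in> homotopy u"
  by (meson homotopy_append_left homotopy_append_right homotopy_trans homotopy_iff)

text \<open>The induction removes \<open>r\<close> from the inside out: the first arc is attached to
  \<open>a\<close> and its reverse to \<open>b\<close>, and they form the last backtrack to
  go.\<close>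

lemma homotopy_cancel:
  assumes "awalk u a x" "awalk x r y" "awalk x b u"
  shows "(a @ r @ rev_walk arev r @ b, a @ b) \<in> homotopy u"
  using assms
proof (induction r arbitrary: a x b)
  case Nil
  then show ?case by (auto simp: homotopy_refl awalk_appendI)
next
  case (Cons e r)
  then have e: "e \<in> arcs G" "tail G e = x" "awalk (head G e) r y" by (auto simp: awalk_Cons_iff)
  have x: "awalk x [e] (head G e)" "awalk (head G e) [arev e] x" using e
    by (auto simp: awalk_Cons_iff awalk_Nil_iff)
  have "((a @ [e]) @ r @ rev_walk arev r @ ([arev e] @ b), (a @ [e]) @ ([arev e] @ b)) \<in> homotopy u"
    by (rule Cons.IH) (use Cons.prems e x awalk_appendI in blast)+
  moreover have "(a @ [e, arev e] @ b, a @ b) \<in> homotopy u"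
  proof (rule homotopy_backtrack)
    have "awalk u (a @ [e] @ [arev e] @ b) u" using Cons.prems x awalk_appendI by blast
    then show "awalk u (a @ [e, arev e] @ b) u" by simp
  qed
  ultimately show ?case using homotopy_trans by simp
qed

lemma fundamental_group_simps:
  "carrier (\<pi>\<^sub>1 u) = {p. awalk u p u} // homotopy u"
  "\<one>\<^bsub>\<pi>\<^sub>1 u\<^esub> = walk_class u []"
  by (simp_all add: fundamental_group_def)

lemma walk_class_in_carrier: "awalk u p u \<Longrightarrow> walk_class u p \<in> carrier (\<pi>\<^sub>1 u)"
  by (auto simp: fundamental_group_simps quotient_def)

lemma carrier_cases:
  assumes "x \<in> carrier (\<pi>\<^sub>1 u)"
  obtains p where "awalk u p u" "x = walk_class u p"
  using assms by (auto simp: fundamental_group_simps quotient_def)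

lemma walk_class_mult:
  assumes "awalk u p u" "awalk u q u"
  shows "walk_class u p \<otimes>\<^bsub>\<pi>\<^sub>1 u\<^esub> walk_class u q = walk_class u (p @ q)"
proof -
  have "walk_class u (p' @ q') = walk_class u (p @ q)"
    if "(p, p') \<in> homotopy u" "(q, q') \<in> homotopy u" for p' q'
    using homotopy_append[OF that] equiv_class_eq[OF homotopy_equiv] by blast
  moreover have "(p, p) \<in> homotopy u" "(q, q) \<in> homotopy u" using assms homotopy_refl by auto
  ultimately have "(\<Union>p'\<in>walk_class u p. \<Union>q'\<in>walk_class u q. walk_class u (p' @ q')) = walk_class u (p @ q)"
    by blast
  then show ?thesis by (simp add: fundamental_group_def)
qed

lemma fundamental_group_group:
  assumes "u \<in> verts G"
  shows "Group.group (\<pi>\<^sub>1 u)"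
proof -
  have nil: "awalk u [] u" using assms by (simp add: awalk_Nil_iff)
  show ?thesis
  proof (rule groupI)
    fix x y z assume "x \<in> carrier (\<pi>\<^sub>1 u)" "y \<in> carrier (\<pi>\<^sub>1 u)" "z \<in> carrier (\<pi>\<^sub>1 u)"
    then show "x \<otimes>\<^bsub>\<pi>\<^sub>1 u\<^esub> y \<otimes>\<^bsub>\<pi>\<^sub>1 u\<^esub> z = x \<otimes>\<^bsub>\<pi>\<^sub>1 u\<^esub> (y \<otimes>\<^bsub>\<pi>\<^sub>1 u\<^esub> z)"
      by (elim carrier_cases) (simp add: walk_class_mult awalk_appendI[of u _ u])
  next
    fix x y assume "x \<in> carrier (\<pi>\<^sub>1 u)" "y \<in> carrier (\<pi>\<^sub>1 u)"
    then show "x \<otimes>\<^bsub>\<pi>\<^sub>1 u\<^esub> y \<in> carrier (\<pi>\<^sub>1 u)"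
      by (elim carrier_cases) (auto simp: walk_class_mult intro!: walk_class_in_carrier awalk_appendI[of u _ u])
  next
    show "\<one>\<^bsub>\<pi>\<^sub>1 u\<^esub> \<in> carrier (\<pi>\<^sub>1 u)"
      using nil by (simp add: fundamental_group_simps(2) walk_class_in_carrier)
  next
    fix x assume "x \<in> carrier (\<pi>\<^sub>1 u)"
    then obtain p where p: "awalk u p u" "x = walk_class u p" by (rule carrier_cases)
    then show "\<one>\<^bsub>\<pi>\<^sub>1 u\<^esub> \<otimes>\<^bsub>\<pi>\<^sub>1 u\<^esub> x = x"
      by (simp add: fundamental_group_simps(2) walk_class_mult nil)
    have r: "awalk u (rev_walk arev p) u" using awalk_rev_walk p by blast
    have "(rev_walk arev p @ p, []) \<in> homotopy u"
      using homotopy_cancel[OF nil r nil] by simp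
    then have "walk_class u (rev_walk arev p) \<otimes>\<^bsub>\<pi>\<^sub>1 u\<^esub> x = \<one>\<^bsub>\<pi>\<^sub>1 u\<^esub>"
      unfolding p(2) walk_class_mult[OF r p(1)] fundamental_group_simps(2)
      by (rule equiv_class_eq[OF homotopy_equiv])
    then show "\<exists>y\<in>carrier (\<pi>\<^sub>1 u). y \<otimes>\<^bsub>\<pi>\<^sub>1 u\<^esub> x = \<one>\<^bsub>\<pi>\<^sub>1 u\<^esub>"
      using walk_class_in_carrier[OF r] by blast
  qed
qed

lemma walk_class_inverse:
  assumes p: "awalk u p u"
  shows "inv\<^bsub>\<pi>\<^sub>1 u\<^esub> walk_class u p = walk_class u (rev_walk arev p)"
proof -
  have u: "u \<in> verts G" using p awalk_hd_in_verts by blast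
  interpret Group.group "\<pi>\<^sub>1 u" by (rule fundamental_group_group[OF u])
  have nil: "awalk u [] u" using u by (simp add: awalk_Nil_iff)
  have r: "awalk u (rev_walk arev p) u" using awalk_rev_walk p by blast
  have "(rev_walk arev p @ p, []) \<in> homotopy u"
    using homotopy_cancel[OF nil r nil] by simp
  then have "walk_class u (rev_walk arev p) \<otimes>\<^bsub>\<pi>\<^sub>1 u\<^esub> walk_class u p = \<one>\<^bsub>\<pi>\<^sub>1 u\<^esub>"
    unfolding walk_class_mult[OF r p(1)] fundamental_group_simps(2)
    by (rule equiv_class_eq[OF homotopy_equiv])
  then show ?thesis by (intro inv_equality walk_class_in_carrier p r)
qed

section \<open>Net counts and the commutator subgroup\<close>

lemma net_count_homotopy:
  assumes "(p, q) \<in> homotopy u"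
  shows "net_count arev p e = net_count arev q e"
proof -
  have bt: "net_count arev p e = net_count arev q e" if "(p, q) \<in> backtracks G arev u" for p q
    using that by (auto simp: backtracks_def net_count_def arev_eq_iff)
  have "(p, q) \<in> (backtrack_step u)\<^sup>*" using assms by (simp add: homotopy_iff)
  then show ?thesis by induction (use bt in auto)
qed

text \<open>Net counts are additive and change sign under reversal. So the classes of walks with
  vanishing net counts form a subgroup, and it contains every commutator.\<close>

lemma derived_imp_net_zero:
  assumes p: "awalk u p u"
    and d: "walk_class u p \<in> derived (\<pi>\<^sub>1 u) (carrier (\<pi>\<^sub>1 u))"
  shows "net_count arev p e = 0"
proof -
  have u: "u \<in> verts G" using p awalk_hd_in_verts by blast
  interpret Group.group "\<pi>\<^sub>1 u" by (rule fundamental_group_group[OF u])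
  have nil: "awalk u [] u" using u by (simp add: awalk_Nil_iff)
  define K where "K = {walk_class u q | q. awalk u q u \<and> (\<forall>e. net_count arev q e = 0)}"
  have "subgroup K (\<pi>\<^sub>1 u)"
  proof (rule subgroupI)
    show "K \<subseteq> carrier (\<pi>\<^sub>1 u)" using walk_class_in_carrier by (auto simp: K_def)
    show "K \<noteq> {}" using nil by (auto simp: K_def)
  next
    fix a assume "a \<in> K"
    then obtain q where "awalk u q u" "\<forall>e. net_count arev q e = 0" "a = walk_class u q"
      by (auto simp: K_def)
    then show "inv\<^bsub>\<pi>\<^sub>1 u\<^esub> a \<in> K"
      unfolding K_def using awalk_rev_walk by (auto simp: walk_class_inverse intro!: exI[of _ "rev_walk arev q"])
  next
    fix a b assume "a \<in> K" "b \<in> K"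
    then obtain q r where "awalk u q u" "\<forall>e. net_count arev q e = 0" "a = walk_class u q"
      "awalk u r u" "\<forall>e. net_count arev r e = 0" "b = walk_class u r"
      by (auto simp: K_def)
    then show "a \<otimes>\<^bsub>\<pi>\<^sub>1 u\<^esub> b \<in> K"
      unfolding K_def by (auto simp: walk_class_mult intro!: exI[of _ "q @ r"] awalk_appendI[of u _ u])
  qed
  moreover have "derived_set (\<pi>\<^sub>1 u) (carrier (\<pi>\<^sub>1 u)) \<subseteq> K"
  proof clarify
    fix a b assume "a \<in> carrier (\<pi>\<^sub>1 u)" "b \<in> carrier (\<pi>\<^sub>1 u)"
    then obtain q r where qr: "awalk u q u" "a = walk_class u q" "awalk u r u" "b = walk_class u r"
      by (elim carrier_cases)
    let ?c = "q @ r @ rev_walk arev q @ rev_walk arev r"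
    have "awalk u ?c u" using qr awalk_rev_walk by (intro awalk_appendI[of u _ u]) auto
    moreover have "a \<otimes>\<^bsub>\<pi>\<^sub>1 u\<^esub> b \<otimes>\<^bsub>\<pi>\<^sub>1 u\<^esub> inv\<^bsub>\<pi>\<^sub>1 u\<^esub> a \<otimes>\<^bsub>\<pi>\<^sub>1 u\<^esub> inv\<^bsub>\<pi>\<^sub>1 u\<^esub> b = walk_class u ?c"
      using qr awalk_rev_walk
      by (simp add: walk_class_mult walk_class_inverse awalk_appendI[of u _ u])
    ultimately show "a \<otimes>\<^bsub>\<pi>\<^sub>1 u\<^esub> b \<otimes>\<^bsub>\<pi>\<^sub>1 u\<^esub> inv\<^bsub>\<pi>\<^sub>1 u\<^esub> a \<otimes>\<^bsub>\<pi>\<^sub>1 u\<^esub> inv\<^bsub>\<pi>\<^sub>1 u\<^esub> b \<in> K"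
      unfolding K_def by auto
  qed
  ultimately have "derived (\<pi>\<^sub>1 u) (carrier (\<pi>\<^sub>1 u)) \<subseteq> K"
    unfolding derived_def by (rule generate_subgroup_incl[rotated])
  then obtain q where q: "awalk u q u" "\<forall>e. net_count arev q e = 0" "walk_class u p = walk_class u q"
    using d by (auto simp: K_def)
  then have "(p, q) \<in> homotopy u" using walk_class_eq_iff p by blast
  then show ?thesis using net_count_homotopy q by metis
qed

text \<open>Conjugating each arc by fixed paths to the base point writes a closed walk as a product of
  classes \<open>c e\<close> with \<open>c (arev e) = inv (c e)\<close>; these can be reordered in the abelianization.\<close>

lemma net_zero_imp_derived:
  assumes p: "awalk u p u" and net: "\<And>e. net_count arev p e = 0"
  shows "walk_class u p \<in> derived (\<pi>\<^sub>1 u) (carrier (\<pi>\<^sub>1 u))"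
proof -
  have u: "u \<in> verts G" using p awalk_hd_in_verts by blast
  interpret Group.group "\<pi>\<^sub>1 u" by (rule fundamental_group_group[OF u])
  have nil: "awalk u [] u" using u by (simp add: awalk_Nil_iff)
  let ?D = "derived (\<pi>\<^sub>1 u) (carrier (\<pi>\<^sub>1 u))"
  have normal: "?D \<lhd> \<pi>\<^sub>1 u" by (rule derived_self_is_normal)
  interpret Ab: comm_group "\<pi>\<^sub>1 u Mod ?D" by (rule derived_quot_is_comm_group)
  define \<psi> where "\<psi> x = ?D #>\<^bsub>\<pi>\<^sub>1 u\<^esub> x" for x
  have hom: "group_hom (\<pi>\<^sub>1 u) (\<pi>\<^sub>1 u Mod ?D) \<psi>"
    unfolding \<psi>_def
    by (intro group_hom.intro group_hom_axioms.intro normal.r_coset_hom_Mod[OF normal]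
        Ab.is_group is_group)
  interpret hom: group_hom "\<pi>\<^sub>1 u" "\<pi>\<^sub>1 u Mod ?D" \<psi> by (rule hom)
  define R where "R = {x. \<exists>q. awalk u q x}"
  have "\<exists>P. \<forall>x\<in>R. awalk u (P x) x" by (rule bchoice) (simp add: R_def)
  then obtain P where P0: "\<And>x. x \<in> R \<Longrightarrow> awalk u (P x) x" by blast
  \<comment> \<open>With the empty path at \<open>u\<close> itself, conjugation leaves a closed walk
    at \<open>u\<close> unchanged.\<close>
  define P' where "P' = P(u := [])"
  have P: "awalk u (P' x) x" if "x \<in> R" for x using P0 that nil by (auto simp: P'_def)
  have P'u: "P' u = []" by (simp add: P'_def)
  define c where "c e = P' (tail G e) @ [e] @ rev_walk arev (P' (head G e))" for e
  define f where "f e = \<psi> (walk_class u (c e))" for e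
  have Rstep: "head G e \<in> R \<longleftrightarrow> tail G e \<in> R" if "e \<in> arcs G" for e
  proof -
    have "awalk (tail G e) [e] (head G e)" "awalk (head G e) [arev e] (tail G e)"
      using that by (auto simp: awalk_simps)
    then show ?thesis unfolding R_def using awalk_appendI by blast
  qed
  have c: "awalk u (c e) u" if "e \<in> arcs G" "tail G e \<in> R" for e
  proof -
    have "awalk (tail G e) [e] (head G e)" using that by (auto simp: awalk_simps)
    moreover have "awalk u (P' (head G e)) (head G e)" using P Rstep that by blast
    ultimately show ?thesis unfolding c_def using P[OF that(2)] awalk_rev_walk awalk_appendI by meson
  qed
  have c_arev: "c (arev e) = rev_walk arev (c e)" if "e \<in> arcs G" for e
    using that by (simp add: c_def)
  have finv: "f (arev e) = inv\<^bsub>\<pi>\<^sub>1 u Mod ?D\<^esub> f e" if "e \<in> arcs G" "tail G e \<in> R" for e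
    unfolding f_def c_arev[OF that(1)] walk_class_inverse[OF c[OF that], symmetric]
    by (rule hom.hom_inv) (rule walk_class_in_carrier[OF c[OF that]])
  \<comment> \<open>Between consecutive arcs a connecting path and its reverse cancel, so the
    product of the conjugated arcs telescopes to the whole walk with one path at each end.\<close>
  have main: "list_mult (\<pi>\<^sub>1 u Mod ?D) f q = \<psi> (walk_class u (P' x @ q @ rev_walk arev (P' y))) \<and>
      (\<forall>e\<in>set q. e \<in> arcs G \<and> tail G e \<in> R)"
    if "awalk x q y" "x \<in> R" for x q y
    using that
  proof (induction q arbitrary: x)
    case Nil
    have "(P' x @ rev_walk arev (P' x), []) \<in> homotopy u"
      using homotopy_cancel[OF nil P[OF Nil.prems(2)] nil] by simp
    then have "walk_class u (P' x @ rev_walk arev (P' x)) = \<one>\<^bsub>\<pi>\<^sub>1 u\<^esub>"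
      unfolding fundamental_group_simps by (rule equiv_class_eq[OF homotopy_equiv])
    moreover have "y = x" using Nil.prems by (simp add: awalk_Nil_iff)
    ultimately show ?case by (simp add: hom.hom_one)
  next
    case (Cons e q)
    then have e: "e \<in> arcs G" "tail G e = x" "awalk (head G e) q y" by (auto simp: awalk_Cons_iff)
    then have hR: "head G e \<in> R" using Rstep Cons.prems by blast
    have yR: "y \<in> R" using hR e awalk_appendI unfolding R_def by blast
    note IH = Cons.IH[OF e(3) hR]
    let ?q = "P' (head G e) @ q @ rev_walk arev (P' y)"
    let ?h = "P' (head G e)"
    have Q: "awalk u ?q u" using P[OF hR] e(3) awalk_rev_walk[OF P[OF yR]] awalk_appendI by meson
    have ce: "awalk u (c e) u" using c e Cons.prems by blast
    have xe: "awalk u (P' x @ [e]) (head G e)"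
      using P[OF Cons.prems(2)] e by (intro awalk_appendI[of u _ x]) (auto simp: awalk_simps)
    have qy: "awalk (head G e) (q @ rev_walk arev (P' y)) u"
      using e(3) awalk_rev_walk[OF P[OF yR]] awalk_appendI by meson
    have hr: "awalk (head G e) (rev_walk arev ?h) u" using awalk_rev_walk[OF P[OF hR]] .
    have "((P' x @ [e]) @ rev_walk arev ?h @ rev_walk arev (rev_walk arev ?h) @ (q @ rev_walk arev (P' y)),
      (P' x @ [e]) @ (q @ rev_walk arev (P' y))) \<in> homotopy u"
      by (rule homotopy_cancel[OF xe hr qy])
    then have "walk_class u (c e @ ?q) = walk_class u (P' x @ (e # q) @ rev_walk arev (P' y))"
      using e by (intro equiv_class_eq[OF homotopy_equiv]) (simp add: c_def)
    then have "walk_class u (c e) \<otimes>\<^bsub>\<pi>\<^sub>1 u\<^esub> walk_class u ?q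
        = walk_class u (P' x @ (e # q) @ rev_walk arev (P' y))"
      using walk_class_mult[OF ce Q] by simp
    then have "\<psi> (walk_class u (P' x @ (e # q) @ rev_walk arev (P' y)))
      = \<psi> (walk_class u (c e)) \<otimes>\<^bsub>\<pi>\<^sub>1 u Mod ?D\<^esub> \<psi> (walk_class u ?q)"
      using hom.hom_mult[OF walk_class_in_carrier[OF ce] walk_class_in_carrier[OF Q]] by simp
    then show ?case using IH e Cons.prems(2) by (simp add: f_def)
  qed
  have uR: "u \<in> R" using nil by (auto simp: R_def)
  have "\<psi> (walk_class u p) = list_mult (\<pi>\<^sub>1 u Mod ?D) f p"
    using main[OF p uR] by (simp add: P'u)
  also have "\<dots> = \<one>\<^bsub>\<pi>\<^sub>1 u Mod ?D\<^esub>"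
  proof (rule Ab.list_mult_net_zero[where rv = arev])
    show "f \<in> set p \<rightarrow> carrier (\<pi>\<^sub>1 u Mod ?D)"
      using main[OF p uR] c walk_class_in_carrier unfolding f_def by auto
    show "arev e \<noteq> e \<and> f (arev e) = inv\<^bsub>\<pi>\<^sub>1 u Mod ?D\<^esub> f e" if "e \<in> set p" for e
      using main[OF p uR] that finv arev_neq by blast
  qed (use net in auto)
  also have "\<dots> = ?D" by (simp add: FactGroup_def)
  finally have "?D #>\<^bsub>\<pi>\<^sub>1 u\<^esub> walk_class u p = ?D" by (simp add: \<psi>_def)
  then show ?thesis
    using coset_join1 walk_class_in_carrier[OF p] normal normal_imp_subgroup by blast
qed

end

section \<open>Walks in coverings\<close>

locale graph_cover = base: bidirected_digraph G arev + cover: bidirected_digraph G' arev'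
  for G :: "('v, 'e) pre_digraph" and arev and G' :: "('x, 'a) pre_digraph" and arev' +
  fixes pV :: "'x \<Rightarrow> 'v" and pE :: "'a \<Rightarrow> 'e"
  assumes covering: "graph_covering G arev G' arev' pV pE"
begin

lemma pV_verts: "x \<in> verts G' \<Longrightarrow> pV x \<in> verts G"
  using covering by (auto simp: graph_covering_def)

lemma pE_arcs:
  assumes "e \<in> arcs G'"
  shows "pE e \<in> arcs G" "tail G (pE e) = pV (tail G' e)" "head G (pE e) = pV (head G' e)"
    "pE (arev' e) = arev (pE e)"
  using covering assms by (auto simp: graph_covering_def)

lemma pE_bij: "x \<in> verts G' \<Longrightarrow> bij_betw pE (out_arcs G' x) (out_arcs G (pV x))"
  using covering by (auto simp: graph_covering_def)

lemma awalk_project: "cover.awalk x p y \<Longrightarrow> base.awalk (pV x) (map pE p) (pV y)"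
  by (induction p arbitrary: x)
    (auto simp: cover.awalk_simps base.awalk_simps pV_verts pE_arcs)

lemma arc_lift:
  assumes "x \<in> verts G'" "e \<in> arcs G" "tail G e = pV x"
  obtains e' where "e' \<in> arcs G'" "tail G' e' = x" "pE e' = e"
proof -
  have "e \<in> pE ` out_arcs G' x"
    using pE_bij[OF assms(1)] assms by (auto simp: bij_betw_def)
  then show ?thesis using that by auto
qed

lemma arc_lift_unique:
  assumes "e \<in> arcs G'" "e' \<in> arcs G'" "tail G' e = tail G' e'" "pE e = pE e'"
  shows "e = e'"
proof -
  have "inj_on pE (out_arcs G' (tail G' e))"
    using pE_bij[of "tail G' e"] assms(1) by (auto simp: bij_betw_def)
  then show ?thesis using assms by (auto simp: inj_on_def)
qed

lemma awalk_lift_unique: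
  assumes "cover.awalk x p y" "cover.awalk x p' y'" "map pE p = map pE p'"
  shows "p = p' \<and> y = y'"
  using assms
proof (induction p arbitrary: x p')
  case Nil
  then show ?case by (auto simp: cover.awalk_Nil_iff)
next
  case (Cons e p)
  then obtain e' q where p': "p' = e' # q" "pE e = pE e'" "map pE p = map pE q" by (cases p') auto
  have *: "e \<in> arcs G'" "tail G' e = x" "cover.awalk (head G' e) p y"
    "e' \<in> arcs G'" "tail G' e' = x" "cover.awalk (head G' e') q y'"
    using Cons.prems p' by (auto simp: cover.awalk_Cons_iff)
  then have "e = e'" using arc_lift_unique p' by metis
  then show ?case using Cons.IH * p' by blast
qed

text \<open>An arc is determined by its projection and its tail, so the lift of a backtrack is
  itself a backtrack.\<close>

lemma backtrack_remove_lift: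
  assumes "cover.awalk x p y" "map pE p = a @ [e, arev e] @ b"
  obtains p' where "cover.awalk x p' y" "map pE p' = a @ b"
proof -
  obtain a' e1 e2 b' where p: "p = a' @ e1 # e2 # b'" "map pE a' = a" "pE e1 = e" "pE e2 = arev e" "map pE b' = b"
    using assms(2) by (auto simp: map_eq_append_conv map_eq_Cons_conv)
  have w: "cover.awalk x a' (cover.awlast x a')" "cover.awalk (cover.awlast x a') (e1 # e2 # b') y"
    using assms(1) cover.awalk_append_iff p(1) by metis+
  then have e: "e1 \<in> arcs G'" "cover.awlast x a' = tail G' e1" "e2 \<in> arcs G'" "head G' e1 = tail G' e2"
    "cover.awalk (head G' e2) b' y"
    by (auto simp: cover.awalk_Cons_iff)
  have "e2 = arev' e1" using e p by (intro arc_lift_unique) (auto simp: pE_arcs)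
  then have "cover.awalk (tail G' e1) b' y" using e by simp
  then have "cover.awalk x (a' @ b') y" using w(1) e cover.awalk_appendI by metis
  then show ?thesis using that p by auto
qed

lemma backtrack_insert_lift:
  assumes "cover.awalk x p y" "map pE p = a @ b" "base.awalk (pV x) (a @ [e, arev e] @ b) v"
  obtains p' where "cover.awalk x p' y" "map pE p' = a @ [e, arev e] @ b"
proof -
  obtain a' b' where p: "p = a' @ b'" "map pE a' = a" "map pE b' = b"
    using assms(2) by (auto simp: map_eq_append_conv)
  define z where "z = cover.awlast x a'"
  have w: "cover.awalk x a' z" "cover.awalk z b' y"
    using assms(1) cover.awalk_append_iff p(1) z_def by metis+
  have wb: "base.awalk (pV x) a (base.awlast (pV x) a)"
      "base.awalk (base.awlast (pV x) a) (e # arev e # b) v"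
    using assms(3) base.awalk_append_iff by (metis append_Cons append_Nil)+
  have "base.awalk (pV x) a (pV z)" using awalk_project[OF w(1)] p by simp
  then have "base.awlast (pV x) a = pV z" by simp
  then have e: "e \<in> arcs G" "tail G e = pV z" using wb by (auto simp: base.awalk_Cons_iff)
  have z: "z \<in> verts G'" using w by (auto dest: cover.awalk_hd_in_verts)
  obtain e' where e': "e' \<in> arcs G'" "tail G' e' = z" "pE e' = e" using arc_lift[OF z e] .
  have "cover.awalk z (e' # arev' e' # b') y" using e' w by (auto simp: cover.awalk_Cons_iff)
  then have "cover.awalk x (a' @ (e' # arev' e' # b')) y" using w cover.awalk_appendI by blast
  then show ?thesis using that p e' by (auto simp: pE_arcs)
qed

text \<open>A homotopy in the base does not move the end point of a lift. This is what later decides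
  whether a lifted walk closes up.\<close>

lemma homotopy_lift:
  assumes "(q, q') \<in> base.homotopy (pV x)" "cover.awalk x p y" "map pE p = q"
  obtains p' where "cover.awalk x p' y" "map pE p' = q'"
proof -
  have "(q, q') \<in> (base.backtrack_step (pV x))\<^sup>*" using assms(1) by (simp add: base.homotopy_iff)
  then have "\<exists>p'. cover.awalk x p' y \<and> map pE p' = q'"
  proof induction
    case base
    then show ?case using assms by blast
  next
    case (step r s)
    then obtain p' where p': "cover.awalk x p' y" "map pE p' = r" by blast
    from step(2) consider "(r, s) \<in> backtracks G arev (pV x)" | "(s, r) \<in> backtracks G arev (pV x)" by auto
    then show ?case
    proof cases
      case 1
      then obtain a e b where "r = a @ [e, arev e] @ b" "s = a @ b" by (auto simp: backtracks_def)
      then show ?thesis using backtrack_remove_lift[OF p'(1)] p'(2) by metis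
    next
      case 2
      then obtain a e b where "s = a @ [e, arev e] @ b" "r = a @ b"
        "base.awalk (pV x) (a @ [e, arev e] @ b) (pV x)" by (auto simp: backtracks_def)
      then show ?thesis using backtrack_insert_lift[OF p'(1)] p'(2) by metis
    qed
  qed
  then show ?thesis using that by blast
qed

lemma homotopy_project:
  assumes "(p, q) \<in> cover.homotopy x"
  shows "(map pE p, map pE q) \<in> base.homotopy (pV x)"
proof -
  have bt: "(map pE p, map pE q) \<in> backtracks G arev (pV x)" if pq: "(p, q) \<in> backtracks G' arev' x" for p q
  proof -
    obtain a e b where *: "p = a @ [e, arev' e] @ b" "q = a @ b" "cover.awalk x (a @ [e, arev' e] @ b) x"
      using pq by (auto simp: backtracks_def)
    have "set (a @ [e, arev' e] @ b) \<subseteq> arcs G'" using *(3) by (simp only: cover.awalk_def)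
    then have "e \<in> arcs G'" by simp
    then have "map pE p = map pE a @ [pE e, arev (pE e)] @ map pE b"
      using * by (simp add: pE_arcs)
    moreover have "base.awalk (pV x) (map pE p) (pV x)" using awalk_project * by blast
    ultimately show ?thesis using *(2) unfolding backtracks_def mem_Collect_eq by (metis map_append)
  qed
  have w: "cover.awalk x p x" "cover.awalk x q x" and
    r: "(p, q) \<in> (cover.backtrack_step x)\<^sup>*" using assms by (auto simp: cover.homotopy_iff)
  from r have "(map pE p, map pE q) \<in> (base.backtrack_step (pV x))\<^sup>*"
    by induction (use bt in \<open>auto intro: rtrancl_into_rtrancl\<close>)
  then show ?thesis using w awalk_project by (auto simp: base.homotopy_iff)
qed

lemma induced_hom_walk_class:
  assumes "cover.awalk x p x"
  shows "induced_hom G arev (pV x) pE (cover.walk_class x p) = base.walk_class (pV x) (map pE p)"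
proof -
  have "base.walk_class (pV x) (map pE q) = base.walk_class (pV x) (map pE p)"
    if "(p, q) \<in> cover.homotopy x" for q
    using homotopy_project[OF that] equiv_class_eq[OF base.homotopy_equiv] by blast
  moreover have "(p, p) \<in> cover.homotopy x" using assms cover.homotopy_refl by blast
  ultimately show ?thesis unfolding induced_hom_def by blast
qed

end

locale abelian_cover = graph_cover +
  assumes derived_image: "x \<in> verts G' \<Longrightarrow>
       induced_hom G arev (pV x) pE ` carrier (fundamental_group G' arev' x) =
       derived (fundamental_group G arev (pV x)) (carrier (fundamental_group G arev (pV x)))"
begin

lemma closed_walk_net_zero:
  assumes p: "cover.awalk x p x"
  shows "net_count arev (map pE p) e = 0"
proof -
  have "x \<in> verts G'" using p by (auto dest: cover.awalk_hd_in_verts)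
  then have "base.walk_class (pV x) (map pE p)
      \<in> derived (fundamental_group G arev (pV x)) (carrier (fundamental_group G arev (pV x)))"
    using derived_image cover.walk_class_in_carrier[OF p] induced_hom_walk_class[OF p] by blast
  then show ?thesis by (rule base.derived_imp_net_zero[OF awalk_project[OF p]])
qed

text \<open>The projected walk has its class in the commutator subgroup, hence is homotopic to the
  projection of a closed walk at \<open>x\<close>. Lifting the homotopy and using that lifts are
  unique shows that \<open>p\<close> is closed.\<close>

lemma net_zero_closed_walk:
  assumes p: "cover.awalk x p y" and y: "pV y = pV x" and net: "\<And>e. net_count arev (map pE p) e = 0"
  shows "y = x"
proof -
  have x: "x \<in> verts G'" using p by (auto dest: cover.awalk_hd_in_verts)
  have w: "base.awalk (pV x) (map pE p) (pV x)" using awalk_project[OF p] y by simp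
  have "base.walk_class (pV x) (map pE p)
      \<in> derived (fundamental_group G arev (pV x)) (carrier (fundamental_group G arev (pV x)))"
    by (rule base.net_zero_imp_derived[OF w net])
  then obtain c where c: "c \<in> carrier (fundamental_group G' arev' x)"
    "base.walk_class (pV x) (map pE p) = induced_hom G arev (pV x) pE c"
    using derived_image[OF x] by blast
  then obtain r where r: "cover.awalk x r x" "c = cover.walk_class x r" by (blast elim: cover.carrier_cases)
  then have "base.walk_class (pV x) (map pE r) = base.walk_class (pV x) (map pE p)"
    using c induced_hom_walk_class by simp
  then have "(map pE r, map pE p) \<in> base.homotopy (pV x)"
    using base.walk_class_eq_iff[OF awalk_project[OF r(1)] w] by simp
  then obtain p' where "cover.awalk x p' x" "map pE p' = map pE p"
    using homotopy_lift r(1) by metis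
  then show ?thesis using awalk_lift_unique[OF p] by metis
qed

end

section \<open>The inner product of $\ell^2(X)$\<close>

definition ell2_norm :: "'x set \<Rightarrow> ('x \<Rightarrow> complex) \<Rightarrow> real" where
  "ell2_norm X f = sqrt (\<Sum>\<^sub>\<infinity>x\<in>X. (cmod (f x))\<^sup>2)"

lemma ell2_norm_nonneg [simp]: "0 \<le> ell2_norm X f"
  by (simp add: ell2_norm_def infsum_nonneg)

lemma ell2_norm_power2: "(ell2_norm X f)\<^sup>2 = (\<Sum>\<^sub>\<infinity>x\<in>X. (cmod (f x))\<^sup>2)"
  by (simp add: ell2_norm_def infsum_nonneg)

lemma ell2_lincomb:
  assumes "f \<in> ell2 X" "g \<in> ell2 X"
  shows "(\<lambda>x. a * f x + b * g x) \<in> ell2 X"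
proof -
  have "(cmod (a * f x + b * g x))\<^sup>2 \<le> 2 * (cmod a)\<^sup>2 * (cmod (f x))\<^sup>2 + 2 * (cmod b)\<^sup>2 * (cmod (g x))\<^sup>2" for x
  proof -
    have "(cmod (a * f x + b * g x))\<^sup>2 \<le> (cmod (a * f x) + cmod (b * g x))\<^sup>2"
      by (intro power_mono norm_triangle_ineq) auto
    also have "\<dots> \<le> 2 * (cmod (a * f x))\<^sup>2 + 2 * (cmod (b * g x))\<^sup>2"
      using sum_squares_ge_zero[of "cmod (a * f x) - cmod (b * g x)" 0]
      by (simp add: power2_eq_square algebra_simps)
    finally show ?thesis by (simp add: norm_mult power_mult_distrib)
  qed
  moreover have "(\<lambda>x. 2 * (cmod a)\<^sup>2 * (cmod (f x))\<^sup>2 + 2 * (cmod b)\<^sup>2 * (cmod (g x))\<^sup>2) summable_on X"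
    using assms by (intro summable_on_add summable_on_cmult_right) (auto simp: ell2_def)
  ultimately have "(\<lambda>x. (cmod (a * f x + b * g x))\<^sup>2) summable_on X"
    by - (rule Infinite_Sum.summable_on_comparison_test, assumption, simp_all)
  then show ?thesis using assms by (auto simp: ell2_def)
qed

lemma ell2_scale: "f \<in> ell2 X \<Longrightarrow> (\<lambda>x. a * f x) \<in> ell2 X"
  using ell2_lincomb[of f X f a 0] by simp

lemma ell2_add: "f \<in> ell2 X \<Longrightarrow> g \<in> ell2 X \<Longrightarrow> (\<lambda>x. f x + g x) \<in> ell2 X"
  using ell2_lincomb[of f X g 1 1] by simp

lemma ell2_diff: "f \<in> ell2 X \<Longrightarrow> g \<in> ell2 X \<Longrightarrow> (\<lambda>x. f x - g x) \<in> ell2 X"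
  using ell2_lincomb[of f X g 1 "-1"] by simp

lemma ell2_inner_summable:
  assumes "f \<in> ell2 X" "g \<in> ell2 X"
  shows "(\<lambda>x. f x * cnj (g x)) summable_on X"
proof -
  have "norm (f x * cnj (g x)) \<le> (cmod (f x))\<^sup>2 + (cmod (g x))\<^sup>2" for x
  proof -
    have "0 \<le> (cmod (f x) - cmod (g x))\<^sup>2 + (cmod (f x))\<^sup>2 + (cmod (g x))\<^sup>2" by simp
    then show ?thesis by (simp add: norm_mult power2_eq_square algebra_simps)
  qed
  moreover have "(\<lambda>x. (cmod (f x))\<^sup>2 + (cmod (g x))\<^sup>2) summable_on X"
    using assms by (intro summable_on_add) (auto simp: ell2_def)
  ultimately have "(\<lambda>x. norm (f x * cnj (g x))) summable_on X"
    by - (rule Infinite_Sum.summable_on_comparison_test, assumption, simp_all)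
  then show ?thesis by (rule abs_summable_summable)
qed

lemma ell2_inner_lincomb:
  assumes "f \<in> ell2 X" "g \<in> ell2 X" "h \<in> ell2 X"
  shows "ell2_inner X (\<lambda>x. a * f x + b * g x) h = a * ell2_inner X f h + b * ell2_inner X g h"
proof -
  have "(\<lambda>x. (a * f x + b * g x) * cnj (h x)) = (\<lambda>x. a * (f x * cnj (h x)) + b * (g x * cnj (h x)))"
    by (auto simp: algebra_simps)
  then show ?thesis
    using ell2_inner_summable[OF assms(1,3)] ell2_inner_summable[OF assms(2,3)]
    unfolding ell2_inner_def
    by (simp add: infsum_add infsum_cmult_right summable_on_cmult_right)
qed

lemma ell2_inner_add:
  "f \<in> ell2 X \<Longrightarrow> g \<in> ell2 X \<Longrightarrow> h \<in> ell2 X \<Longrightarrow>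
    ell2_inner X (\<lambda>x. f x + g x) h = ell2_inner X f h + ell2_inner X g h"
  using ell2_inner_lincomb[of f X g h 1 1] by simp

lemma ell2_inner_diff:
  "f \<in> ell2 X \<Longrightarrow> g \<in> ell2 X \<Longrightarrow> h \<in> ell2 X \<Longrightarrow>
    ell2_inner X (\<lambda>x. f x - g x) h = ell2_inner X f h - ell2_inner X g h"
  using ell2_inner_lincomb[of f X g h 1 "-1"] by simp

lemma ell2_inner_commute: "ell2_inner X g f = cnj (ell2_inner X f g)"
  unfolding ell2_inner_def infsum_cnj[symmetric] by (simp add: mult.commute)

lemma ell2_inner_lincomb_right:
  assumes "f \<in> ell2 X" "g \<in> ell2 X" "h \<in> ell2 X"
  shows "ell2_inner X h (\<lambda>x. a * f x + b * g x) = cnj a * ell2_inner X h f + cnj b * ell2_inner X h g"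
  by (subst (1 2 3) ell2_inner_commute) (simp add: ell2_inner_lincomb assms)

lemma ell2_inner_lincomb_both:
  assumes "p \<in> ell2 X" "q \<in> ell2 X" "f \<in> ell2 X" "g \<in> ell2 X"
  shows "ell2_inner X (\<lambda>x. a * p x + b * q x) (\<lambda>x. c * f x + d * g x) =
    a * cnj c * ell2_inner X p f + a * cnj d * ell2_inner X p g +
    b * cnj c * ell2_inner X q f + b * cnj d * ell2_inner X q g"
  unfolding ell2_inner_lincomb[OF assms(1,2) ell2_lincomb[OF assms(3,4)]]
    ell2_inner_lincomb_right[OF assms(3,4,1)] ell2_inner_lincomb_right[OF assms(3,4,2)]
  by (simp add: algebra_simps)

lemma ell2_inner_self:
  assumes "f \<in> ell2 X"
  shows "ell2_inner X f f = of_real ((ell2_norm X f)\<^sup>2)"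
proof -
  have *: "f x * cnj (f x) = of_real ((cmod (f x))\<^sup>2)" for x using complex_norm_square[of "f x"] by simp
  show ?thesis unfolding ell2_inner_def ell2_norm_power2 *
    by (rule infsumI[OF has_sum_of_real[OF has_sum_infsum]]) (use assms in \<open>simp add: ell2_def\<close>)
qed

lemma ell2_norm_zero:
  assumes "f \<in> ell2 X" "ell2_norm X f = 0"
  shows "f = (\<lambda>x. 0)"
proof
  fix x
  show "f x = 0"
  proof (cases "x \<in> X")
    case True
    have "(cmod (f x))\<^sup>2 = 0"
      using nonneg_infsum_le_0D[of "\<lambda>x. (cmod (f x))\<^sup>2" X x] assms True
      by (auto simp: ell2_def ell2_norm_power2[symmetric])
    then show ?thesis by simp
  qed (use assms in \<open>auto simp: ell2_def\<close>)
qed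

lemma ell2_inner_zero_left [simp]: "ell2_inner X (\<lambda>x. 0) g = 0"
  and ell2_inner_zero_right [simp]: "ell2_inner X g (\<lambda>x. 0) = 0"
  by (simp_all add: ell2_inner_def)

lemma ell2_eq_zeroI:
  assumes "f \<in> ell2 X" "\<And>g. g \<in> ell2 X \<Longrightarrow> ell2_inner X f g = 0"
  shows "f = (\<lambda>x. 0)"
  using assms(2)[OF assms(1)] ell2_norm_zero[OF assms(1)] by (simp add: ell2_inner_self assms)

lemma ell2_cauchy_schwarz:
  assumes f: "f \<in> ell2 X" and g: "g \<in> ell2 X"
  shows "cmod (ell2_inner X f g) \<le> ell2_norm X f * ell2_norm X g"
proof (cases "ell2_norm X g = 0")
  case True
  then show ?thesis using ell2_norm_zero[OF g] by simp
next
  case False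
  define G where "G = (ell2_norm X g)\<^sup>2"
  have G: "G > 0" using False by (simp add: G_def)
  define z where "z = ell2_inner X f g"
  \<comment> \<open>The coefficient of the orthogonal projection of \<open>f\<close> on
    \<open>g\<close>, so that \<open>h\<close> is orthogonal to \<open>g\<close>.\<close>
  define c where "c = z / of_real G"
  define h where "h = (\<lambda>x. 1 * f x + (- c) * g x)"
  have h: "h \<in> ell2 X" unfolding h_def by (rule ell2_lincomb[OF f g])
  have 1: "ell2_inner X g g = of_real G" by (simp add: ell2_inner_self g G_def)
  have "ell2_inner X h g = 0"
    unfolding h_def ell2_inner_lincomb[OF f g g] using G by (simp add: 1 c_def z_def)
  then have "ell2_inner X g h = 0" using ell2_inner_commute[of X g h] by simp
  then have "ell2_inner X h h = ell2_inner X f h"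
    using ell2_inner_lincomb[OF f g h, of 1 "- c"] unfolding h_def[symmetric] by simp
  also have "\<dots> = of_real ((ell2_norm X f)\<^sup>2) - cnj c * z"
    unfolding h_def ell2_inner_lincomb_right[OF f g f] by (simp add: ell2_inner_self f z_def)
  also have "cnj c * z = of_real ((cmod z)\<^sup>2 / G)"
    using complex_norm_square[of z] by (simp add: c_def mult.commute)
  finally have "of_real ((ell2_norm X h)\<^sup>2) = (of_real ((ell2_norm X f)\<^sup>2 - (cmod z)\<^sup>2 / G) :: complex)"
    by (simp add: ell2_inner_self h)
  then have "(ell2_norm X h)\<^sup>2 = (ell2_norm X f)\<^sup>2 - (cmod z)\<^sup>2 / G" using of_real_eq_iff by blast
  then have "(cmod z)\<^sup>2 / G \<le> (ell2_norm X f)\<^sup>2" by (metis diff_ge_0_iff_ge zero_le_power2)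
  then have "(cmod z)\<^sup>2 \<le> (ell2_norm X f * ell2_norm X g)\<^sup>2"
    using G by (simp add: field_simps G_def power_mult_distrib)
  then show ?thesis unfolding z_def by (rule power2_le_imp_le) simp
qed

lemma delta_ell2: "y \<in> X \<Longrightarrow> delta y \<in> ell2 X"
  using summable_on_finite[of "{y}" "\<lambda>x. (cmod (delta y x))\<^sup>2"]
    summable_on_cong_neutral[of X "{y}" "\<lambda>x. (cmod (delta y x))\<^sup>2" "\<lambda>x. (cmod (delta y x))\<^sup>2"]
  by (auto simp: ell2_def delta_def)

lemma ell2_inner_delta: "y \<in> X \<Longrightarrow> ell2_inner X f (delta y) = f y"
proof -
  assume y: "y \<in> X"
  have "ell2_inner X f (delta y) = infsum (\<lambda>x. f x * cnj (delta y x)) {y}"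
    unfolding ell2_inner_def by (rule infsum_cong_neutral) (auto simp: delta_def y)
  then show ?thesis by (simp add: delta_def)
qed

section \<open>Spectral resolutions and eigenprojections\<close>

text \<open>Symmetry of \<open>H\<close> is derived from the resolution in \<open>H_sym\<close>;
  norm bounds enter as explicit hypotheses of the lemmas that use them.\<close>

locale ell2_spectral =
  fixes X :: "'x set" and H :: "('x \<Rightarrow> complex) \<Rightarrow> 'x \<Rightarrow> complex"
    and E :: "real set \<Rightarrow> ('x \<Rightarrow> complex) \<Rightarrow> 'x \<Rightarrow> complex"
  assumes H_ell2: "f \<in> ell2 X \<Longrightarrow> H f \<in> ell2 X"
    and H_lincomb: "H (\<lambda>x. a * f x + b * g x) = (\<lambda>x. a * H f x + b * H g x)"
    and resolution: "spectral_resolution X H E"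
begin

section \<open>Calculus of the spectral projections\<close>

lemma pvm: "projection_valued_measure X E"
  using resolution by (simp add: spectral_resolution_def)

lemma E_ell2: "B \<in> sets borel \<Longrightarrow> f \<in> ell2 X \<Longrightarrow> E B f \<in> ell2 X"
  using pvm by (auto simp: projection_valued_measure_def ell2_projection_def)

lemma E_lincomb: "B \<in> sets borel \<Longrightarrow> f \<in> ell2 X \<Longrightarrow> g \<in> ell2 X \<Longrightarrow>
    E B (\<lambda>x. a * f x + b * g x) = (\<lambda>x. a * E B f x + b * E B g x)"
  using pvm by (auto simp: projection_valued_measure_def ell2_projection_def)

lemma E_sym: "B \<in> sets borel \<Longrightarrow> f \<in> ell2 X \<Longrightarrow> g \<in> ell2 X \<Longrightarrow>
    ell2_inner X (E B f) g = ell2_inner X f (E B g)"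
  using pvm by (auto simp: projection_valued_measure_def ell2_projection_def)

lemma E_Int: "A \<in> sets borel \<Longrightarrow> B \<in> sets borel \<Longrightarrow> f \<in> ell2 X \<Longrightarrow> E (A \<inter> B) f = E A (E B f)"
  using pvm by (auto simp: projection_valued_measure_def)

lemma E_UNIV: "f \<in> ell2 X \<Longrightarrow> E UNIV f = f"
  using pvm by (auto simp: projection_valued_measure_def)

lemma E_sums: "range B \<subseteq> sets borel \<Longrightarrow> disjoint_family B \<Longrightarrow> f \<in> ell2 X \<Longrightarrow> g \<in> ell2 X \<Longrightarrow>
    (\<lambda>n. ell2_inner X (E (B n) f) g) sums ell2_inner X (E (\<Union>n::nat. B n) f) g"
  using pvm by (auto simp: projection_valued_measure_def)

text \<open>The constant sequence of empty sets is disjoint, and a constant series converges only if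
  its terms are zero.\<close>

lemma E_empty:
  assumes f: "f \<in> ell2 X"
  shows "E {} f = (\<lambda>x. 0)"
proof (rule ell2_eq_zeroI)
  show "E {} f \<in> ell2 X" using E_ell2 f by simp
  fix g assume g: "g \<in> ell2 X"
  have "(\<lambda>n::nat. ell2_inner X (E {} f) g) sums ell2_inner X (E (\<Union>n::nat. {}) f) g"
    by (rule E_sums) (auto simp: f g disjoint_family_on_def)
  then have "summable (\<lambda>n::nat. ell2_inner X (E {} f) g)" by (rule sums_summable)
  then show "ell2_inner X (E {} f) g = 0" by (simp add: summable_const_iff)
qed

lemma E_Un:
  assumes A: "A \<in> sets borel" and B: "B \<in> sets borel" and d: "A \<inter> B = {}" and f: "f \<in> ell2 X"
  shows "E (A \<union> B) f = (\<lambda>x. E A f x + E B f x)"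
proof -
  have AB: "A \<union> B \<in> sets borel" using A B by simp
  let ?h = "\<lambda>x. E (A \<union> B) f x - (E A f x + E B f x)"
  have mem: "E A f \<in> ell2 X" "E B f \<in> ell2 X" "E (A \<union> B) f \<in> ell2 X" using E_ell2 A B AB f by auto
  have "?h = (\<lambda>x. 0)"
  proof (rule ell2_eq_zeroI)
    show "?h \<in> ell2 X" by (intro ell2_diff ell2_add mem)
    fix g assume g: "g \<in> ell2 X"
    have "(\<lambda>n. ell2_inner X (E (binaryset A B n) f) g) sums ell2_inner X (E (\<Union>n. binaryset A B n) f) g"
      by (rule E_sums) (use A B d f g in \<open>auto simp: range_binaryset_eq disjoint_family_on_def binaryset_def\<close>)
    moreover have "(\<lambda>n. ell2_inner X (E (binaryset A B n) f) g) sums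
        (ell2_inner X (E A f) g + ell2_inner X (E B f) g)"
    proof -
      have "(\<lambda>n. ell2_inner X (E (binaryset A B n) f) g) sums
          (\<Sum>n\<in>{0, 1}. ell2_inner X (E (binaryset A B n) f) g)"
        by (rule sums_finite) (auto simp: binaryset_def E_empty f)
      then show ?thesis by (simp add: binaryset_def)
    qed
    ultimately have "ell2_inner X (E (A \<union> B) f) g = ell2_inner X (E A f) g + ell2_inner X (E B f) g"
      unfolding UN_binaryset_eq by (rule sums_unique2)
    then show "ell2_inner X ?h g = 0"
      by (simp add: ell2_inner_diff ell2_inner_add ell2_add mem g)
  qed
  then show ?thesis by (metis (no_types, lifting) diff_eq_diff_eq eq_iff_diff_eq_0 ext)
qed

lemma E_inner_self:
  assumes "B \<in> sets borel" "f \<in> ell2 X"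
  shows "ell2_inner X (E B f) f = of_real ((ell2_norm X (E B f))\<^sup>2)"
  using E_sym[of B "E B f" f] E_Int[of B B f] assms
  by (simp add: E_ell2 ell2_inner_self)

lemma E_split:
  assumes B: "B \<in> sets borel" and f: "f \<in> ell2 X"
  shows "f = (\<lambda>x. E B f x + E (- B) f x)"
  using E_Un[OF B _ _ f, of "- B"] B f by (simp add: E_UNIV)

lemma norm_E_le:
  assumes B: "B \<in> sets borel" and f: "f \<in> ell2 X"
  shows "ell2_norm X (E B f) \<le> ell2_norm X f"
proof -
  have B': "- B \<in> sets borel" using B by auto
  have "ell2_inner X f f = ell2_inner X (E B f) f + ell2_inner X (E (- B) f) f"
    by (subst (1) E_split[OF B f]) (simp add: ell2_inner_add E_ell2 B B' f)
  then have "complex_of_real ((ell2_norm X f)\<^sup>2) = of_real ((ell2_norm X (E B f))\<^sup>2 + (ell2_norm X (E (- B) f))\<^sup>2)"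
    by (simp add: ell2_inner_self[OF f] E_inner_self B B' f)
  then have "(ell2_norm X f)\<^sup>2 = (ell2_norm X (E B f))\<^sup>2 + (ell2_norm X (E (- B) f))\<^sup>2"
    using of_real_eq_iff by blast
  then have "(ell2_norm X (E B f))\<^sup>2 \<le> (ell2_norm X f)\<^sup>2" by simp
  then show ?thesis by (rule power2_le_imp_le) simp
qed

section \<open>Scalar measures, spectral ranges and their invariance under the operator\<close>

abbreviation "\<mu> \<equiv> scalar_spectral_measure X E"

lemma sets_scalar [simp]: "sets (\<mu> f) = sets borel"
  and space_scalar [simp]: "space (\<mu> f) = UNIV"
  using sets.sigma_sets_eq[of "borel :: real measure"]
  by (auto simp: scalar_spectral_measure_def sets_measure_of_conv space_measure_of_conv)

lemma emeasure_scalar: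
  assumes f: "f \<in> ell2 X" and B: "B \<in> sets borel"
  shows "emeasure (\<mu> f) B = ennreal ((ell2_norm X (E B f))\<^sup>2)"
proof -
  have "emeasure (\<mu> f) B = ennreal (Re (ell2_inner X (E B f) f))"
  proof (rule emeasure_measure_of)
    show "\<mu> f = measure_of UNIV (sets borel) (\<lambda>B. ennreal (Re (ell2_inner X (E B f) f)))"
      by (simp add: scalar_spectral_measure_def)
    show "positive (sets (\<mu> f)) (\<lambda>B. ennreal (Re (ell2_inner X (E B f) f)))"
      by (simp add: positive_def E_empty f)
    show "countably_additive (sets (\<mu> f)) (\<lambda>B. ennreal (Re (ell2_inner X (E B f) f)))"
    proof (rule countably_additiveI)
      fix A :: "nat \<Rightarrow> real set"
      assume A: "range A \<subseteq> sets (\<mu> f)" "disjoint_family A"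
      have "(\<lambda>n. Re (ell2_inner X (E (A n) f) f)) sums Re (ell2_inner X (E (\<Union>n. A n) f) f)"
        by (rule sums_Re, rule E_sums) (use A f in auto)
      moreover have "0 \<le> Re (ell2_inner X (E (A n) f) f)" for n
      proof -
        have "A n \<in> sets borel" using A by auto
        then show ?thesis by (simp add: E_inner_self f)
      qed
      ultimately show "(\<Sum>n. ennreal (Re (ell2_inner X (E (A n) f) f))) = ennreal (Re (ell2_inner X (E (\<Union>n. A n) f) f))"
        by (intro suminf_ennreal_eq)
    qed
  qed (use B in auto)
  then show ?thesis using E_inner_self[OF B f] by simp
qed

lemma finite_scalar: "f \<in> ell2 X \<Longrightarrow> finite_measure (\<mu> f)"
  by (rule finite_measureI) (simp add: emeasure_scalar)

lemma measure_scalar: "f \<in> ell2 X \<Longrightarrow> B \<in> sets borel \<Longrightarrow> measure (\<mu> f) B = (ell2_norm X (E B f))\<^sup>2"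
  by (simp add: measure_def emeasure_scalar)

lemma H_quadratic:
  assumes "f \<in> ell2 X"
  shows "ell2_inner X (H f) f = of_real (\<integral>t. t \<partial>\<mu> f)" "integrable (\<mu> f) (\<lambda>t. t)"
  using resolution assms by (auto simp: spectral_resolution_def)

definition spectral_range :: "real set \<Rightarrow> ('x \<Rightarrow> complex) set" where
  "spectral_range B = {f \<in> ell2 X. E B f = f}"

lemma E_in_range: "B \<in> sets borel \<Longrightarrow> f \<in> ell2 X \<Longrightarrow> E B f \<in> spectral_range B"
  using E_Int[of B B f] by (simp add: spectral_range_def E_ell2)

lemma range_AE:
  assumes f: "f \<in> spectral_range B" and B: "B \<in> sets borel"
  shows "AE t in \<mu> f. t \<in> B"
proof -
  have f': "f \<in> ell2 X" "E B f = f" using f by (auto simp: spectral_range_def)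
  have "E (- B) f = E (- B) (E B f)" by (simp add: f')
  also have "\<dots> = E {} f" using E_Int[of "- B" B f] B f' by simp
  finally have "emeasure (\<mu> f) (- B) = 0"
    using B f' by (simp add: emeasure_scalar E_empty ell2_norm_def)
  then show ?thesis using B by (intro AE_I[of _ _ "- B"]) auto
qed

text \<open>The measure of \<open>f\<close> lives on \<open>B\<close> and has the squared norm of
  \<open>f\<close> as total mass, so the bound on \<open>B\<close> can be integrated.\<close>

lemma range_quadratic_ge:
  assumes f: "f \<in> spectral_range B" and B: "B \<in> sets borel" and a: "\<And>t. t \<in> B \<Longrightarrow> a \<le> t"
  shows "a * (ell2_norm X f)\<^sup>2 \<le> Re (ell2_inner X (H f) f)"
proof -
  have f': "f \<in> ell2 X" using f by (auto simp: spectral_range_def)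
  interpret finite_measure "\<mu> f" by (rule finite_scalar[OF f'])
  have "(\<integral>t. a \<partial>\<mu> f) \<le> (\<integral>t. t \<partial>\<mu> f)"
  proof (rule integral_mono_AE)
    show "AE t in \<mu> f. a \<le> t" using range_AE[OF f B] by eventually_elim (rule a)
  qed (use H_quadratic(2)[OF f'] in auto)
  then show ?thesis using H_quadratic(1)[OF f'] by (simp add: measure_scalar f' E_UNIV mult.commute)
qed

lemma range_quadratic_le:
  assumes f: "f \<in> spectral_range B" and B: "B \<in> sets borel" and a: "\<And>t. t \<in> B \<Longrightarrow> t \<le> a"
  shows "Re (ell2_inner X (H f) f) \<le> a * (ell2_norm X f)\<^sup>2"
proof -
  have f': "f \<in> ell2 X" using f by (auto simp: spectral_range_def)
  interpret finite_measure "\<mu> f" by (rule finite_scalar[OF f'])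
  have "(\<integral>t. t \<partial>\<mu> f) \<le> (\<integral>t. a \<partial>\<mu> f)"
  proof (rule integral_mono_AE)
    show "AE t in \<mu> f. t \<le> a" using range_AE[OF f B] by eventually_elim (rule a)
  qed (use H_quadratic(2)[OF f'] in auto)
  then show ?thesis using H_quadratic(1)[OF f'] by (simp add: measure_scalar f' E_UNIV mult.commute)
qed

lemma H_inner_lincomb:
  assumes "f \<in> ell2 X" "g \<in> ell2 X"
  shows "ell2_inner X (H (\<lambda>x. 1 * f x + c * g x)) (\<lambda>x. 1 * f x + c * g x) =
    ell2_inner X (H f) f + cnj c * ell2_inner X (H f) g + c * ell2_inner X (H g) f
      + (c * cnj c) * ell2_inner X (H g) g"
  unfolding H_lincomb ell2_inner_lincomb_both[OF H_ell2[OF assms(1)] H_ell2[OF assms(2)] assms]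
  by simp

text \<open>Polarization: the quadratic form is an integral of a real function, hence real, also at
  \<open>f + g\<close> and at \<open>f + \<i> g\<close>.\<close>

lemma H_sym:
  assumes f: "f \<in> ell2 X" and g: "g \<in> ell2 X"
  shows "ell2_inner X (H f) g = ell2_inner X f (H g)"
proof -
  define p q where "p = ell2_inner X (H f) g" and "q = ell2_inner X (H g) f"
  have real: "Im (ell2_inner X (H h) h) = 0" if "h \<in> ell2 X" for h using H_quadratic(1)[OF that] by simp
  have "Im (cnj c * p + c * q) = 0" if "c * cnj c = 1" for c
    using real[OF ell2_lincomb[OF f g, of 1 c]] real[OF f] real[OF g] that
    unfolding H_inner_lincomb[OF f g] by (simp add: p_def q_def)
  from this[of 1] this[of \<i>] have "p = cnj q" by (auto simp: complex_eq_iff)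
  then show ?thesis using ell2_inner_commute[of X f "H g"] by (simp add: p_def q_def)
qed

text \<open>For \<open>f\<close> and \<open>g\<close> in complementary spectral ranges, the measures of \<open>f + c g\<close> with \<open>\<bar>c\<bar> = 1\<close>
  all agree, hence so do their quadratic forms.\<close>

lemma H_inner_complementary:
  assumes B: "B \<in> sets borel" and f: "f \<in> spectral_range B" and g: "g \<in> spectral_range (- B)"
  shows "ell2_inner X (H f) g = 0"
proof -
  have f': "f \<in> ell2 X" "E B f = f" and g': "g \<in> ell2 X" "E (- B) g = g"
    using f g by (auto simp: spectral_range_def)
  have B': "- B \<in> sets borel" using B by auto
  \<comment> \<open>The projections commute, so \<open>E C\<close> maps the range of
    \<open>E B\<close> into itself, and this range is orthogonal to that of the complement.\<close>
  have cross: "ell2_inner X (E C f) g = 0" if C: "C \<in> sets borel" for C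
  proof -
    have "ell2_inner X (E C f) g = ell2_inner X (E C f) (E (- B) g)" by (simp add: g')
    also have "\<dots> = ell2_inner X (E (- B) (E C (E B f))) g"
      using E_sym[OF B' E_ell2[OF C f'(1)] g'(1)] by (simp add: f')
    also have "E (- B) (E C (E B f)) = E (- B \<inter> (C \<inter> B)) f"
      using B B' C f' E_Int[of "- B" "C \<inter> B" f] E_Int[of C B f] by simp
    also have "- B \<inter> (C \<inter> B) = {}" by auto
    finally show ?thesis by (simp add: E_empty f')
  qed
  have cross': "ell2_inner X (E C g) f = 0" if C: "C \<in> sets borel" for C
    using cross[OF C] E_sym[OF C g'(1) f'(1)] ell2_inner_commute[of X g "E C f"] by simp
  define h where "h c = (\<lambda>x. 1 * f x + c * g x)" for c
  have hL: "h c \<in> ell2 X" for c unfolding h_def by (rule ell2_lincomb[OF f'(1) g'(1)])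
  have eq: "\<mu> (h c) = \<mu> (h 1)" if c: "c * cnj c = 1" for c
  proof -
    have "ell2_inner X (E C (h c)) (h c) = ell2_inner X (E C f) f + ell2_inner X (E C g) g"
      if "C \<in> sets borel" and c: "c * cnj c = 1" for C c
      unfolding h_def E_lincomb[OF that(1) f'(1) g'(1)]
        ell2_inner_lincomb_both[OF E_ell2[OF that(1) f'(1)] E_ell2[OF that(1) g'(1)] f'(1) g'(1)]
      using that by (simp add: cross cross')
    then show ?thesis unfolding scalar_spectral_measure_def
      by (intro measure_of_eq) (use c in \<open>auto simp: sets.sigma_sets_eq[of "borel :: real measure", simplified]\<close>)
  qed
  define p q where "p = ell2_inner X (H f) g" and "q = ell2_inner X (H g) f"
  have "cnj c * p + c * q = p + q" if c: "c * cnj c = 1" for c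
  proof -
    have "ell2_inner X (H (h c)) (h c) = ell2_inner X (H (h 1)) (h 1)"
      unfolding H_quadratic(1)[OF hL] eq[OF c] ..
    then show ?thesis
      unfolding h_def H_inner_lincomb[OF f'(1) g'(1)] using c by (simp add: p_def q_def)
  qed
  \<comment> \<open>With c = -1 one gets p + q = 0, and with c = \<i> then also p = q.\<close>
  from this[of "-1"] this[of \<i>] have "p + q = 0" "\<i> * q - \<i> * p = p + q" by (auto simp: complex_eq_iff)
  then have "p = 0" by (auto simp: complex_eq_iff)
  then show ?thesis by (simp add: p_def)
qed

text \<open>By the orthogonality just shown, \<open>H f\<close> has no component in the
  complementary range. Thus powers of the operator can be estimated on each spectral range
  separately.\<close>

lemma H_spectral_range:
  assumes B: "B \<in> sets borel" and f: "f \<in> spectral_range B"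
  shows "H f \<in> spectral_range B"
proof -
  have f': "f \<in> ell2 X" using f by (auto simp: spectral_range_def)
  have B': "- B \<in> sets borel" using B by auto
  have "E (- B) (H f) = (\<lambda>x. 0)"
  proof (rule ell2_eq_zeroI)
    show "E (- B) (H f) \<in> ell2 X" by (intro E_ell2 H_ell2 B' f')
    fix g assume g: "g \<in> ell2 X"
    have "ell2_inner X (E (- B) (H f)) g = ell2_inner X (H f) (E (- B) g)"
      by (intro E_sym B' H_ell2 f' g)
    also have "\<dots> = 0" by (rule H_inner_complementary[OF B f E_in_range[OF B' g]])
    finally show "ell2_inner X (E (- B) (H f)) g = 0" .
  qed
  then have "E B (H f) = H f" using E_split[OF B H_ell2[OF f']] by simp
  then show ?thesis using H_ell2 f' by (simp add: spectral_range_def)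
qed

lemma spectral_range_lincomb:
  "B \<in> sets borel \<Longrightarrow> f \<in> spectral_range B \<Longrightarrow> g \<in> spectral_range B \<Longrightarrow>
    (\<lambda>x. a * f x + b * g x) \<in> spectral_range B"
  by (auto simp: spectral_range_def ell2_lincomb E_lincomb)

definition shifted :: "real \<Rightarrow> ('x \<Rightarrow> complex) \<Rightarrow> 'x \<Rightarrow> complex" where
  "shifted \<theta> f = (\<lambda>x. H f x - of_real \<theta> * f x)"

lemma shifted_ell2: "f \<in> ell2 X \<Longrightarrow> shifted \<theta> f \<in> ell2 X"
  unfolding shifted_def by (intro ell2_diff ell2_scale H_ell2)

lemma shifted_range:
  assumes "B \<in> sets borel" "f \<in> spectral_range B"
  shows "shifted \<theta> f \<in> spectral_range B"
  using spectral_range_lincomb[OF assms(1) H_spectral_range[OF assms] assms(2), of 1 "- of_real \<theta>"]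
  by (simp add: shifted_def)

lemma shifted_lincomb: "shifted \<theta> (\<lambda>x. a * f x + b * g x) = (\<lambda>x. a * shifted \<theta> f x + b * shifted \<theta> g x)"
  by (simp add: shifted_def H_lincomb algebra_simps)

lemma shifted_sym:
  assumes "f \<in> ell2 X" "g \<in> ell2 X"
  shows "ell2_inner X (shifted \<theta> f) g = ell2_inner X f (shifted \<theta> g)"
proof -
  have "ell2_inner X f (shifted \<theta> g) = ell2_inner X f (H g) - of_real \<theta> * ell2_inner X f g"
    using ell2_inner_lincomb_right[OF H_ell2[OF assms(2)] assms(2,1), of 1 "- of_real \<theta>"]
    by (simp add: shifted_def)
  moreover have "ell2_inner X (shifted \<theta> f) g = ell2_inner X (H f) g - of_real \<theta> * ell2_inner X f g"
    using ell2_inner_lincomb[OF H_ell2[OF assms(1)] assms, of 1 "- of_real \<theta>"]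
    by (simp add: shifted_def)
  ultimately show ?thesis using H_sym[OF assms] by simp
qed

lemma shifted_quadratic:
  assumes "f \<in> ell2 X"
  shows "ell2_inner X (shifted \<theta> f) f = of_real (Re (ell2_inner X (H f) f) - \<theta> * (ell2_norm X f)\<^sup>2)"
proof -
  have "ell2_inner X (shifted \<theta> f) f = ell2_inner X (H f) f - of_real \<theta> * ell2_inner X f f"
    using ell2_inner_lincomb[OF H_ell2[OF assms] assms assms, of 1 "- of_real \<theta>"]
    by (simp add: shifted_def)
  then show ?thesis using H_quadratic(1)[OF assms] assms by (simp add: ell2_inner_self)
qed

text \<open>On the range of \<open>E {\<theta>}\<close> the quadratic form of
  \<open>H - \<theta>\<close> vanishes. The range is invariant, so it contains
  \<open>g = (H - \<theta>) f\<close>, and polarizing with \<open>f\<close> and \<open>g\<close>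
  gives that the norm of \<open>g\<close> is 0.\<close>

lemma shifted_eigenrange:
  assumes f: "f \<in> spectral_range {\<theta>}"
  shows "shifted \<theta> f = (\<lambda>x. 0)"
proof -
  have quad: "ell2_inner X (shifted \<theta> g) g = 0" if g: "g \<in> spectral_range {\<theta>}" for g
  proof -
    have g': "g \<in> ell2 X" using g by (simp add: spectral_range_def)
    have "Re (ell2_inner X (H g) g) = \<theta> * (ell2_norm X g)\<^sup>2"
      by (intro antisym range_quadratic_le[OF g] range_quadratic_ge[OF g]) auto
    then show ?thesis using shifted_quadratic[OF g'] by simp
  qed
  define g where "g = shifted \<theta> f"
  have B: "{\<theta>} \<in> sets borel" by simp
  have g: "g \<in> spectral_range {\<theta>}" unfolding g_def by (rule shifted_range[OF B f])
  have fL: "f \<in> ell2 X" and gL: "g \<in> ell2 X" using f g by (auto simp: spectral_range_def)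
  have "ell2_inner X (shifted \<theta> (\<lambda>x. 1 * f x + c * g x)) (\<lambda>x. 1 * f x + c * g x) =
    cnj c * ell2_inner X g g + c * ell2_inner X (shifted \<theta> g) f" for c
    unfolding shifted_lincomb ell2_inner_lincomb_both[OF shifted_ell2[OF fL] shifted_ell2[OF gL] fL gL]
    using quad[OF f] quad[OF g] by (simp add: g_def)
  then have "cnj c * ell2_inner X g g + c * ell2_inner X (shifted \<theta> g) f = 0" for c
    using quad[OF spectral_range_lincomb[OF B f g, of 1 c]] by simp
  moreover have "ell2_inner X (shifted \<theta> g) f = ell2_inner X g g"
    using shifted_sym[OF gL fL] by (simp add: g_def)
  ultimately have "cnj 1 * ell2_inner X g g + 1 * ell2_inner X g g = 0" by metis
  then have "ell2_inner X g g = 0" by simp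
  then show ?thesis unfolding g_def[symmetric] by (intro ell2_norm_zero[OF gL]) (simp add: ell2_inner_self gL)
qed

text \<open>On one side of \<theta> the quadratic form of \<open>H - \<theta>\<close> is definite
  with constant \<epsilon>, and Cauchy-Schwarz turns this into a norm bound. Since the argument
  needs a fixed sign, the two sides are treated separately later on.\<close>

lemma shifted_bounded_below:
  assumes B: "B \<in> sets borel" and \<epsilon>: "\<epsilon> \<ge> 0" and f: "f \<in> spectral_range B"
    and out: "(\<forall>t\<in>B. \<theta> + \<epsilon> \<le> t) \<or> (\<forall>t\<in>B. t \<le> \<theta> - \<epsilon>)"
  shows "\<epsilon> * ell2_norm X f \<le> ell2_norm X (shifted \<theta> f)"
proof -
  have fL: "f \<in> ell2 X" using f by (auto simp: spectral_range_def)
  define s where "s = Re (ell2_inner X (H f) f) - \<theta> * (ell2_norm X f)\<^sup>2"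
  have "\<epsilon> * (ell2_norm X f)\<^sup>2 \<le> \<bar>s\<bar>"
  proof (rule disjE[OF out])
    assume "\<forall>t\<in>B. \<theta> + \<epsilon> \<le> t"
    then have "(\<theta> + \<epsilon>) * (ell2_norm X f)\<^sup>2 \<le> Re (ell2_inner X (H f) f)"
      by (intro range_quadratic_ge[OF f B]) auto
    then show ?thesis by (simp add: s_def algebra_simps)
  next
    assume "\<forall>t\<in>B. t \<le> \<theta> - \<epsilon>"
    then have "Re (ell2_inner X (H f) f) \<le> (\<theta> - \<epsilon>) * (ell2_norm X f)\<^sup>2"
      by (intro range_quadratic_le[OF f B]) auto
    then show ?thesis by (simp add: s_def algebra_simps)
  qed
  also have "\<bar>s\<bar> = cmod (ell2_inner X (shifted \<theta> f) f)"
    unfolding shifted_quadratic[OF fL] norm_of_real s_def ..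
  also have "\<dots> \<le> ell2_norm X (shifted \<theta> f) * ell2_norm X f"
    by (rule ell2_cauchy_schwarz[OF shifted_ell2[OF fL] fL])
  finally have le: "(\<epsilon> * ell2_norm X f) * ell2_norm X f \<le> ell2_norm X (shifted \<theta> f) * ell2_norm X f"
    by (simp add: power2_eq_square mult.assoc)
  show ?thesis
  proof (cases "ell2_norm X f = 0")
    case False
    then have "ell2_norm X f > 0" using ell2_norm_nonneg[of X f] by linarith
    then show ?thesis by (rule mult_right_le_imp_le[OF le])
  qed simp
qed

end

text \<open>The function $1 - (t - \theta)^2 / R$ of the operator. If $R$ bounds $(t - \theta)^2$ on the
  spectrum, then its powers converge to the projection on the eigenspace of $\theta$.\<close>

definition peak_op :: "(('x \<Rightarrow> complex) \<Rightarrow> 'x \<Rightarrow> complex) \<Rightarrow> real \<Rightarrow> real \<Rightarrow> ('x \<Rightarrow> complex) \<Rightarrow> 'x \<Rightarrow> complex" where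
  "peak_op H \<theta> R f = (let T = (\<lambda>f x. H f x - of_real \<theta> * f x) in (\<lambda>x. f x - of_real (1 / R) * T (T f) x))"

section \<open>Powers of the peak operator\<close>

context ell2_spectral begin

lemma peak_op_eq: "peak_op H \<theta> R f = (\<lambda>x. 1 * f x + (- of_real (1 / R)) * shifted \<theta> (shifted \<theta> f) x)"
  by (simp add: peak_op_def shifted_def[abs_def])

lemma peak_op_ell2: "f \<in> ell2 X \<Longrightarrow> peak_op H \<theta> R f \<in> ell2 X"
  unfolding peak_op_eq by (intro ell2_lincomb shifted_ell2)

lemma peak_op_range: "B \<in> sets borel \<Longrightarrow> f \<in> spectral_range B \<Longrightarrow> peak_op H \<theta> R f \<in> spectral_range B"
  unfolding peak_op_eq by (intro spectral_range_lincomb shifted_range)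

lemma peak_op_add: "peak_op H \<theta> R (\<lambda>x. f x + g x) = (\<lambda>x. peak_op H \<theta> R f x + peak_op H \<theta> R g x)"
  using shifted_lincomb[of \<theta> 1 f 1 g] shifted_lincomb[of \<theta> 1 "shifted \<theta> f" 1 "shifted \<theta> g"]
  unfolding peak_op_eq by (simp add: algebra_simps)

lemma peak_op_pow_add: "(peak_op H \<theta> R ^^ k) (\<lambda>x. f x + g x) = (\<lambda>x. (peak_op H \<theta> R ^^ k) f x + (peak_op H \<theta> R ^^ k) g x)"
  by (induction k) (simp_all add: peak_op_add)

text \<open>Write T for \<open>shifted \<theta>\<close>. Expanding the square gives two subtracted
  copies of |T f|^2 / R and one term |T T f|^2 / R^2; the bound on T makes the latter at most one
  copy.\<close>

lemma peak_op_norm: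
  assumes R: "R > 0" and f: "f \<in> ell2 X"
    and bound: "\<And>g. g \<in> ell2 X \<Longrightarrow> (ell2_norm X (shifted \<theta> g))\<^sup>2 \<le> R * (ell2_norm X g)\<^sup>2"
  shows "(ell2_norm X (peak_op H \<theta> R f))\<^sup>2 \<le> (ell2_norm X f)\<^sup>2 - (ell2_norm X (shifted \<theta> f))\<^sup>2 / R"
proof -
  let ?T = "shifted \<theta> f" let ?TT = "shifted \<theta> ?T"
  have m: "?T \<in> ell2 X" "?TT \<in> ell2 X" using f by (auto intro: shifted_ell2)
  have 1: "ell2_inner X f ?TT = of_real ((ell2_norm X ?T)\<^sup>2)"
    using shifted_sym[OF f m(1)] ell2_inner_self[OF m(1)] by simp
  have 2: "ell2_inner X ?TT f = of_real ((ell2_norm X ?T)\<^sup>2)"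
    using shifted_sym[OF m(1) f] ell2_inner_self[OF m(1)] by simp
  have "ell2_inner X (peak_op H \<theta> R f) (peak_op H \<theta> R f) = of_real ((ell2_norm X f)\<^sup>2
      - 2 * (ell2_norm X ?T)\<^sup>2 / R + (ell2_norm X ?TT)\<^sup>2 / R\<^sup>2)"
    unfolding peak_op_eq ell2_inner_lincomb_both[OF f m(2) f m(2)] 1 2 ell2_inner_self[OF f] ell2_inner_self[OF m(2)]
    using R by (simp add: power2_eq_square field_simps)
  then have "(ell2_norm X (peak_op H \<theta> R f))\<^sup>2 = (ell2_norm X f)\<^sup>2
      - 2 * (ell2_norm X ?T)\<^sup>2 / R + (ell2_norm X ?TT)\<^sup>2 / R\<^sup>2"
    unfolding ell2_inner_self[OF peak_op_ell2[OF f]] using of_real_eq_iff by blast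
  moreover have "(ell2_norm X ?TT)\<^sup>2 / R\<^sup>2 \<le> (ell2_norm X ?T)\<^sup>2 / R"
    using bound[OF m(1)] R by (simp add: power2_eq_square field_simps)
  ultimately show ?thesis by (simp add: field_simps)
qed

text \<open>The range is invariant, so the gain of one step can be iterated. The value \<epsilon> =
  0 is allowed and gives mere contraction; the absolute value keeps the factor nonnegative.\<close>

lemma peak_op_pow_norm:
  assumes R: "R > 0" and B: "B \<in> sets borel" and f: "f \<in> spectral_range B" and \<epsilon>: "\<epsilon> \<ge> 0"
    and bound: "\<And>g. g \<in> ell2 X \<Longrightarrow> (ell2_norm X (shifted \<theta> g))\<^sup>2 \<le> R * (ell2_norm X g)\<^sup>2"
    and below: "\<And>g. g \<in> spectral_range B \<Longrightarrow> \<epsilon> * ell2_norm X g \<le> ell2_norm X (shifted \<theta> g)"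
  shows "(peak_op H \<theta> R ^^ k) f \<in> spectral_range B \<and>
    (ell2_norm X ((peak_op H \<theta> R ^^ k) f))\<^sup>2 \<le> \<bar>1 - \<epsilon>\<^sup>2 / R\<bar> ^ k * (ell2_norm X f)\<^sup>2"
proof (induction k)
  case (Suc k)
  let ?g = "(peak_op H \<theta> R ^^ k) f"
  have g: "?g \<in> spectral_range B" "?g \<in> ell2 X" using Suc by (auto simp: spectral_range_def)
  have "\<epsilon>\<^sup>2 * (ell2_norm X ?g)\<^sup>2 \<le> (ell2_norm X (shifted \<theta> ?g))\<^sup>2"
    using power_mono[OF below[OF g(1)], of 2] \<epsilon> by (simp add: power_mult_distrib)
  then have "(ell2_norm X (peak_op H \<theta> R ?g))\<^sup>2 \<le> (ell2_norm X ?g)\<^sup>2 - \<epsilon>\<^sup>2 * (ell2_norm X ?g)\<^sup>2 / R"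
    using peak_op_norm[OF R g(2) bound] R divide_right_mono[of _ _ R] by fastforce
  also have "\<dots> = (1 - \<epsilon>\<^sup>2 / R) * (ell2_norm X ?g)\<^sup>2" by (simp add: algebra_simps)
  also have "\<dots> \<le> \<bar>1 - \<epsilon>\<^sup>2 / R\<bar> * (ell2_norm X ?g)\<^sup>2" by (intro mult_right_mono) auto
  also have "\<dots> \<le> \<bar>1 - \<epsilon>\<^sup>2 / R\<bar> * (\<bar>1 - \<epsilon>\<^sup>2 / R\<bar> ^ k * (ell2_norm X f)\<^sup>2)"
    using Suc by (intro mult_left_mono) auto
  finally show ?case using peak_op_range[OF B g(1)] by (simp add: mult.assoc)
qed (use f in simp)

text \<open>Split \<open>f\<close> along the point \<theta>, the two half-lines at distance
  \<epsilon> and the punctured neighbourhood \<open>S n\<close>. The first part is fixed, the next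
  two decay geometrically, and the last is small from the start because the sets \<open>S n\<close>
  decrease to the empty set.\<close>

lemma peak_op_pow_tendsto:
  assumes R: "R > 0" and f: "f \<in> ell2 X"
    and bound: "\<And>g. g \<in> ell2 X \<Longrightarrow> (ell2_norm X (shifted \<theta> g))\<^sup>2 \<le> R * (ell2_norm X g)\<^sup>2"
  shows "(\<lambda>k. ell2_inner X ((peak_op H \<theta> R ^^ k) f) f) \<longlonglongrightarrow> ell2_inner X (E {\<theta>} f) f"
proof -
  define S where "S n = {\<theta> - inverse (Suc n)<..<\<theta>} \<union> {\<theta><..<\<theta> + inverse (Suc n)}" for n :: nat
  let ?N = "ell2_norm X f"
  let ?A = "peak_op H \<theta> R"
  have Sb: "S n \<in> sets borel" for n by (simp add: S_def)
  interpret fm: finite_measure "\<mu> f" by (rule finite_scalar[OF f])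
  have "(\<lambda>n. measure (\<mu> f) (S n)) \<longlonglongrightarrow> measure (\<mu> f) (\<Inter>n. S n)"
  proof (rule fm.finite_Lim_measure_decseq)
    show "range S \<subseteq> sets (\<mu> f)" using Sb by auto
    show "decseq S" unfolding decseq_Suc_iff
    proof (intro allI)
      fix n
      have "inverse (real (Suc (Suc n))) \<le> inverse (real (Suc n))" by (intro le_imp_inverse_le) auto
      moreover have "{\<theta> - p<..<\<theta>} \<union> {\<theta><..<\<theta> + p} \<subseteq> {\<theta> - q<..<\<theta>} \<union> {\<theta><..<\<theta> + q}" if "p \<le> q" for p q
        using that by auto
      ultimately show "S (Suc n) \<subseteq> S n" unfolding S_def by blast
    qed
  qed
  moreover have "(\<Inter>n. S n) = {}"
  proof -
    have "\<exists>n. t \<notin> S n" for t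
    proof (cases "t = \<theta>")
      case False
      then obtain n where "inverse (real (Suc n)) < \<bar>t - \<theta>\<bar>" using reals_Archimedean[of "\<bar>t - \<theta>\<bar>"] by auto
      then have "t \<notin> S n" by (auto simp: S_def)
      then show ?thesis ..
    qed (auto simp: S_def)
    then show ?thesis by auto
  qed
  ultimately have lim: "(\<lambda>n. (ell2_norm X (E (S n) f))\<^sup>2) \<longlonglongrightarrow> 0"
    using f Sb by (simp add: measure_scalar)
  show ?thesis
  proof (rule LIMSEQ_I)
    fix r :: real assume r: "r > 0"
    \<comment> \<open>The summand 1 keeps the denominator positive when \<open>f\<close> has norm
      0.\<close>
    have r': "r / (2 * (?N + 1)) > 0" using r by (intro divide_pos_pos mult_pos_pos add_nonneg_pos) auto
    then obtain n0 where "\<forall>n\<ge>n0. norm ((ell2_norm X (E (S n) f))\<^sup>2 - 0) < (r / (2 * (?N + 1)))\<^sup>2"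
      using LIMSEQ_D[OF lim zero_less_power] by blast
    then obtain n where n: "(ell2_norm X (E (S n) f))\<^sup>2 < (r / (2 * (?N + 1)))\<^sup>2" by auto
    define \<epsilon> where "\<epsilon> = inverse (real (Suc n))"
    have \<epsilon>: "\<epsilon> > 0" by (simp add: \<epsilon>_def)
    define U L where "U = {\<theta> + \<epsilon>..}" and "L = {..\<theta> - \<epsilon>}"
    have bor: "U \<in> sets borel" "L \<in> sets borel" "{\<theta>} \<in> sets borel" by (auto simp: U_def L_def)
    have f3: "ell2_norm X (E (S n) f) \<le> r / (2 * (?N + 1))"
      using power2_less_imp_less[OF n] r' by simp
    have UNIV: "((({\<theta>} \<union> U) \<union> L) \<union> S n) = UNIV"
      using \<epsilon> by (auto simp: U_def L_def S_def \<epsilon>_def[symmetric] simp del: of_nat_Suc)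
    have d: "{\<theta>} \<inter> U = {}" "({\<theta>} \<union> U) \<inter> L = {}" "(({\<theta>} \<union> U) \<union> L) \<inter> S n = {}"
      using \<epsilon> by (auto simp: U_def L_def S_def \<epsilon>_def[symmetric] simp del: of_nat_Suc)
    define f0 f1 f2 f3 where "f0 = E {\<theta>} f" and "f1 = E U f" and "f2 = E L f" and "f3 = E (S n) f"
    note fi = f0_def f1_def f2_def f3_def
    have eq: "f = (\<lambda>x. ((f0 x + f1 x) + f2 x) + f3 x)" unfolding fi
      using E_Un[OF _ Sb d(3) f] E_Un[OF _ bor(2) d(2) f] E_Un[OF bor(3,1) d(1) f] E_UNIV[OF f] bor
      unfolding UNIV by (simp add: fun_eq_iff)
    have split: "(?A ^^ k) f = (\<lambda>x. (((?A ^^ k) f0 x + (?A ^^ k) f1 x) + (?A ^^ k) f2 x) + (?A ^^ k) f3 x)" for k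
      by (subst eq) (simp only: peak_op_pow_add)
    have "(?A ^^ k) (E {\<theta>} f) = E {\<theta>} f" for k
    proof (induction k)
      case (Suc k)
      have "shifted \<theta> (\<lambda>x. 0) = (\<lambda>x. 0)" using shifted_lincomb[of \<theta> 0 f 0 f] by simp
      then have "?A (E {\<theta>} f) = E {\<theta>} f"
        unfolding peak_op_eq shifted_eigenrange[OF E_in_range[OF bor(3) f]] by simp
      then show ?case using Suc by simp
    qed simp
    then have fix0: "(?A ^^ k) f0 = f0" for k by (simp add: f0_def)
    \<comment> \<open>The cut at \<open>sqrt R\<close> keeps \<open>1 - \<delta>\<^sup>2 / R\<close>
      in [0, 1), so the rate \<open>s\<close> is below 1 even if \<epsilon> is large.\<close>
    define \<delta> where "\<delta> = min \<epsilon> (sqrt R)"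
    have \<delta>: "\<delta> > 0" "\<delta> \<le> \<epsilon>" "\<delta>\<^sup>2 \<le> R"
      using \<epsilon> R power_mono[of \<delta> "sqrt R" 2] by (auto simp: \<delta>_def)
    define s where "s = sqrt \<bar>1 - \<delta>\<^sup>2 / R\<bar>"
    have s: "0 \<le> s" "s < 1" using \<delta> R by (auto simp: s_def field_simps)
    have range: "f1 \<in> spectral_range U" "f2 \<in> spectral_range L" "f3 \<in> spectral_range (S n)"
      unfolding fi using E_in_range bor Sb f by auto
    have below: "\<delta> * ell2_norm X g \<le> ell2_norm X (shifted \<theta> g)" if "g \<in> spectral_range U \<or> g \<in> spectral_range L" for g
    proof -
      have "\<epsilon> * ell2_norm X g \<le> ell2_norm X (shifted \<theta> g)"
        using that shifted_bounded_below[OF bor(1), of \<epsilon> g \<theta>] shifted_bounded_below[OF bor(2), of \<epsilon> g \<theta>] \<epsilon>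
        by (auto simp: U_def L_def)
      moreover have "\<delta> * ell2_norm X g \<le> \<epsilon> * ell2_norm X g" using \<delta> by (intro mult_right_mono) auto
      ultimately show ?thesis by simp
    qed
    have small: "(?A ^^ k) g \<in> ell2 X \<and> ell2_norm X ((?A ^^ k) g) \<le> s ^ k * ?N"
      if g: "g = f1 \<and> B = U \<or> g = f2 \<and> B = L" for k g B
    proof -
      have gB: "B \<in> sets borel" "g \<in> spectral_range B" "g = E B f" using g range bor by (auto simp: fi)
      have "(?A ^^ k) g \<in> spectral_range B \<and> (ell2_norm X ((?A ^^ k) g))\<^sup>2 \<le> \<bar>1 - \<delta>\<^sup>2 / R\<bar> ^ k * (ell2_norm X g)\<^sup>2"
        by (rule peak_op_pow_norm[OF R gB(1,2) _ bound]) (use \<delta> g below in auto)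
      moreover have "ell2_norm X g \<le> ?N" using norm_E_le[OF gB(1) f] gB by simp
      then have "\<bar>1 - \<delta>\<^sup>2 / R\<bar> ^ k * (ell2_norm X g)\<^sup>2 \<le> \<bar>1 - \<delta>\<^sup>2 / R\<bar> ^ k * ?N\<^sup>2"
        by (intro mult_left_mono power_mono) auto
      moreover have "\<bar>1 - \<delta>\<^sup>2 / R\<bar> ^ k * ?N\<^sup>2 = (s ^ k * ?N)\<^sup>2"
      proof -
        have "s\<^sup>2 = \<bar>1 - \<delta>\<^sup>2 / R\<bar>" by (simp add: s_def)
        then show ?thesis by (metis mult.commute power_mult power_mult_distrib)
      qed
      ultimately have "(?A ^^ k) g \<in> ell2 X" "(ell2_norm X ((?A ^^ k) g))\<^sup>2 \<le> (s ^ k * ?N)\<^sup>2"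
        by (auto simp: spectral_range_def)
      then show ?thesis using s by (auto intro: power2_le_imp_le)
    qed
    have A3: "(?A ^^ k) f3 \<in> ell2 X \<and> ell2_norm X ((?A ^^ k) f3) \<le> r / (2 * (?N + 1))" for k
    proof -
      \<comment> \<open>Close to \<theta> no positive lower bound is available, so the constant is 0
        and the powers only fail to increase the norm.\<close>
      have "(?A ^^ k) f3 \<in> spectral_range (S n) \<and> (ell2_norm X ((?A ^^ k) f3))\<^sup>2 \<le> \<bar>1 - 0\<^sup>2 / R\<bar> ^ k * (ell2_norm X f3)\<^sup>2"
        by (rule peak_op_pow_norm[OF R Sb range(3) _ bound]) auto
      then have "(?A ^^ k) f3 \<in> ell2 X" "ell2_norm X ((?A ^^ k) f3) \<le> ell2_norm X f3"
        by (auto simp: spectral_range_def intro: power2_le_imp_le)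
      then show ?thesis using f3[folded f3_def] by simp
    qed
    have L0: "f0 \<in> ell2 X" unfolding f0_def using E_ell2 bor f by blast
    have est: "norm (ell2_inner X ((?A ^^ k) f) f - ell2_inner X (E {\<theta>} f) f) \<le> s ^ k * (2 * ?N\<^sup>2) + r / 2" for k
    proof -
      let ?a = "ell2_inner X ((?A ^^ k) f1) f" and ?b = "ell2_inner X ((?A ^^ k) f2) f" and ?c = "ell2_inner X ((?A ^^ k) f3) f"
      have L: "(?A ^^ k) f1 \<in> ell2 X" "(?A ^^ k) f2 \<in> ell2 X" "(?A ^^ k) f3 \<in> ell2 X"
        using small A3 by auto
      have "ell2_inner X ((?A ^^ k) f) f - ell2_inner X (E {\<theta>} f) f = ?a + ?b + ?c"
        unfolding split fix0 by (simp add: ell2_inner_add ell2_add L L0 f) (simp add: f0_def)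
      then have "norm (ell2_inner X ((?A ^^ k) f) f - ell2_inner X (E {\<theta>} f) f) \<le> cmod ?a + cmod ?b + cmod ?c"
        by (metis (no_types, lifting) add_mono_thms_linordered_semiring(3) norm_triangle_ineq order_trans)
      also have "\<dots> \<le> (s ^ k * ?N) * ?N + (s ^ k * ?N) * ?N + (r / (2 * (?N + 1))) * ?N"
        using small A3 f L by (intro add_mono order_trans[OF ell2_cauchy_schwarz] mult_right_mono) auto
      also have "(r / (2 * (?N + 1))) * ?N \<le> r / 2"
      proof -
        have "(r / (2 * (?N + 1))) * ?N \<le> (r / (2 * (?N + 1))) * (?N + 1)"
          using r' by (intro mult_left_mono) auto
        also have "\<dots> = r / 2"
        proof -
          have g: "x / (2 * b) * b = x / 2" if "b \<noteq> 0" for x b :: real using that by simp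
          have "?N + 1 > 0" by (rule add_nonneg_pos) auto
          then have "?N + 1 \<noteq> 0" by (rule less_imp_neq[THEN not_sym])
          then show ?thesis by (rule g)
        qed
        finally show ?thesis .
      qed
      finally show ?thesis by (simp add: power2_eq_square algebra_simps)
    qed
    have "(\<lambda>k. s ^ k * (2 * ?N\<^sup>2)) \<longlonglongrightarrow> 0 * (2 * ?N\<^sup>2)"
      by (intro tendsto_mult tendsto_const LIMSEQ_realpow_zero s)
    then obtain k0 where k0: "\<And>k. k \<ge> k0 \<Longrightarrow> norm (s ^ k * (2 * ?N\<^sup>2) - 0 * (2 * ?N\<^sup>2)) < r / 2"
      using LIMSEQ_D[of _ _ "r / 2"] r by (metis half_gt_zero)
    have "norm (ell2_inner X ((?A ^^ k) f) f - ell2_inner X (E {\<theta>} f) f) < r" if "k \<ge> k0" for k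
      using est[of k] k0[OF that] by simp
    then show "\<exists>k0. \<forall>k\<ge>k0. norm (ell2_inner X ((?A ^^ k) f) f - ell2_inner X (E {\<theta>} f) f) < r" by blast
  qed
qed

end

section \<open>Boundedness of Schroedinger operators\<close>

lemma schrodinger_op_lincomb:
  "schrodinger_op G w V (\<lambda>x. a * f x + b * g x) =
    (\<lambda>x. a * schrodinger_op G w V f x + b * schrodinger_op G w V g x)"
  by (rule ext) (simp add: schrodinger_op_def sum_distrib_left sum.distrib algebra_simps)

context bidirected_digraph begin

text \<open>The arcs into a vertex are the reverses of those out of it, so each vertex occurs as a
  head at most \<open>D\<close> times.\<close>

lemma sum_heads_le:
  fixes \<phi> :: "'a \<Rightarrow> real"
  assumes F: "finite F" "F \<subseteq> verts G"
    and deg: "\<And>x. x \<in> verts G \<Longrightarrow> finite (out_arcs G x) \<and> card (out_arcs G x) \<le> D"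
    and \<phi>: "\<phi> summable_on verts G" "\<And>x. 0 \<le> \<phi> x"
  shows "(\<Sum>x\<in>F. \<Sum>e\<in>out_arcs G x. \<phi> (head G e)) \<le> real D * infsum \<phi> (verts G)"
proof -
  define EF where "EF = (\<Union>x\<in>F. out_arcs G x)"
  have finE: "finite EF" using F deg by (auto simp: EF_def)
  have EA: "EF \<subseteq> arcs G" by (auto simp: EF_def)
  have "(\<Sum>x\<in>F. \<Sum>e\<in>out_arcs G x. \<phi> (head G e)) = (\<Sum>e\<in>EF. \<phi> (head G e))"
    unfolding EF_def using F deg by (subst sum.UNION_disjoint) auto
  also have "\<dots> = (\<Sum>y\<in>head G ` EF. \<Sum>e\<in>{e \<in> EF. head G e = y}. \<phi> (head G e))"
    by (rule sum.image_gen[OF finE])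
  also have "\<dots> = (\<Sum>y\<in>head G ` EF. real (card {e \<in> EF. head G e = y}) * \<phi> y)"
    by (intro sum.cong refl) simp
  also have "\<dots> \<le> (\<Sum>y\<in>head G ` EF. real D * \<phi> y)"
  proof (intro sum_mono mult_right_mono \<phi>)
    fix y assume "y \<in> head G ` EF"
    then have y: "y \<in> verts G" using EA by auto
    have "{e \<in> EF. head G e = y} \<subseteq> arev ` out_arcs G y" using EA by (auto simp: in_arcs_eq[symmetric])
    then have "card {e \<in> EF. head G e = y} \<le> card (arev ` out_arcs G y)"
      using deg[OF y] by (intro card_mono) auto
    also have "\<dots> \<le> D" using deg[OF y] card_image_le order_trans by blast
    finally show "real (card {e \<in> EF. head G e = y}) \<le> real D" by simp
  qed
  also have "\<dots> = real D * (\<Sum>y\<in>head G ` EF. \<phi> y)" by (simp add: sum_distrib_left)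
  also have "\<dots> \<le> real D * infsum \<phi> (verts G)"
    using finE EA by (intro mult_left_mono finite_sum_le_infsum \<phi>) auto
  finally show ?thesis .
qed

text \<open>Cauchy-Schwarz over the at most D + 1 terms at a vertex gives one factor D + 1; counting
  how often each vertex is used gives the other.\<close>

lemma schrodinger_op_bounded:
  assumes deg: "\<And>x. x \<in> verts G \<Longrightarrow> finite (out_arcs G x) \<and> card (out_arcs G x) \<le> D"
    and w: "\<And>e. e \<in> arcs G \<Longrightarrow> cmod (w e) \<le> W" and V: "\<And>x. x \<in> verts G \<Longrightarrow> \<bar>V x\<bar> \<le> W"
    and f: "f \<in> ell2 (verts G)"
  shows "schrodinger_op G w V f \<in> ell2 (verts G)"
    and "(ell2_norm (verts G) (schrodinger_op G w V f))\<^sup>2 \<le> (real (D + 1) * W)\<^sup>2 * (ell2_norm (verts G) f)\<^sup>2"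
proof -
  let ?H = "schrodinger_op G w V f"
  define \<phi> where "\<phi> = (\<lambda>x. (cmod (f x))\<^sup>2)"
  define C where "C = (real (D + 1) * W)\<^sup>2 * infsum \<phi> (verts G)"
  have \<phi>: "\<phi> summable_on verts G" "\<And>x. 0 \<le> \<phi> x" using f by (auto simp: ell2_def \<phi>_def)
  have pt: "(cmod (?H x))\<^sup>2 \<le> real (D + 1) * W\<^sup>2 * ((\<Sum>e\<in>out_arcs G x. \<phi> (head G e)) + \<phi> x)"
    if x: "x \<in> verts G" for x
  proof -
    \<comment> \<open>\<open>None\<close> indexes the potential term, so that one application of
      Cauchy-Schwarz covers it together with the arcs.\<close>
    define g where "g c = (case c of None \<Rightarrow> W * cmod (f x) | Some e \<Rightarrow> W * cmod (f (head G e)))" for c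
    define I where "I = insert None (Some ` out_arcs G x)"
    have fin: "finite (out_arcs G x)" using deg x by auto
    have W: "W \<ge> 0" using V[OF x] by linarith
    have "cmod (?H x) \<le> (\<Sum>e\<in>out_arcs G x. cmod (w e * f (head G e))) + cmod (of_real (V x) * f x)"
      unfolding schrodinger_op_def by (intro order_trans[OF norm_triangle_ineq] add_mono norm_sum) auto
    also have "\<dots> \<le> (\<Sum>e\<in>out_arcs G x. W * cmod (f (head G e))) + W * cmod (f x)"
      unfolding norm_mult by (intro add_mono sum_mono mult_right_mono) (use w V[OF x] in auto)
    also have "\<dots> = (\<Sum>c\<in>I. g c)"
      unfolding I_def using fin by (subst sum.insert) (auto simp: g_def sum.reindex)
    finally have "(cmod (?H x))\<^sup>2 \<le> (\<Sum>c\<in>I. g c)\<^sup>2" by (intro power_mono) auto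
    also have "\<dots> \<le> (\<Sum>c\<in>I. (g c)\<^sup>2) * real (card I)" by (rule sum_squared_le_sum_of_squares) 
    also have "\<dots> \<le> (\<Sum>c\<in>I. (g c)\<^sup>2) * real (D + 1)"
    proof (intro mult_left_mono sum_nonneg)
      have "card I = card (out_arcs G x) + 1" using fin by (simp add: I_def card_image)
      then show "real (card I) \<le> real (D + 1)" using deg[OF x] by simp
    qed auto
    also have "(\<Sum>c\<in>I. (g c)\<^sup>2) = W\<^sup>2 * ((\<Sum>e\<in>out_arcs G x. \<phi> (head G e)) + \<phi> x)"
      unfolding I_def using fin
      by (subst sum.insert) (auto simp: g_def sum.reindex \<phi>_def power_mult_distrib sum_distrib_left algebra_simps)
    finally show ?thesis by (simp add: mult_ac)
  qed
  have sums: "(\<Sum>x\<in>F. (cmod (?H x))\<^sup>2) \<le> C" if F: "finite F" "F \<subseteq> verts G" for F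
  proof -
    have "(\<Sum>x\<in>F. (cmod (?H x))\<^sup>2)
      \<le> (\<Sum>x\<in>F. real (D + 1) * W\<^sup>2 * ((\<Sum>e\<in>out_arcs G x. \<phi> (head G e)) + \<phi> x))"
      using F pt by (intro sum_mono) auto
    also have "\<dots> = real (D + 1) * W\<^sup>2 * ((\<Sum>x\<in>F. \<Sum>e\<in>out_arcs G x. \<phi> (head G e)) + (\<Sum>x\<in>F. \<phi> x))"
      unfolding sum_distrib_left[symmetric] sum.distrib ..
    also have "\<dots> \<le> real (D + 1) * W\<^sup>2 * (real D * infsum \<phi> (verts G) + infsum \<phi> (verts G))"
      by (intro mult_left_mono add_mono sum_heads_le[OF F deg] finite_sum_le_infsum F \<phi>) auto
    also have "\<dots> = C" by (simp add: C_def power2_eq_square algebra_simps)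
    finally show ?thesis .
  qed
  have summ: "(\<lambda>x. (cmod (?H x))\<^sup>2) summable_on verts G"
    by (rule nonneg_bdd_above_summable_on) (use sums in \<open>auto intro!: bdd_aboveI[of _ C]\<close>)
  have "?H x = 0" if "x \<notin> verts G" for x
  proof -
    have "out_arcs G x = {}" using that by auto
    then show ?thesis using f that by (simp add: schrodinger_op_def ell2_def)
  qed
  then show "?H \<in> ell2 (verts G)" using summ by (auto simp: ell2_def)
  show "(ell2_norm (verts G) ?H)\<^sup>2 \<le> (real (D + 1) * W)\<^sup>2 * (ell2_norm (verts G) f)\<^sup>2"
    using infsum_le_finite_sums[OF summ sums] by (simp add: ell2_norm_power2 C_def \<phi>_def)
qed

end

section \<open>Traces of powers of Hermitian matrices\<close>

definition mat_trace :: "'a::comm_ring_1 mat \<Rightarrow> 'a" where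
  "mat_trace A = (\<Sum>i<dim_row A. A $$ (i, i))"

lemma mat_trace_mult_commute:
  assumes "A \<in> carrier_mat n m" "B \<in> carrier_mat m n"
  shows "mat_trace (A * B) = mat_trace (B * A)"
proof -
  have "mat_trace (A * B) = (\<Sum>i<n. \<Sum>j<m. A $$ (i, j) * B $$ (j, i))"
    using assms unfolding mat_trace_def by (auto simp: scalar_prod_def atLeast0LessThan intro!: sum.cong)
  also have "\<dots> = (\<Sum>j<m. \<Sum>i<n. B $$ (j, i) * A $$ (i, j))"
    by (subst sum.swap) (simp add: mult.commute)
  also have "\<dots> = mat_trace (B * A)"
    using assms unfolding mat_trace_def by (auto simp: scalar_prod_def atLeast0LessThan intro!: sum.cong)
  finally show ?thesis .
qed

lemma mat_trace_similar:
  assumes "A \<in> carrier_mat n n" "similar_mat_wit A B P Q"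
  shows "mat_trace A = mat_trace B"
proof -
  note d = similar_mat_witD2[OF assms]
  have "mat_trace A = mat_trace ((P * B) * Q)" using d by simp
  also have "\<dots> = mat_trace (Q * (P * B))" by (rule mat_trace_mult_commute[of _ n n]) (use d in auto)
  also have "Q * (P * B) = (Q * P) * B" by (rule assoc_mult_mat[symmetric, of _ n n _ n _ n]) (use d in auto)
  also have "\<dots> = B" using d by simp
  finally show ?thesis .
qed

lemma upper_triangular_mult:
  fixes A B :: "'a::comm_ring_1 mat"
  assumes A: "A \<in> carrier_mat n n" "upper_triangular A" and B: "B \<in> carrier_mat n n" "upper_triangular B"
  shows "upper_triangular (A * B)" "\<And>i. i < n \<Longrightarrow> (A * B) $$ (i, i) = A $$ (i, i) * B $$ (i, i)"
proof -
  have ent: "(A * B) $$ (i, j) = (\<Sum>l<n. A $$ (i, l) * B $$ (l, j))" if "i < n" "j < n" for i j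
    using A B that by (auto simp: scalar_prod_def atLeast0LessThan intro!: sum.cong)
  show "upper_triangular (A * B)"
  proof (rule upper_triangularI)
    fix i j assume ij: "j < i" "i < dim_row (A * B)"
    have "A $$ (i, l) * B $$ (l, j) = 0" if "l < n" for l
      using upper_triangularD[OF A(2), of l i] upper_triangularD[OF B(2), of j l] A(1) B(1) ij that
      by (cases "l < i") auto
    then show "(A * B) $$ (i, j) = 0" using ij A by (subst ent) auto
  qed
  fix i assume i: "i < n"
  have "A $$ (i, l) * B $$ (l, i) = (if l = i then A $$ (i, i) * B $$ (i, i) else 0)" if "l < n" for l
    using upper_triangularD[OF A(2), of l i] upper_triangularD[OF B(2), of i l] A(1) B(1) i that
    by (cases l i rule: linorder_cases) auto
  then have "(\<Sum>l<n. A $$ (i, l) * B $$ (l, i)) = (\<Sum>l<n. if l = i then A $$ (i, i) * B $$ (i, i) else 0)"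
    by (intro sum.cong) auto
  then show "(A * B) $$ (i, i) = A $$ (i, i) * B $$ (i, i)" using i by (simp add: ent)
qed

lemma upper_triangular_pow:
  fixes A :: "'a::comm_ring_1 mat"
  assumes A: "A \<in> carrier_mat n n" "upper_triangular A"
  shows "upper_triangular (A ^\<^sub>m k) \<and> (\<forall>i<n. (A ^\<^sub>m k) $$ (i, i) = (A $$ (i, i)) ^ k)"
proof (induction k)
  case 0
  then show ?case using A by simp
next
  case (Suc k)
  have "A ^\<^sub>m k \<in> carrier_mat n n" using A by simp
  then show ?case using upper_triangular_mult[of "A ^\<^sub>m k" n A] A Suc by (simp add: mult.commute)
qed

lemma smult_mat_mult_vec:
  fixes A :: "'a::comm_ring_1 mat"
  assumes "A \<in> carrier_mat n m" "v \<in> carrier_vec m"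
  shows "(k \<cdot>\<^sub>m A) *\<^sub>v v = k \<cdot>\<^sub>v (A *\<^sub>v v)"
  using assms by (intro eq_vecI) (auto simp: scalar_prod_def sum_distrib_left mult.assoc)

lemma order_linear_factors:
  fixes xs :: "'a::idom list"
  shows "Polynomial.order a (\<Prod>x\<leftarrow>xs. [:- x, 1:]) = count_list xs a"
proof (induction xs)
  case (Cons x xs)
  have "(\<Prod>x\<leftarrow>xs. [:- x, 1:]) \<noteq> 0" by (auto simp: prod_list_zero_iff)
  then have "[:- x, 1:] * (\<Prod>x\<leftarrow>xs. [:- x, 1:]) \<noteq> 0" by (simp only: mult_eq_0_iff) simp
  then have "Polynomial.order a ([:- x, 1:] * (\<Prod>x\<leftarrow>xs. [:- x, 1:])) =
    Polynomial.order a [:- x, 1:] + Polynomial.order a (\<Prod>x\<leftarrow>xs. [:- x, 1:])"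
    by (rule order_mult)
  moreover have "Polynomial.order a [:- x, 1:] = (if x = a then 1 else 0)"
    using order_power_n_n[of a 1] order_0I[of "[:- x, 1:]" a] by auto
  ultimately show ?case using Cons by simp
qed (simp add: order_0I)

text \<open>\<open>F\<close> stays an operator on functions so that \<open>peak_op\<close> applies
  to it as on the cover; matrices appear only inside \<open>trace_peak_op\<close>. The constant
  \<open>C\<close> bounds the squared norm.\<close>

locale hermitian_kernel =
  fixes S :: "'v set" and a :: "'v \<Rightarrow> 'v \<Rightarrow> complex" and F :: "('v \<Rightarrow> complex) \<Rightarrow> 'v \<Rightarrow> complex" and C :: real
  assumes finite_S: "finite S"
    and F_kernel: "x \<in> S \<Longrightarrow> F f x = (\<Sum>y\<in>S. a x y * f y)"
    and hermitian: "x \<in> S \<Longrightarrow> y \<in> S \<Longrightarrow> a y x = cnj (a x y)"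
    and bound: "(\<Sum>x\<in>S. (cmod (F f x))\<^sup>2) \<le> C * (\<Sum>x\<in>S. (cmod (f x))\<^sup>2)"
begin

text \<open>The Leibniz expansion of det(x - a), over permutations of \<open>S\<close> itself, in
  the form to which the expansion over oriented cycle sets applies.\<close>

definition kernel_charpoly :: "complex poly" where
  "kernel_charpoly = (\<Sum>p | p permutes S. of_int (sign p) *
     (\<Prod>v\<in>S. (if p v = v then [:0, 1:] else 0) - [:a v (p v):]))"

text \<open>\<open>q\<close> is the quadratic form at the eigenvector: it is real by the symmetry of
  the kernel, and it is \<open>b\<close> times the positive number \<open>N\<close>.\<close>

lemma eigenvalue_real_bounded:
  assumes f: "\<And>x. x \<in> S \<Longrightarrow> F f x = b * f x" and nz: "\<exists>x\<in>S. f x \<noteq> 0"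
  shows "Im b = 0" "(Re b)\<^sup>2 \<le> C"
proof -
  define N where "N = (\<Sum>x\<in>S. (cmod (f x))\<^sup>2)"
  have N: "N > 0" using nz finite_S unfolding N_def by (auto intro!: sum_pos2)
  define q where "q = (\<Sum>x\<in>S. F f x * cnj (f x))"
  have "q = (\<Sum>x\<in>S. b * of_real ((cmod (f x))\<^sup>2))"
    unfolding q_def by (intro sum.cong refl) (simp add: f complex_norm_square mult.assoc del: of_real_power)
  then have q1: "q = b * of_real N" by (simp add: N_def sum_distrib_left)
  have q2: "q = (\<Sum>x\<in>S. \<Sum>y\<in>S. a x y * f y * cnj (f x))"
    unfolding q_def by (intro sum.cong refl) (simp add: F_kernel sum_distrib_right)
  have "cnj q = (\<Sum>x\<in>S. \<Sum>y\<in>S. a y x * cnj (f y) * f x)"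
    unfolding q2 by (simp add: hermitian[symmetric] cong: sum.cong)
  also have "\<dots> = q" unfolding q2 by (subst sum.swap) (simp add: mult_ac)
  finally have "Im q = 0" by (metis cnj.simps(2) equation_minus_iff neg_equal_zero)
  then show im: "Im b = 0" using N by (simp add: q1)
  have "(\<Sum>x\<in>S. (cmod (F f x))\<^sup>2) = (cmod b)\<^sup>2 * N"
    by (simp add: N_def f norm_mult power_mult_distrib sum_distrib_left cong: sum.cong)
  then have "(cmod b)\<^sup>2 * N \<le> C * N" using bound[of f] by (simp add: N_def)
  then have "(cmod b)\<^sup>2 \<le> C" using N by simp
  then show "(Re b)\<^sup>2 \<le> C" using im by (simp add: cmod_def)
qed

text \<open>Schur triangularization puts the values 1 - (b - \<theta>)^2 / R, for the eigenvalues b,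
  on the diagonal. They lie in (0, 1] because b is real with b^2 at most \<open>C\<close>, and the
  value 1 occurs exactly for b = \<theta>.\<close>

lemma trace_peak_op:
  assumes R: "R > 2 * C + 2 * \<theta>\<^sup>2" "R > 0"
  obtains xs :: "real list" where
    "\<And>k. (\<Sum>v\<in>S. (peak_op F \<theta> R ^^ k) (delta v) v) = of_real (\<Sum>x\<leftarrow>xs. x ^ k)"
    "\<And>x. x \<in> set xs \<Longrightarrow> 0 < x \<and> x \<le> 1" "length xs = card S"
    "count_list xs 1 = Polynomial.order (of_real \<theta>) kernel_charpoly"
proof -
  define n where "n = card S"
  obtain h where h: "bij_betw h {0..<n} S" using ex_bij_betw_nat_finite[OF finite_S] n_def by blast
  have hS: "h i \<in> S" if "i < n" for i using h that by (auto simp: bij_betw_def)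
  have hinj: "h i = h j \<longleftrightarrow> i = j" if "i < n" "j < n" for i j using h that by (auto simp: bij_betw_def inj_on_def)
  have sumh: "(\<Sum>y\<in>S. g y) = (\<Sum>i<n. g (h i))" for g :: "'v \<Rightarrow> complex"
    using sum.reindex_bij_betw[OF h, of g] by (simp add: atLeast0LessThan)
  define M where "M = mat n n (\<lambda>(i, j). a (h i) (h j))"
  have M: "M \<in> carrier_mat n n" by (simp add: M_def)
  define u where "u f = vec n (\<lambda>i. f (h i))" for f :: "'v \<Rightarrow> complex"
  have u: "u f \<in> carrier_vec n" for f by (simp add: u_def)
  have Mu: "M *\<^sub>v u f = u (F f)" for f
  proof (rule eq_vecI)
    fix i assume "i < dim_vec (u (F f))"
    then have i: "i < n" by (simp add: u_def)
    have "(M *\<^sub>v u f) $ i = (\<Sum>j<n. a (h i) (h j) * f (h j))"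
      using i by (auto simp: M_def u_def scalar_prod_def atLeast0LessThan intro!: sum.cong)
    then show "(M *\<^sub>v u f) $ i = u (F f) $ i" using i by (simp add: u_def F_kernel hS sumh)
  qed (simp add: M_def u_def)
  \<comment> \<open>\<open>char_matrix A c\<close> is A - c, so \<open>P\<close> is 1 - (M -
    \<theta>)^2 / R, the last 1 coming from subtracting -1.\<close>
  define T where "T = char_matrix M (of_real \<theta>)"
  define Z where "Z = (- of_real (1 / R)) \<cdot>\<^sub>m (T ^\<^sub>m 2)"
  define P where "P = char_matrix Z (-1)"
  have carr: "T \<in> carrier_mat n n" "Z \<in> carrier_mat n n" "P \<in> carrier_mat n n"
    using M by (auto simp: T_def Z_def P_def char_matrix_def)
  have Tu: "T *\<^sub>v u f = u (\<lambda>x. F f x - of_real \<theta> * f x)" for f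
  proof -
    have "T *\<^sub>v u f = M *\<^sub>v u f + (- of_real \<theta> \<cdot>\<^sub>m 1\<^sub>m n) *\<^sub>v u f"
      unfolding T_def char_matrix_def using M u by (simp add: add_mult_distrib_mat_vec[of _ n n])
    also have "(- of_real \<theta> \<cdot>\<^sub>m 1\<^sub>m n) *\<^sub>v u f = - of_real \<theta> \<cdot>\<^sub>v u f"
      using u[of f] by (simp add: smult_mat_mult_vec[of _ n n])
    finally show ?thesis unfolding Mu by (intro eq_vecI) (auto simp: u_def)
  qed
  have Pu: "P *\<^sub>v u f = u (peak_op F \<theta> R f)" for f
  proof -
    define g where "g = (\<lambda>x. F f x - of_real \<theta> * f x)"
    have "P *\<^sub>v u f = Z *\<^sub>v u f + (1 \<cdot>\<^sub>m 1\<^sub>m n) *\<^sub>v u f"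
      unfolding P_def char_matrix_def using carr u by (simp add: add_mult_distrib_mat_vec[of _ n n])
    also have "(1 \<cdot>\<^sub>m 1\<^sub>m n) *\<^sub>v u f = u f"
      using u[of f] by (simp add: smult_mat_mult_vec[of _ n n])
    also have "Z *\<^sub>v u f = (- of_real (1 / R)) \<cdot>\<^sub>v (T *\<^sub>v (T *\<^sub>v u f))"
      unfolding Z_def using carr u[of f]
      by (simp add: smult_mat_mult_vec[of _ n n] numeral_2_eq_2 assoc_mult_mat_vec[of _ n n _ n])
    also have "T *\<^sub>v (T *\<^sub>v u f) = u (\<lambda>x. F g x - of_real \<theta> * g x)" unfolding Tu g_def ..
    finally show ?thesis unfolding peak_op_def Let_def g_def[symmetric]
      by (intro eq_vecI) (auto simp: u_def)
  qed
  have Pk: "(P ^\<^sub>m k) *\<^sub>v u f = u ((peak_op F \<theta> R ^^ k) f)" for k f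
  proof (induction k arbitrary: f)
    case 0 then show ?case using carr u[of f] by simp
  next
    case (Suc k)
    have "(P ^\<^sub>m Suc k) *\<^sub>v u f = (P ^\<^sub>m k) *\<^sub>v (P *\<^sub>v u f)"
      using carr u by (simp add: assoc_mult_mat_vec[of _ n n _ n])
    then show ?case unfolding Pu Suc by (simp add: funpow_swap1)
  qed
  have tr: "(\<Sum>v\<in>S. (peak_op F \<theta> R ^^ k) (delta v) v) = mat_trace (P ^\<^sub>m k)" for k
  proof -
    have "(peak_op F \<theta> R ^^ k) (delta (h i)) (h i) = (P ^\<^sub>m k) $$ (i, i)" if i: "i < n" for i
    proof -
      have "u (delta (h i)) = unit_vec n i"
        by (rule eq_vecI) (auto simp: u_def delta_def unit_vec_def hinj i)
      then have "u ((peak_op F \<theta> R ^^ k) (delta (h i))) = (P ^\<^sub>m k) *\<^sub>v unit_vec n i" using Pk by metis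
      then have "u ((peak_op F \<theta> R ^^ k) (delta (h i))) $ i = (P ^\<^sub>m k) $$ (i, i)"
        using carr i by (simp add: scalar_prod_right_unit[of _ n])
      then show ?thesis using i carr by (simp add: u_def)
    qed
    then show ?thesis using carr by (simp add: sumh mat_trace_def)
  qed
  obtain bs where bs: "char_poly M = (\<Prod>b\<leftarrow>bs. [:- b, 1:])" "length bs = n"
    using char_poly_factorized[OF M] by blast
  obtain B Q Q' where "schur_decomposition M bs = (B, Q, Q')" by (metis prod_cases3)
  then have sd: "similar_mat_wit M B Q Q'" "upper_triangular B" "diag_mat B = bs"
    using schur_decomposition[OF M bs(1)] by auto
  have B: "B \<in> carrier_mat n n" using similar_mat_witD2[OF M sd(1)] by auto
  have Bbs: "B $$ (i, i) = bs ! i" if "i < n" for i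
    using sd(3) that B by (metis carrier_matD(1) diag_mat_def diff_zero length_upt nth_map_upt plus_nat.add_0 add_0)
  \<comment> \<open>The same polynomial of the triangular matrix \<open>B\<close>; each stage of the
    construction preserves similarity with the same transformation.\<close>
  define T' where "T' = char_matrix B (of_real \<theta>)"
  define Z' where "Z' = (- of_real (1 / R)) \<cdot>\<^sub>m (T' ^\<^sub>m 2)"
  define P' where "P' = char_matrix Z' (-1)"
  have carr': "T' \<in> carrier_mat n n" "Z' \<in> carrier_mat n n" "P' \<in> carrier_mat n n"
    using B by (auto simp: T'_def Z'_def P'_def char_matrix_def)
  have sim: "similar_mat_wit (P ^\<^sub>m k) (P' ^\<^sub>m k) Q Q'" for k
    unfolding P_def P'_def Z_def Z'_def T_def T'_def
    by (intro similar_mat_wit_pow similar_mat_wit_char_matrix similar_mat_wit_smult sd(1))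
  have ut: "upper_triangular P'" and dg: "\<And>i. i < n \<Longrightarrow> P' $$ (i, i) = 1 - (bs ! i - of_real \<theta>)\<^sup>2 / of_real R"
  proof -
    have T': "upper_triangular T'" using upper_triangularD[OF sd(2)] B by (auto simp: T'_def char_matrix_def)
    note T2 = upper_triangular_pow[OF carr'(1) T', of 2]
    have dT: "T' $$ (i, i) = bs ! i - of_real \<theta>" if "i < n" for i
      using that B Bbs by (simp add: T'_def char_matrix_def)
    have ent: "P' $$ (i, j) = - of_real (1 / R) * (T' ^\<^sub>m 2) $$ (i, j) + (if i = j then 1 else 0)" if "i < n" "j < n" for i j
      using carr' that unfolding P'_def Z'_def char_matrix_def by (simp add: pow_carrier_mat[of _ n])
    show "upper_triangular P'"
    proof (rule upper_triangularI)
      fix i j assume ij: "j < i" "i < dim_row P'"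
      then have "i < dim_row (T' ^\<^sub>m 2)" using carr' by simp
      then have "(T' ^\<^sub>m 2) $$ (i, j) = 0" using T2 ij by auto
      then show "P' $$ (i, j) = 0" using ent[of i j] ij carr' by simp
    qed
    show "P' $$ (i, i) = 1 - (bs ! i - of_real \<theta>)\<^sup>2 / of_real R" if "i < n" for i
      using ent[OF that that] T2 dT that by (simp add: field_simps)
  qed
  have ev: "Im b = 0 \<and> (Re b)\<^sup>2 \<le> C" if b: "b \<in> set bs" for b
  proof -
    have "poly (char_poly M) b = 0" using b unfolding bs(1) by (induction bs) auto
    then have "eigenvalue M b" using eigenvalue_root_char_poly[OF M] by simp
    then obtain v where v: "v \<in> carrier_vec n" "v \<noteq> 0\<^sub>v n" "M *\<^sub>v v = b \<cdot>\<^sub>v v"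
      using M by (auto simp: eigenvalue_def eigenvector_def)
    define f where "f x = v $ (the_inv_into {0..<n} h x)" for x
    have fh: "f (h i) = v $ i" if "i < n" for i
      using h that by (simp add: f_def bij_betw_def the_inv_into_f_f)
    have uf: "u f = v" using v(1) by (intro eq_vecI) (auto simp: u_def fh)
    have Ff: "F f x = b * f x" if x: "x \<in> S" for x
    proof -
      obtain i where i: "i < n" "x = h i" using x h by (auto simp: bij_betw_def)
      have "u (F f) $ i = (b \<cdot>\<^sub>v v) $ i" using Mu[of f] v uf by simp
      then show ?thesis using i v(1) fh by (simp add: u_def)
    qed
    have "\<exists>i<n. v $ i \<noteq> 0"
    proof (rule ccontr)
      assume "\<not> (\<exists>i<n. v $ i \<noteq> 0)"
      then have "v = 0\<^sub>v n" using v(1) by (intro eq_vecI) auto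
      then show False using v by simp
    qed
    then have "\<exists>x\<in>S. f x \<noteq> 0" using fh hS by metis
    then show ?thesis using eigenvalue_real_bounded[OF Ff] by blast
  qed
  define xs where "xs = map (\<lambda>b. 1 - (Re b - \<theta>)\<^sup>2 / R) bs"
  have xb: "P' $$ (i, i) = of_real (xs ! i)" if i: "i < n" for i
  proof -
    have "bs ! i = of_real (Re (bs ! i))" using ev[of "bs ! i"] i bs(2) by (simp add: complex_eq_iff)
    then have "1 - (bs ! i - of_real \<theta>)\<^sup>2 / of_real R = of_real (1 - (Re (bs ! i) - \<theta>)\<^sup>2 / R)"
      by (metis of_real_1 of_real_diff of_real_divide of_real_power)
    then show ?thesis using dg[OF i] i bs(2) by (simp add: xs_def)
  qed
  \<comment> \<open>The enumeration \<open>h\<close> conjugates permutations of indices to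
    permutations of \<open>S\<close> without changing signs.\<close>
  have det_eq: "char_poly M = kernel_charpoly"
  proof -
    define I where "I = the_inv_into {0..<n} h"
    have hh: "h ` {0..<n} = S" "inj_on h {0..<n}" using h by (auto simp: bij_betw_def)
    have hI: "bij_betw I S {0..<n}" unfolding I_def by (rule bij_betw_the_inv_into[OF h])
    have Ih: "I (h i) = i" if "i < n" for i
      using hh that by (simp add: I_def the_inv_into_f_f)
    have hIx: "h (I x) = x" if "x \<in> S" for x using hh that by (auto simp: I_def f_the_inv_into_f)
    have "char_poly M = (\<Sum>p | p permutes {0..<n}. signof p * (\<Prod>i = 0..<n. char_poly_matrix M $$ (i, p i)))"
      unfolding char_poly_def by (rule det_def'[of _ n]) (use M in simp)
    also have "\<dots> = kernel_charpoly"
      unfolding kernel_charpoly_def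
    proof (rule sum.reindex_bij_witness[where i = "map_permutation S I" and j = "map_permutation {0..<n} h"])
      fix p assume "p \<in> {p. p permutes {0..<n}}"
      then have p: "p permutes {0..<n}" by simp
      show "map_permutation {0..<n} h p \<in> {p. p permutes S}"
        using map_permutation_permutes[OF h p] by simp
      show "map_permutation S I (map_permutation {0..<n} h p) = p"
        by (rule map_permutation_compose_inv[OF h p]) (use Ih in auto)
      have "(\<Prod>v\<in>S. (if map_permutation {0..<n} h p v = v then [:0, 1:] else 0) - [:a v (map_permutation {0..<n} h p v):])
        = (\<Prod>i\<in>{0..<n}. (if map_permutation {0..<n} h p (h i) = h i then [:0, 1:] else 0) - [:a (h i) (map_permutation {0..<n} h p (h i)):])"
        by (rule prod.reindex_bij_betw[OF h, symmetric])
      also have "\<dots> = (\<Prod>i = 0..<n. char_poly_matrix M $$ (i, p i))"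
      proof (rule prod.cong[OF refl])
        fix i assume i: "i \<in> {0..<n}"
        then have pi: "p i < n" using permutes_in_image[OF p, of i] by simp
        have "map_permutation {0..<n} h p (h i) = h (p i)"
          using map_permutation_apply[OF hh(2) i] by simp
        then show "(if map_permutation {0..<n} h p (h i) = h i then [:0, 1:] else 0) - [:a (h i) (map_permutation {0..<n} h p (h i)):] = char_poly_matrix M $$ (i, p i)"
          using i pi hinj[of "p i" i] M by (auto simp: char_poly_matrix_def M_def)
      qed
      finally show "of_int (sign (map_permutation {0..<n} h p)) *
          (\<Prod>v\<in>S. (if map_permutation {0..<n} h p v = v then [:0, 1:] else 0) - [:a v (map_permutation {0..<n} h p v):])
        = signof p * (\<Prod>i = 0..<n. char_poly_matrix M $$ (i, p i))"
        using sign_map_permutation[OF hh(2) p] by simp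
    next
      fix p assume "p \<in> {p. p permutes S}"
      then have p: "p permutes S" by simp
      show "map_permutation S I p \<in> {p. p permutes {0..<n}}"
        using map_permutation_permutes[OF hI p] by simp
      show "map_permutation {0..<n} h (map_permutation S I p) = p"
        by (rule map_permutation_compose_inv[OF hI p]) (use hIx in auto)
    qed
    finally show ?thesis .
  qed
  show ?thesis
  proof (rule that[of xs])
    fix k
    have "mat_trace (P ^\<^sub>m k) = mat_trace (P' ^\<^sub>m k)"
      by (rule mat_trace_similar[OF pow_carrier_mat[OF carr(3)] sim])
    also have "\<dots> = (\<Sum>i<n. (P' $$ (i, i)) ^ k)"
      using upper_triangular_pow[OF carr'(3) ut, of k] carr' by (simp add: mat_trace_def)
    also have "\<dots> = (\<Sum>i<n. of_real ((xs ! i) ^ k))" by (intro sum.cong refl) (simp add: xb)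
    also have "\<dots> = of_real (\<Sum>x\<leftarrow>xs. x ^ k)"
      using bs(2) by (simp add: sum_list_sum_nth xs_def atLeast0LessThan)
    finally show "(\<Sum>v\<in>S. (peak_op F \<theta> R ^^ k) (delta v) v) = of_real (\<Sum>x\<leftarrow>xs. x ^ k)" using tr by simp
  next
    fix x assume "x \<in> set xs"
    then obtain b where b: "b \<in> set bs" "x = 1 - (Re b - \<theta>)\<^sup>2 / R" by (auto simp: xs_def)
    \<comment> \<open>This elementary estimate is the reason for the lower bound on
      \<open>R\<close>.\<close>
    have "(Re b - \<theta>)\<^sup>2 \<le> 2 * (Re b)\<^sup>2 + 2 * \<theta>\<^sup>2"
      using zero_le_power2[of "Re b + \<theta>"] by (simp add: power2_eq_square algebra_simps)
    also have "\<dots> < R" using ev[OF b(1)] R by linarith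
    finally show "0 < x \<and> x \<le> 1" using R by (simp add: b(2))
  next
    show "length xs = card S" using bs(2) by (simp add: xs_def n_def)
  next
    have "count_list xs 1 = count_list bs (of_real \<theta>)"
    proof -
      have "1 - (Re b - \<theta>)\<^sup>2 / R = 1 \<longleftrightarrow> b = of_real \<theta>" if "b \<in> set bs" for b
        using ev[OF that] R by (auto simp: complex_eq_iff)
      then show ?thesis unfolding xs_def by (induction bs) auto
    qed
    also have "\<dots> = Polynomial.order (of_real \<theta>) kernel_charpoly"
      unfolding det_eq[symmetric] bs(1) order_linear_factors ..
    finally show "count_list xs 1 = Polynomial.order (of_real \<theta>) kernel_charpoly" .
  qed
qed

end

section \<open>Random phases\<close>

definition unit_interval :: "real measure" where
  "unit_interval = restrict_space lborel {0..1}"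

lemma space_unit_interval [simp]: "space unit_interval = {0..1}"
  by (simp add: unit_interval_def space_restrict_space)

lemma prob_space_unit_interval: "prob_space unit_interval"
  by (rule prob_spaceI) (simp add: unit_interval_def emeasure_restrict_space space_restrict_space)

lemma measurable_unit_interval: "f \<in> borel_measurable borel \<Longrightarrow> f \<in> borel_measurable unit_interval"
  unfolding unit_interval_def by (intro measurable_restrict_space1) simp

lemma integral_unit_interval_cis:
  "(\<integral>x. cis (2 * pi * real_of_int n * x) \<partial>unit_interval) = (if n = 0 then 1 else 0)"
proof (cases "n = 0")
  case True
  interpret prob_space unit_interval by (rule prob_space_unit_interval)
  show ?thesis using True prob_space by simp
next
  case False
  define c where "c = 2 * pi * real_of_int n"
  have c: "c \<noteq> 0" using False by (simp add: c_def)
  have "(\<integral>x. cis (c * x) \<partial>unit_interval) = (\<integral>x. indicator {0..1} x *\<^sub>R cis (c * x) \<partial>lborel)"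
    unfolding unit_interval_def by (rule integral_restrict_space) simp
  also have "\<dots> = cis (c * 1) / (\<i> * c) - cis (c * 0) / (\<i> * c)"
  proof (rule integral_FTC_atLeastAtMost)
    fix x :: real assume "0 \<le> x" "x \<le> 1"
    have "((\<lambda>x. exp (\<i> * (c * x)) / (\<i> * c)) has_vector_derivative exp (\<i> * (c * x))) (at x within {0..1})"
      by (auto intro!: derivative_eq_intros has_vector_derivative_real_field simp: c algebra_simps)
    then show "((\<lambda>x. cis (c * x) / (\<i> * c)) has_vector_derivative cis (c * x)) (at x within {0..1})"
      by (simp add: cis_conv_exp)
  qed (auto intro!: continuous_intros)
  also have "cis (c * 1) = 1"
    unfolding c_def by (simp add: cis_multiple_2pi)
  finally show ?thesis using False by (simp add: c_def)
qed

section \<open>Characters of the torus of phases\<close>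

definition phase_space :: "'e set \<Rightarrow> (('e \<Rightarrow> real) \<times> real) measure" where
  "phase_space A = Pi\<^sub>M A (\<lambda>_. unit_interval) \<Otimes>\<^sub>M unit_interval"

text \<open>The first component makes the phases independent and uniform. The second one multiplies
  each phase by a different power of a single uniform phase, which reduces almost sure statements on
  the torus to the finiteness of the zero set of a univariate polynomial.\<close>

definition phase :: "('e \<Rightarrow> nat) \<Rightarrow> ('e \<Rightarrow> real) \<times> real \<Rightarrow> 'e \<Rightarrow> real" where
  "phase N \<omega> e = 2 * pi * (fst \<omega> e + real (N e) * snd \<omega>)"

text \<open>The Laurent monomial with exponent vector \<open>m\<close> in the phases of the
  arcs.\<close>

definition character :: "'e set \<Rightarrow> ('e \<Rightarrow> nat) \<Rightarrow> ('e \<Rightarrow> int) \<Rightarrow> ('e \<Rightarrow> real) \<times> real \<Rightarrow> complex" where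
  "character A N m \<omega> = cis (\<Sum>e\<in>A. phase N \<omega> e * real_of_int (m e))"

locale phases =
  fixes A :: "'e set" and N :: "'e \<Rightarrow> nat"
  assumes finite_A: "finite A"
begin

lemma prob_space_phase_space: "prob_space (phase_space A)"
proof -
  interpret U: prob_space unit_interval by (rule prob_space_unit_interval)
  interpret PP: prob_space "Pi\<^sub>M A (\<lambda>_. unit_interval)"
    by (rule prob_space_PiM) (rule prob_space_unit_interval)
  interpret PU: pair_prob_space "Pi\<^sub>M A (\<lambda>_. unit_interval)" unit_interval ..
  show ?thesis unfolding phase_space_def by unfold_locales
qed

lemma phase_measurable: "e \<in> A \<Longrightarrow> (\<lambda>\<omega>. phase N \<omega> e) \<in> borel_measurable (phase_space A)"
proof -
  assume e: "e \<in> A"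
  have id: "(\<lambda>x. x) \<in> borel_measurable unit_interval" by (rule measurable_unit_interval) simp
  have 1: "(\<lambda>\<omega>. fst \<omega> e) \<in> borel_measurable (phase_space A)"
    unfolding phase_space_def
    by (intro measurable_compose[OF measurable_compose[OF measurable_fst measurable_component_singleton[OF e]] id])
  have 2: "(\<lambda>\<omega>. snd \<omega>) \<in> borel_measurable (phase_space A)"
    unfolding phase_space_def by (intro measurable_compose[OF measurable_snd id])
  show ?thesis unfolding phase_def using 1 2 by measurable
qed

lemma cis_measurable: "f \<in> borel_measurable M \<Longrightarrow> (\<lambda>x. cis (f x)) \<in> borel_measurable M"
  by (rule measurable_compose[of _ _ borel])
    (auto intro!: borel_measurable_continuous_onI continuous_intros)

lemma character_measurable: "character A N m \<in> borel_measurable (phase_space A)"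
  unfolding character_def
  by (intro cis_measurable borel_measurable_sum borel_measurable_times phase_measurable) auto

lemma character_integrable: "integrable (phase_space A) (character A N m)"
proof -
  interpret prob_space "phase_space A" by (rule prob_space_phase_space)
  show ?thesis
    by (rule integrable_const_bound[of _ 1]) (simp add: character_def, rule character_measurable)
qed

text \<open>For fixed independent phases \<open>y\<close> a character is an exponential in the
  common phase \<open>s\<close>, with frequency the \<open>N\<close>-weighted sum of the
  exponents.\<close>

lemma character_split:
  "character A N m (y, s) = (\<Prod>e\<in>A. cis (2 * pi * real_of_int (m e) * y e)) *
     cis (2 * pi * real_of_int (\<Sum>e\<in>A. int (N e) * m e) * s)"
proof -
  have "(\<Sum>e\<in>A. phase N (y, s) e * real_of_int (m e)) =
      (\<Sum>e\<in>A. 2 * pi * real_of_int (m e) * y e) + 2 * pi * real_of_int (\<Sum>e\<in>A. int (N e) * m e) * s"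
  proof -
    have "phase N (y, s) e * real_of_int (m e) = 2 * pi * real_of_int (m e) * y e + 2 * pi * real_of_int (int (N e) * m e) * s" for e
      by (simp add: phase_def algebra_simps)
    then show ?thesis by (simp only: sum.distrib sum_distrib_left sum_distrib_right of_int_sum)
  qed
  moreover have "cis (\<Sum>e\<in>A. f e) = (\<Prod>e\<in>A. cis (f e))" for f
    using finite_A by (induction A rule: finite_induct) (auto simp: cis_mult[symmetric])
  ultimately show ?thesis by (simp add: character_def cis_mult[symmetric])
qed

text \<open>The common phase contributes only the factor \<open>c\<close>. The integral over the
  independent phases is a product with a zero factor as soon as one exponent is nonzero.\<close>

lemma integral_character:
  "(\<integral>\<omega>. character A N m \<omega> \<partial>phase_space A) = (if \<forall>e\<in>A. m e = 0 then 1 else 0)"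
proof (cases "\<forall>e\<in>A. m e = 0")
  case True
  interpret prob_space "phase_space A" by (rule prob_space_phase_space)
  have "character A N m \<omega> = 1" for \<omega> using True by (simp add: character_def)
  then show ?thesis using True by (simp add: prob_space)
next
  case False
  interpret U: prob_space unit_interval by (rule prob_space_unit_interval)
  interpret PP: prob_space "Pi\<^sub>M A (\<lambda>_. unit_interval)"
    by (rule prob_space_PiM) (rule prob_space_unit_interval)
  interpret PU: pair_prob_space "Pi\<^sub>M A (\<lambda>_. unit_interval)" unit_interval ..
  interpret PS: product_sigma_finite "\<lambda>_::'e. unit_interval" ..
  define c where "c = (\<integral>s. cis (2 * pi * real_of_int (\<Sum>e\<in>A. int (N e) * m e) * s) \<partial>unit_interval)"
  have intc: "integrable unit_interval (\<lambda>x. cis (a * x))" for a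
    by (rule U.integrable_const_bound[of _ 1])
      (auto intro!: measurable_unit_interval borel_measurable_continuous_onI continuous_intros)
  have "(\<integral>\<omega>. character A N m \<omega> \<partial>phase_space A)
    = (\<integral>y. (\<integral>s. character A N m (y, s) \<partial>unit_interval) \<partial>Pi\<^sub>M A (\<lambda>_. unit_interval))"
    using PU.integral_fst'[of "character A N m"] character_integrable unfolding phase_space_def by simp
  also have "\<dots> = (\<integral>y. (\<Prod>e\<in>A. cis (2 * pi * real_of_int (m e) * y e)) * c \<partial>Pi\<^sub>M A (\<lambda>_. unit_interval))"
    unfolding character_split c_def by simp
  also have "\<dots> = (\<integral>y. (\<Prod>e\<in>A. cis (2 * pi * real_of_int (m e) * y e)) \<partial>Pi\<^sub>M A (\<lambda>_. unit_interval)) * c"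
    by simp
  also have "(\<integral>y. (\<Prod>e\<in>A. cis (2 * pi * real_of_int (m e) * y e)) \<partial>Pi\<^sub>M A (\<lambda>_. unit_interval))
    = (\<Prod>e\<in>A. \<integral>x. cis (2 * pi * real_of_int (m e) * x) \<partial>unit_interval)"
    by (rule PS.product_integral_prod[OF finite_A]) (rule intc)
  also have "\<dots> = 0"
    using False finite_A by (auto simp: integral_unit_interval_cis prod_zero_iff)
  finally show ?thesis using False by simp
qed

text \<open>Up to a unimodular factor the sum is a polynomial in \<open>cis (2 * pi * s)\<close>,
  nonzero because the frequencies are distinct.\<close>

lemma finite_zeros_exponential_sum:
  fixes d :: "'i \<Rightarrow> complex" and k :: "'i \<Rightarrow> int"
  assumes I: "finite I" and inj: "inj_on k I" and nz: "\<exists>i\<in>I. d i \<noteq> 0"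
  shows "finite {s \<in> {0..1}. (\<Sum>i\<in>I. d i * cis (2 * pi * real_of_int (k i) * s)) = 0}"
proof -
  \<comment> \<open>A shift by \<open>K\<close> makes all frequencies nonnegative.\<close>
  define K where "K = (\<Sum>i\<in>I. \<bar>k i\<bar>)"
  have K: "k i + K \<ge> 0" if "i \<in> I" for i
    using member_le_sum[OF that, of "\<lambda>i. \<bar>k i\<bar>"] I by (simp add: K_def)
  define p where "p = (\<Sum>i\<in>I. Polynomial.monom (d i) (nat (k i + K)))"
  have inj': "inj_on (\<lambda>i. nat (k i + K)) I"
    using K inj by (auto simp: inj_on_def eq_nat_nat_iff)
  obtain j where j: "j \<in> I" "d j \<noteq> 0" using nz by blast
  have "coeff p (nat (k j + K)) = (\<Sum>i\<in>I. if i = j then d j else 0)"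
    unfolding p_def coeff_sum using inj' j by (intro sum.cong) (auto simp: inj_on_def)
  then have "coeff p (nat (k j + K)) \<noteq> 0" using j I by simp
  then have "p \<noteq> 0" by auto
  then have fin: "finite {z. poly p z = 0}" by (rule poly_roots_finite)
  \<comment> \<open>The end point 1 gives the same value as 0; it is left out here and put back by
    \<open>insert 1\<close> below.\<close>
  have inj_cis: "inj_on (\<lambda>s. cis (2 * pi * s)) {0..<1}"
  proof (rule inj_onI)
    fix s t :: real assume st: "s \<in> {0..<1}" "t \<in> {0..<1}" and "cis (2 * pi * s) = cis (2 * pi * t)"
    then have "sin (2 * pi * s) = sin (2 * pi * t) \<and> cos (2 * pi * s) = cos (2 * pi * t)"
      by (simp add: complex_eq_iff)
    then obtain n :: int where "2 * pi * s = 2 * pi * t + 2 * pi * n" using sin_cos_eq_iff by metis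
    then have "2 * pi * s = 2 * pi * (t + n)" by (simp add: algebra_simps)
    then have n: "s = t + n" by simp
    then have "real_of_int n < 1" "- 1 < real_of_int n" using st by auto
    then have "n = 0" by linarith
    then show "s = t" using n by simp
  qed
  have "{s \<in> {0..1}. (\<Sum>i\<in>I. d i * cis (2 * pi * real_of_int (k i) * s)) = 0}
      \<subseteq> insert 1 ((\<lambda>s. cis (2 * pi * s)) -` {z. poly p z = 0} \<inter> {0..<1})"
  proof
    fix s assume "s \<in> {s \<in> {0..1}. (\<Sum>i\<in>I. d i * cis (2 * pi * real_of_int (k i) * s)) = 0}"
    then have s: "s \<in> {0..1}" and 0: "(\<Sum>i\<in>I. d i * cis (2 * pi * real_of_int (k i) * s)) = 0" by auto
    have "poly p (cis (2 * pi * s)) = (\<Sum>i\<in>I. d i * cis (2 * pi * real_of_int (k i) * s) * cis (2 * pi * K * s))"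
      unfolding p_def poly_sum poly_monom
    proof (intro sum.cong refl)
      fix i assume i: "i \<in> I"
      have "cis (2 * pi * s) ^ nat (k i + K) = cis (real (nat (k i + K)) * (2 * pi * s))" by (rule Complex.DeMoivre)
      also have "real (nat (k i + K)) * (2 * pi * s) = 2 * pi * real_of_int (k i) * s + 2 * pi * K * s"
        using K[OF i] by (simp add: algebra_simps)
      finally show "d i * cis (2 * pi * s) ^ nat (k i + K) = d i * cis (2 * pi * real_of_int (k i) * s) * cis (2 * pi * K * s)"
        by (simp add: cis_mult)
    qed
    also have "\<dots> = 0" using 0 by (simp add: sum_distrib_right[symmetric])
    finally show "s \<in> insert 1 ((\<lambda>s. cis (2 * pi * s)) -` {z. poly p z = 0} \<inter> {0..<1})" using s by auto
  qed
  then show ?thesis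
    by (rule finite_subset) (use finite_vimage_IntI[OF fin inj_cis] in simp)
qed

text \<open>For each fixed value of the independent phases only finitely many values of the common
  phase are zeros; a Fubini argument concludes.\<close>

lemma AE_character_sum_nonzero:
  fixes c :: "'i \<Rightarrow> complex" and m :: "'i \<Rightarrow> 'e \<Rightarrow> int"
  assumes I: "finite I" and inj: "inj_on (\<lambda>i. \<Sum>e\<in>A. int (N e) * m i e) I" and nz: "\<exists>i\<in>I. c i \<noteq> 0"
  shows "AE \<omega> in phase_space A. (\<Sum>i\<in>I. c i * character A N (m i) \<omega>) \<noteq> 0"
proof -
  interpret U: prob_space unit_interval by (rule prob_space_unit_interval)
  interpret PP: prob_space "Pi\<^sub>M A (\<lambda>_. unit_interval)"
    by (rule prob_space_PiM) (rule prob_space_unit_interval)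
  interpret PU: pair_prob_space "Pi\<^sub>M A (\<lambda>_. unit_interval)" unit_interval ..
  have meas: "(\<lambda>\<omega>. \<Sum>i\<in>I. c i * character A N (m i) \<omega>) \<in> borel_measurable (phase_space A)"
    by (intro borel_measurable_sum borel_measurable_times character_measurable) auto
  have "AE s in unit_interval. (\<Sum>i\<in>I. c i * character A N (m i) (y, s)) \<noteq> 0" for y
  proof -
    \<comment> \<open>The factors absorbed into \<open>d\<close> are unimodular, so a nonzero
      coefficient stays nonzero.\<close>
    define d where "d i = c i * (\<Prod>e\<in>A. cis (2 * pi * real_of_int (m i e) * y e))" for i
    let ?Z = "{s \<in> {0..1}. (\<Sum>i\<in>I. d i * cis (2 * pi * real_of_int (\<Sum>e\<in>A. int (N e) * m i e) * s)) = 0}"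
    have "\<exists>i\<in>I. d i \<noteq> 0" using nz finite_A by (auto simp: d_def)
    then have fin: "finite ?Z" by (intro finite_zeros_exponential_sum[OF I inj])
    have "emeasure lborel ?Z = 0" by (rule emeasure_lborel_countable) (use fin countable_finite in blast)
    moreover have "?Z \<in> sets lborel" using fin by (simp add: finite_imp_closed borel_closed)
    ultimately have "?Z \<in> null_sets unit_interval"
      unfolding unit_interval_def by (subst null_sets_restrict_space) (auto simp: null_sets_def)
    moreover have "(\<Sum>i\<in>I. c i * character A N (m i) (y, s))
        = (\<Sum>i\<in>I. d i * cis (2 * pi * real_of_int (\<Sum>e\<in>A. int (N e) * m i e) * s))" for s
      by (simp only: character_split d_def mult.assoc)
    ultimately show ?thesis by (intro AE_I'[of ?Z]) (auto simp del: of_int_sum)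
  qed
  then have "AE y in Pi\<^sub>M A (\<lambda>_. unit_interval). AE s in unit_interval. (\<Sum>i\<in>I. c i * character A N (m i) (y, s)) \<noteq> 0"
    by simp
  then show ?thesis
    unfolding phase_space_def
  proof (rule PU.AE_pair_measure[rotated])
    have "{\<omega> \<in> space (phase_space A). (\<Sum>i\<in>I. c i * character A N (m i) \<omega>) \<noteq> 0} \<in> sets (phase_space A)"
      using meas by measurable
    then show "{\<omega> \<in> space (Pi\<^sub>M A (\<lambda>_. unit_interval) \<Otimes>\<^sub>M unit_interval). (\<Sum>i\<in>I. c i * character A N (m i) \<omega>) \<noteq> 0}
      \<in> sets (Pi\<^sub>M A (\<lambda>_. unit_interval) \<Otimes>\<^sub>M unit_interval)"
      unfolding phase_space_def .
  qed
qed

end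

text \<open>The digits below position n contribute less than 3^n in absolute value, so the top digit
  must vanish. The bound 2 is what the difference of two vectors with entries in {-1, 0, 1}
  satisfies.\<close>

lemma ternary_sum_zero:
  fixes d :: "nat \<Rightarrow> int"
  assumes "\<And>i. i < n \<Longrightarrow> \<bar>d i\<bar> \<le> 2" "(\<Sum>i<n. 3 ^ i * d i) = 0" "i < n"
  shows "d i = 0"
  using assms
proof (induction n arbitrary: i)
  case (Suc n)
  have b: "\<bar>\<Sum>i<k. 3 ^ i * d i\<bar> < 3 ^ k" if "k \<le> n" for k
    using that
  proof (induction k)
    case (Suc k)
    have "\<bar>3 ^ k * d k\<bar> \<le> 3 ^ k * 2" using Suc.prems \<open>\<And>i. i < Suc n \<Longrightarrow> \<bar>d i\<bar> \<le> 2\<close>[of k] by (simp add: abs_mult)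
    moreover have "\<bar>\<Sum>i<k. 3 ^ i * d i\<bar> < 3 ^ k" using Suc by simp
    ultimately show ?case unfolding sum.lessThan_Suc power_Suc by linarith
  qed simp
  have "d n = 0"
  proof (rule ccontr)
    assume "d n \<noteq> 0"
    then have "\<bar>3 ^ n * d n\<bar> \<ge> 3 ^ n" by (simp add: abs_mult)
    then show False using b[of n] Suc.prems(2) by simp
  qed
  have "(\<Sum>i<n. 3 ^ i * d i) = 0" using Suc.prems(2) \<open>d n = 0\<close> by simp
  then have "d i = 0" if "i < n" for i
    using Suc.IH Suc.prems(1) that by (metis less_SucI)
  then show ?case using \<open>d n = 0\<close> Suc.prems(3) by (metis less_SucE)
qed simp

section \<open>The Floquet transform on the maximal abelian cover\<close>

text \<open>The difference makes the factors of opposite arcs conjugate, so that twisted weights are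
  again the weights of a Schroedinger operator.\<close>

definition edge_phase :: "('e \<Rightarrow> nat) \<Rightarrow> ('e \<Rightarrow> 'e) \<Rightarrow> ('e \<Rightarrow> real) \<times> real \<Rightarrow> 'e \<Rightarrow> complex" where
  "edge_phase N rv \<omega> e = cis (phase N \<omega> e - phase N \<omega> (rv e))"

lemma schrodinger_op_integral:
  assumes fin: "\<And>x. finite (out_arcs G x)" and F: "\<And>x. integrable M (\<lambda>\<omega>. F \<omega> x)"
  shows "schrodinger_op G w V (\<lambda>x. \<integral>\<omega>. F \<omega> x \<partial>M) x = (\<integral>\<omega>. schrodinger_op G w V (F \<omega>) x \<partial>M)"
    and "integrable M (\<lambda>\<omega>. schrodinger_op G w V (F \<omega>) x)"
  unfolding schrodinger_op_def using fin F by simp_all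

lemma peak_op_integral:
  assumes H: "\<And>F x. (\<And>x. integrable M (\<lambda>\<omega>. F \<omega> x)) \<Longrightarrow>
      H (\<lambda>x. \<integral>\<omega>. F \<omega> x \<partial>M) x = (\<integral>\<omega>. H (F \<omega>) x \<partial>M) \<and> integrable M (\<lambda>\<omega>. H (F \<omega>) x)"
    and F: "\<And>x. integrable M (\<lambda>\<omega>. F \<omega> x)"
  shows "peak_op H \<theta> R (\<lambda>x. \<integral>\<omega>. F \<omega> x \<partial>M) = (\<lambda>x. \<integral>\<omega>. peak_op H \<theta> R (F \<omega>) x \<partial>M)"
    and "integrable M (\<lambda>\<omega>. peak_op H \<theta> R (F \<omega>) x)"
proof -
  define T where "T f = (\<lambda>x. H f x - of_real \<theta> * f x)" for f :: "'b \<Rightarrow> complex"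
  have T: "T (\<lambda>x. \<integral>\<omega>. F \<omega> x \<partial>M) x = (\<integral>\<omega>. T (F \<omega>) x \<partial>M) \<and> integrable M (\<lambda>\<omega>. T (F \<omega>) x)"
    if "\<And>x. integrable M (\<lambda>\<omega>. F \<omega> x)" for F x
    using H[OF that] that by (simp add: T_def)
  have T1: "T (\<lambda>x. \<integral>\<omega>. F \<omega> x \<partial>M) = (\<lambda>x. \<integral>\<omega>. T (F \<omega>) x \<partial>M)" using T[OF F] by auto
  have T2: "integrable M (\<lambda>\<omega>. T (F \<omega>) x)" for x using T[OF F] by auto
  have p: "peak_op H \<theta> R f = (\<lambda>x. f x - of_real (1 / R) * T (T f) x)" for f
    by (simp add: peak_op_def T_def[abs_def] Let_def)
  note T3 = T[of "\<lambda>\<omega>. T (F \<omega>)", OF T2]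
  show "peak_op H \<theta> R (\<lambda>x. \<integral>\<omega>. F \<omega> x \<partial>M) = (\<lambda>x. \<integral>\<omega>. peak_op H \<theta> R (F \<omega>) x \<partial>M)"
    unfolding p T1 using T3 F by (intro ext) simp
  show "integrable M (\<lambda>\<omega>. peak_op H \<theta> R (F \<omega>) x)"
    unfolding p using T3 F by simp
qed

lemma peak_op_pow_integral:
  assumes H: "\<And>F x. (\<And>x. integrable M (\<lambda>\<omega>. F \<omega> x)) \<Longrightarrow>
      H (\<lambda>x. \<integral>\<omega>. F \<omega> x \<partial>M) x = (\<integral>\<omega>. H (F \<omega>) x \<partial>M) \<and> integrable M (\<lambda>\<omega>. H (F \<omega>) x)"
    and F: "\<And>x. integrable M (\<lambda>\<omega>. F \<omega> x)"
  shows "(peak_op H \<theta> R ^^ k) (\<lambda>x. \<integral>\<omega>. F \<omega> x \<partial>M) = (\<lambda>x. \<integral>\<omega>. (peak_op H \<theta> R ^^ k) (F \<omega>) x \<partial>M) \<and>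
    (\<forall>x. integrable M (\<lambda>\<omega>. (peak_op H \<theta> R ^^ k) (F \<omega>) x))"
proof (induction k)
  case (Suc k)
  then have I: "\<And>x. integrable M (\<lambda>\<omega>. (peak_op H \<theta> R ^^ k) (F \<omega>) x)" by blast
  show ?case using peak_op_integral[where H = H and F = "\<lambda>\<omega>. (peak_op H \<theta> R ^^ k) (F \<omega>)", OF H I] Suc by auto
qed (use F in simp)

lemma peak_op_intertwine:
  assumes H: "\<And>f. H (U f) = U (H' f)"
    and U: "\<And>f g a b. U (\<lambda>x. a * f x + b * g x) = (\<lambda>x. a * U f x + b * U g x)"
  shows "(peak_op H \<theta> R ^^ k) (U f) = U ((peak_op H' \<theta> R ^^ k) f)"
proof (induction k)
  case (Suc k)
  have T: "(\<lambda>x. H (U f) x - of_real \<theta> * U f x) = U (\<lambda>x. H' f x - of_real \<theta> * f x)" for f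
    using U[of 1 "H' f" "- of_real \<theta>" f] by (simp add: H)
  have "peak_op H \<theta> R (U f) = U (peak_op H' \<theta> R f)" for f
    using U[of 1 f "- of_real (1 / R)"] by (simp add: peak_op_def Let_def T)
  then show ?case using Suc by simp
qed simp

section \<open>Exponents of walks and quasi-periodic functions on the cover\<close>

context graph_cover begin

lemma map_rev_walk: "set p \<subseteq> arcs G' \<Longrightarrow> map pE (rev_walk arev' p) = rev_walk arev (map pE p)"
  by (induction p) (auto simp: pE_arcs)

lemma finite_out_arcs:
  assumes "finite (arcs G)"
  shows "finite (out_arcs G' x)" "card (out_arcs G' x) \<le> card (arcs G)"
proof -
  have "finite (out_arcs G' x) \<and> card (out_arcs G' x) \<le> card (arcs G)"
  proof (cases "x \<in> verts G'")
    case True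
    have "finite (out_arcs G (pV x))" using assms by (rule rev_finite_subset) auto
    moreover have "card (out_arcs G (pV x)) \<le> card (arcs G)" using assms by (intro card_mono) auto
    ultimately show ?thesis using pE_bij[OF True] bij_betw_finite bij_betw_same_card by metis
  next
    case False
    then have "out_arcs G' x = {}" by auto
    then show ?thesis by simp
  qed
  then show "finite (out_arcs G' x)" "card (out_arcs G' x) \<le> card (arcs G)" by auto
qed

end

locale finite_abelian_cover = abelian_cover + phases "arcs G" N for N
begin

text \<open>The homological displacement from \<open>x0\<close> to \<open>x\<close>; by
  \<open>walk_net_eq\<close> any walk may be taken.\<close>

definition walk_net where
  "walk_net x0 x = net_count arev (map pE (SOME p. cover.awalk x0 p x))"

text \<open>The quasi-periodic lift of \<open>f\<close>: its value is multiplied by the phase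
  collected on the way from \<open>x0\<close>. It is 0 off the component of \<open>x0\<close>, and
  the operator respects this.\<close>

definition floquet where
  "floquet x0 \<omega> f x =
    (if \<exists>p. cover.awalk x0 p x then character (arcs G) N (walk_net x0 x) \<omega> * f (pV x) else 0)"

text \<open>Two walks with the same ends combine to a closed walk of the cover, whose projection has
  net counts zero.\<close>

lemma walk_net_eq:
  assumes p: "cover.awalk x0 p x"
  shows "walk_net x0 x e = net_count arev (map pE p) e"
proof -
  define q where "q = (SOME p. cover.awalk x0 p x)"
  have q: "cover.awalk x0 q x" unfolding q_def using p by (rule someI)
  have "cover.awalk x0 (q @ rev_walk arev' p) x0"
    using q cover.awalk_rev_walk[OF p] cover.awalk_appendI by blast
  then have "net_count arev (map pE (q @ rev_walk arev' p)) e = 0" by (rule closed_walk_net_zero)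
  moreover have "set p \<subseteq> arcs G'" using p by (auto simp: cover.awalk_def)
  ultimately have "net_count arev (map pE q) e = net_count arev (map pE p) e"
    by (simp add: map_rev_walk)
  then show ?thesis by (simp add: walk_net_def q_def)
qed

lemma character_step:
  assumes "e \<in> arcs G"
  shows "character (arcs G) N (\<lambda>f. m f + net_count arev [e] f) \<omega>
    = character (arcs G) N m \<omega> * edge_phase N arev \<omega> e"
proof -
  have "(\<Sum>f\<in>arcs G. phase N \<omega> f * real_of_int (m f + net_count arev [e] f))
    = (\<Sum>f\<in>arcs G. phase N \<omega> f * real_of_int (m f) + ((if f = e then phase N \<omega> e else 0)
        - (if f = arev e then phase N \<omega> (arev e) else 0)))"
    by (intro sum.cong refl) (auto simp: net_count_def algebra_simps)
  also have "\<dots> = (\<Sum>f\<in>arcs G. phase N \<omega> f * real_of_int (m f)) + (phase N \<omega> e - phase N \<omega> (arev e))"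
    using finite_A assms by (simp add: sum.distrib sum_subtractf)
  finally show ?thesis by (simp add: character_def edge_phase_def cis_mult)
qed

text \<open>Arcs out of \<open>x\<close> correspond to arcs out of its projection, and each step
  multiplies the collected phase by the twist of the projected arc.\<close>

lemma floquet_intertwine:
  "schrodinger_op G' (w \<circ> pE) (V \<circ> pV) (floquet x0 \<omega> f)
    = floquet x0 \<omega> (schrodinger_op G (\<lambda>e. w e * edge_phase N arev \<omega> e) V f)"
proof
  fix x
  show "schrodinger_op G' (w \<circ> pE) (V \<circ> pV) (floquet x0 \<omega> f) x
    = floquet x0 \<omega> (schrodinger_op G (\<lambda>e. w e * edge_phase N arev \<omega> e) V f) x"
  proof (cases "\<exists>p. cover.awalk x0 p x")
    case False
    have "floquet x0 \<omega> f (head G' e) = 0" if e: "e \<in> out_arcs G' x" for e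
    proof -
      have "\<not> cover.awalk x0 q (head G' e)" for q
      proof
        assume "cover.awalk x0 q (head G' e)"
        moreover have "cover.awalk (head G' e) [arev' e] x" using e by (auto simp: cover.awalk_simps)
        ultimately show False using False cover.awalk_appendI by blast
      qed
      then show ?thesis by (simp add: floquet_def)
    qed
    then show ?thesis using False by (simp add: schrodinger_op_def floquet_def)
  next
    case True
    then obtain p where p: "cover.awalk x0 p x" by blast
    have x: "x \<in> verts G'" using p by (rule cover.awalk_last_in_verts)
    let ?c = "character (arcs G) N (walk_net x0 x) \<omega>"
    have step: "floquet x0 \<omega> f (head G' e) = ?c * (edge_phase N arev \<omega> (pE e) * f (head G (pE e)))"
      if e: "e \<in> out_arcs G' x" for e
    proof -
      have eA: "e \<in> arcs G'" "tail G' e = x" using e by auto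
      have "cover.awalk x [e] (head G' e)" using eA by (auto simp: cover.awalk_simps)
      then have pe: "cover.awalk x0 (p @ [e]) (head G' e)" using p cover.awalk_appendI by blast
      have "walk_net x0 (head G' e) = (\<lambda>g. walk_net x0 x g + net_count arev [pE e] g)"
        by (rule ext) (simp add: walk_net_eq[OF pe] walk_net_eq[OF p])
      then show ?thesis
        using pe eA by (auto simp: floquet_def character_step pE_arcs)
    qed
    have "(\<Sum>e\<in>out_arcs G' x. (w \<circ> pE) e * floquet x0 \<omega> f (head G' e))
      = (\<Sum>e\<in>out_arcs G' x. ?c * (w (pE e) * edge_phase N arev \<omega> (pE e) * f (head G (pE e))))"
      by (intro sum.cong refl) (simp add: step)
    also have "\<dots> = (\<Sum>e\<in>out_arcs G (pV x). ?c * (w e * edge_phase N arev \<omega> e * f (head G e)))"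
      by (rule sum.reindex_bij_betw[OF pE_bij[OF x]])
    finally show ?thesis
      using True by (simp add: schrodinger_op_def floquet_def sum_distrib_left algebra_simps)
  qed
qed

lemma floquet_lincomb:
  "floquet x0 \<omega> (\<lambda>x. a * f x + b * g x) = (\<lambda>x. a * floquet x0 \<omega> f x + b * floquet x0 \<omega> g x)"
  by (auto simp: floquet_def algebra_simps)

lemma floquet_integrable: "integrable (phase_space (arcs G)) (\<lambda>\<omega>. floquet x0 \<omega> f x)"
  unfolding floquet_def by (cases "\<exists>p. cover.awalk x0 p x") (simp_all add: character_integrable)

text \<open>This is where the maximality of the abelian cover enters: the characters separate
  the points of a fibre.\<close>

lemma delta_eq_floquet_integral:
  assumes x0: "x0 \<in> verts G'"
  shows "delta x0 = (\<lambda>x. \<integral>\<omega>. floquet x0 \<omega> (delta (pV x0)) x \<partial>phase_space (arcs G))"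
proof
  fix x
  have nil: "cover.awalk x0 [] x0" using x0 by (simp add: cover.awalk_simps)
  show "delta x0 x = (\<integral>\<omega>. floquet x0 \<omega> (delta (pV x0)) x \<partial>phase_space (arcs G))"
  proof (cases "(\<exists>p. cover.awalk x0 p x) \<and> pV x = pV x0")
    case True
    then obtain p where p: "cover.awalk x0 p x" and v: "pV x = pV x0" by blast
    have "(\<forall>e\<in>arcs G. walk_net x0 x e = 0) \<longleftrightarrow> x = x0"
    proof
      assume z: "\<forall>e\<in>arcs G. walk_net x0 x e = 0"
      have "net_count arev (map pE p) e = 0" for e
      proof (cases "e \<in> arcs G")
        case True then show ?thesis using z walk_net_eq[OF p] by simp
      next
        case False
        \<comment> \<open>Outside \<open>arcs G\<close> the reversal is the identity, so the two
          counts cancel.\<close>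
        then show ?thesis by (simp add: net_count_def base.arev_eq)
      qed
      then show "x = x0" using net_zero_closed_walk[OF p v] by simp
    next
      assume "x = x0"
      then show "\<forall>e\<in>arcs G. walk_net x0 x e = 0" using walk_net_eq[OF nil] by simp
    qed
    then show ?thesis
      using True integral_character[of "walk_net x0 x"] by (auto simp: floquet_def delta_def)
  next
    case False
    then have "x \<noteq> x0" using nil by auto
    moreover have "floquet x0 \<omega> (delta (pV x0)) x = 0" for \<omega>
      using False by (auto simp: floquet_def delta_def)
    ultimately show ?thesis by (simp add: delta_def)
  qed
qed

text \<open>Powers of the peak operator commute with the average and with the Floquet map. At
  \<open>x0\<close> no phase has been collected, so the Floquet map returns the value at the
  projection.\<close>

lemma peak_op_return:
  fixes w V
  assumes x0: "x0 \<in> verts G'"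
  defines "K \<omega> \<equiv> schrodinger_op G (\<lambda>e. w e * edge_phase N arev \<omega> e) V"
  shows "(peak_op (schrodinger_op G' (w \<circ> pE) (V \<circ> pV)) \<theta> R ^^ k) (delta x0) x0
      = (\<integral>\<omega>. (peak_op (K \<omega>) \<theta> R ^^ k) (delta (pV x0)) (pV x0) \<partial>phase_space (arcs G))"
    and "integrable (phase_space (arcs G)) (\<lambda>\<omega>. (peak_op (K \<omega>) \<theta> R ^^ k) (delta (pV x0)) (pV x0))"
proof -
  let ?H = "schrodinger_op G' (w \<circ> pE) (V \<circ> pV)" and ?M = "phase_space (arcs G)"
  let ?F = "\<lambda>\<omega>. floquet x0 \<omega> (delta (pV x0))"
  have nil: "cover.awalk x0 [] x0" using x0 by (simp add: cover.awalk_simps)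
  have int: "(peak_op ?H \<theta> R ^^ k) (\<lambda>x. \<integral>\<omega>. ?F \<omega> x \<partial>?M) = (\<lambda>x. \<integral>\<omega>. (peak_op ?H \<theta> R ^^ k) (?F \<omega>) x \<partial>?M) \<and>
    (\<forall>x. integrable ?M (\<lambda>\<omega>. (peak_op ?H \<theta> R ^^ k) (?F \<omega>) x))"
  proof (rule peak_op_pow_integral[where H = ?H and F = ?F and M = ?M])
    fix F :: "_ \<Rightarrow> 'c \<Rightarrow> complex" and x :: 'c assume "\<And>x. integrable ?M (\<lambda>\<omega>. F \<omega> x :: complex)"
    then show "?H (\<lambda>x. \<integral>\<omega>. F \<omega> x \<partial>?M) x = (\<integral>\<omega>. ?H (F \<omega>) x \<partial>?M) \<and> integrable ?M (\<lambda>\<omega>. ?H (F \<omega>) x)"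
      using schrodinger_op_integral[where F = F and M = ?M, OF finite_out_arcs(1)[OF finite_A]] by blast
  qed (rule floquet_integrable)
  have "(peak_op ?H \<theta> R ^^ k) (?F \<omega>) = floquet x0 \<omega> ((peak_op (K \<omega>) \<theta> R ^^ k) (delta (pV x0)))" for \<omega>
    unfolding K_def
    by (rule peak_op_intertwine[where U = "floquet x0 \<omega>" and H = ?H])
      (rule floquet_intertwine, rule floquet_lincomb)
  moreover have "floquet x0 \<omega> f x0 = f (pV x0)" for \<omega> f
  proof -
    have "walk_net x0 x0 = (\<lambda>e. 0)" using walk_net_eq[OF nil] by auto
    then show ?thesis using nil by (auto simp: floquet_def character_def)
  qed
  ultimately have ret: "(peak_op ?H \<theta> R ^^ k) (?F \<omega>) x0 = (peak_op (K \<omega>) \<theta> R ^^ k) (delta (pV x0)) (pV x0)" for \<omega>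
    by simp
  show "(peak_op ?H \<theta> R ^^ k) (delta x0) x0
      = (\<integral>\<omega>. (peak_op (K \<omega>) \<theta> R ^^ k) (delta (pV x0)) (pV x0) \<partial>?M)"
    by (subst (1) delta_eq_floquet_integral[OF x0]) (simp add: int ret)
  show "integrable ?M (\<lambda>\<omega>. (peak_op (K \<omega>) \<theta> R ^^ k) (delta (pV x0)) (pV x0))"
    using int unfolding ret[symmetric] by blast
qed

end

section \<open>Characteristic polynomials of the fibre operators\<close>

lemma prod_const_poly: "(\<Prod>e\<in>F. [:f e:]) = [:\<Prod>e\<in>F. f e::'a::comm_ring_1:]"
  by (induction F rule: infinite_finite_induct) (auto simp: one_pCons)

lemma order_times_power:
  fixes s :: "'a::idom poly"
  assumes "poly s a \<noteq> 0"
  shows "Polynomial.order a ([:- a, 1:] ^ m * s) = m"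
proof -
  have "s \<noteq> 0" using assms by auto
  then have "[:- a, 1:] ^ m * s \<noteq> 0" by simp
  then show ?thesis using assms by (simp add: order_mult order_power_n_n order_0I)
qed

text \<open>Here \<open>d i\<close> is the value at \<open>a\<close> of \<open>q i\<close> divided by \<open>[:- a, 1:] ^ m\<close>.\<close>

lemma order_generic_sum:
  fixes q :: "'i \<Rightarrow> 'a::field poly" and a
  assumes I: "finite I" "I \<noteq> {}" and q: "\<And>i. i \<in> I \<Longrightarrow> q i \<noteq> 0"
  defines "m \<equiv> Min ((\<lambda>i. Polynomial.order a (q i)) ` I)"
  obtains d where "\<exists>i\<in>I. d i \<noteq> 0"
    "\<And>c. (\<Sum>i\<in>I. c i * d i) \<noteq> 0 \<Longrightarrow> Polynomial.order a (\<Sum>i\<in>I. Polynomial.smult (c i) (q i)) = m"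
proof -
  have "\<exists>r. q i = [:- a, 1:] ^ m * r" if i: "i \<in> I" for i
  proof -
    have "m \<le> Polynomial.order a (q i)" unfolding m_def using I i by (intro Min_le) auto
    then have "[:- a, 1:] ^ m dvd [:- a, 1:] ^ Polynomial.order a (q i)" by (rule le_imp_power_dvd)
    also have "\<dots> dvd q i" by (rule order_1)
    finally show ?thesis by (auto simp: dvd_def)
  qed
  then obtain r where r: "\<And>i. i \<in> I \<Longrightarrow> q i = [:- a, 1:] ^ m * r i" by metis
  \<comment> \<open>The minimum is attained at some \<open>j\<close>, whose cofactor does not vanish
    at \<open>a\<close>; this is the nonzero \<open>d j\<close>.\<close>
  have "m \<in> (\<lambda>i. Polynomial.order a (q i)) ` I" unfolding m_def using I by (intro Min_in) auto
  then obtain j where j: "j \<in> I" "Polynomial.order a (q j) = m" by auto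
  have "poly (r j) a \<noteq> 0"
  proof
    assume "poly (r j) a = 0"
    then have "[:- a, 1:] dvd r j" by (simp add: poly_eq_0_iff_dvd)
    then have "[:- a, 1:] ^ m * [:- a, 1:] dvd [:- a, 1:] ^ m * r j" by (intro mult_dvd_mono dvd_refl)
    then have "[:- a, 1:] ^ Suc m dvd q j" unfolding r[OF j(1), symmetric] power_Suc2 .
    then show False using order_2[OF q[OF j(1)], of a] j(2) by simp
  qed
  moreover have "Polynomial.order a (\<Sum>i\<in>I. Polynomial.smult (c i) (q i)) = m"
    if "(\<Sum>i\<in>I. c i * poly (r i) a) \<noteq> 0" for c
  proof -
    have "(\<Sum>i\<in>I. Polynomial.smult (c i) (q i)) = [:- a, 1:] ^ m * (\<Sum>i\<in>I. Polynomial.smult (c i) (r i))"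
      by (simp add: r sum_distrib_left cong: sum.cong)
    then show ?thesis using that by (simp add: order_times_power poly_sum)
  qed
  ultimately show ?thesis using that[of "\<lambda>i. poly (r i) a"] j(1) by blast
qed

lemma degree_prod_linear:
  fixes r :: "'u \<Rightarrow> 'a::field"
  assumes "finite Y"
  shows "degree (\<Prod>u\<in>Y. [:- r u, 1:]) = card Y \<and> coeff (\<Prod>u\<in>Y. [:- r u, 1:]) (card Y) = 1"
proof -
  have "degree (\<Prod>u\<in>Y. [:- r u, 1:]) = (\<Sum>u\<in>Y. degree [:- r u, 1:])"
    by (rule degree_prod_eq_sum_degree) simp
  then have d: "degree (\<Prod>u\<in>Y. [:- r u, 1:]) = card Y" by simp
  moreover have "lead_coeff (\<Prod>u\<in>Y. [:- r u, 1:]) = 1" by (simp add: lead_coeff_prod)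
  ultimately show ?thesis by simp
qed

section \<open>Matching polynomials as coefficients of the twisted characteristic polynomial\<close>

locale finite_schrodinger = bidirected_digraph G arev + fin_digraph G
  for G :: "('v, 'e) pre_digraph" and arev +
  fixes w :: "'e \<Rightarrow> complex" and V :: "'v \<Rightarrow> real"
  assumes data: "schrodinger_data G arev w"
begin

sublocale arcs: arc_system "verts G" "arcs G" "tail G" "head G" arev
  by unfold_locales (auto simp: arev_neq)

lemma w_arev: "e \<in> arcs G \<Longrightarrow> w (arev e) = cnj (w e)"
  and w_nonzero: "e \<in> arcs G \<Longrightarrow> w e \<noteq> 0"
  using data by (auto simp: schrodinger_data_def)

lemma matchings_restrict: "matchings (G \<restriction> Y) arev = arcs.edge_matchings Y"
  by (simp add: matchings_def arcs.edge_matchings_def edges_def induce_subgraph_def)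

lemma matching_poly_restrict:
  "matching_poly (G \<restriction> Y) arev w V = (\<Sum>M\<in>arcs.edge_matchings Y.
     Polynomial.smult ((-1) ^ card M * (\<Prod>e\<in>\<Union>M. w e)) (\<Prod>u\<in>Y - tail G ` \<Union>M. [:- of_real (V u), 1:]))"
  unfolding matching_poly_def matchings_restrict by (simp add: induce_subgraph_def)

text \<open>Only the empty matching reaches the degree \<open>card Y\<close>, and its term is
  monic.\<close>

lemma matching_poly_nonzero:
  assumes Y: "Y \<subseteq> verts G"
  shows "matching_poly (G \<restriction> Y) arev w V \<noteq> 0"
proof -
  have finY: "finite Y" using Y finite_verts finite_subset by blast
  have "coeff (matching_poly (G \<restriction> Y) arev w V) (card Y) = (\<Sum>M\<in>arcs.edge_matchings Y. if M = {} then 1 else 0)"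
    unfolding matching_poly_restrict coeff_sum
  proof (intro sum.cong refl)
    fix M assume M: "M \<in> arcs.edge_matchings Y"
    let ?Q = "\<Prod>u\<in>Y - tail G ` \<Union>M. [:- complex_of_real (V u), 1:]"
    have d: "degree ?Q = card (Y - tail G ` \<Union>M)"
      using degree_prod_linear[of "Y - tail G ` \<Union>M" "\<lambda>u. complex_of_real (V u)"] finY by simp
    show "coeff (Polynomial.smult ((-1) ^ card M * (\<Prod>e\<in>\<Union>M. w e)) ?Q) (card Y) = (if M = {} then 1 else 0)"
    proof (cases "M = {}")
      case True
      then show ?thesis using degree_prod_linear[of Y "\<lambda>u. complex_of_real (V u)"] finY by simp
    next
      case False
      then obtain s where s: "s \<in> M" by blast
      then have "s \<noteq> {}" using M by (auto simp: arcs.edge_matchings_def)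
      then obtain e where "e \<in> s" by blast
      then have "tail G e \<in> Y" "tail G e \<in> tail G ` \<Union>M" using arcs.edge_matchings_mem(3)[OF M s] s by auto
      then have "card (Y - tail G ` \<Union>M) < card Y" using finY by (intro psubset_card_mono) auto
      then show ?thesis using False d by (simp add: coeff_eq_0)
    qed
  qed
  also have "\<dots> = 1"
  proof -
    have "{} \<in> arcs.edge_matchings Y" by (simp add: arcs.edge_matchings_def)
    then show ?thesis using arcs.finite_edge_matchings[of Y] by simp
  qed
  finally show ?thesis by auto
qed

text \<open>The multiplicity depends on the subgraph only through its vertex set, and 2-regular
  subgraphs and oriented cycle sets cover the same vertex sets.\<close>

lemma two_regular_mult_theta:
  "(\<lambda>C. mult_theta \<theta> (G \<restriction> (verts G - verts C)) arev w V) ` two_regular_subgraphs G arev =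
   (\<lambda>F. mult_theta \<theta> (G \<restriction> (verts G - tail G ` F)) arev w V) ` arcs.oriented_cycle_sets"
proof -
  have 1: "\<exists>F\<in>arcs.oriented_cycle_sets. tail G ` F = verts C" if C: "C \<in> two_regular_subgraphs G arev" for C
  proof -
    have c: "arcs C \<subseteq> arcs G" "tail C = tail G" "arev ` arcs C \<subseteq> arcs C"
      "\<And>v. v \<in> verts C \<Longrightarrow> out_degree C v = 2" "wf_digraph C"
      using C by (auto simp: two_regular_subgraphs_def subgraph_def compatible_def)
    have tl: "tail G ` arcs C = verts C"
    proof
      show "tail G ` arcs C \<subseteq> verts C" using wf_digraph.tail_in_verts[OF c(5)] c(2) by auto
      show "verts C \<subseteq> tail G ` arcs C"
      proof
        fix v assume "v \<in> verts C"
        then have "card (out_arcs C v) = 2" using c(4) by (simp add: out_degree_def)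
        then have "out_arcs C v \<noteq> {}" by auto
        then show "v \<in> tail G ` arcs C" using c(2) by (auto simp: out_arcs_def)
      qed
    qed
    have "card {e \<in> arcs C. tail G e = v} = 2" if "v \<in> tail G ` arcs C" for v
      using c(4)[of v] that tl c(2) by (simp add: out_degree_def out_arcs_def)
    then obtain F where "F \<in> arcs.oriented_cycle_sets" "tail G ` F = tail G ` arcs C"
      using arcs.two_regular_orientation[OF c(1,3)] by metis
    then show ?thesis using tl by auto
  qed
  have 2: "\<exists>C\<in>two_regular_subgraphs G arev. verts C = tail G ` F" if F: "F \<in> arcs.oriented_cycle_sets" for F
  proof -
    define C where "C = \<lparr>verts = tail G ` F, arcs = F \<union> arev ` F, tail = tail G, head = head G\<rparr>"
    have Fc: "F \<subseteq> arcs G" "head G ` F = tail G ` F"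
      using F by (auto simp: arcs.oriented_cycle_sets_def arcs.cycle_sets_def)
    have "head G e \<in> tail G ` F" "tail G (arev e) \<in> tail G ` F" "head G (arev e) \<in> tail G ` F" if "e \<in> F" for e
      using imageI[OF that, of "head G"] imageI[OF that, of "tail G"] that Fc by auto
    then have "wf_digraph C" by (auto simp: C_def wf_digraph_def)
    then have "subgraph C G" using Fc wf_digraph unfolding subgraph_def C_def compatible_def by auto
    moreover have "arev ` arcs C \<subseteq> arcs C" by (auto simp: C_def)
    moreover have "out_degree C v = 2" if "v \<in> verts C" for v
      using arcs.oriented_two_regular[OF F, of v] that by (simp add: C_def out_degree_def out_arcs_def)
    ultimately have "C \<in> two_regular_subgraphs G arev" by (simp add: two_regular_subgraphs_def)
    then show ?thesis by (intro bexI[of _ C]) (simp add: C_def)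
  qed
  show ?thesis
  proof (intro equalityI subsetI)
    fix x assume "x \<in> (\<lambda>C. mult_theta \<theta> (G \<restriction> (verts G - verts C)) arev w V) ` two_regular_subgraphs G arev"
    then obtain C where "C \<in> two_regular_subgraphs G arev" "x = mult_theta \<theta> (G \<restriction> (verts G - verts C)) arev w V" by auto
    then show "x \<in> (\<lambda>F. mult_theta \<theta> (G \<restriction> (verts G - tail G ` F)) arev w V) ` arcs.oriented_cycle_sets"
      using 1 by (metis (no_types, lifting) image_eqI)
  next
    fix x assume "x \<in> (\<lambda>F. mult_theta \<theta> (G \<restriction> (verts G - tail G ` F)) arev w V) ` arcs.oriented_cycle_sets"
    then obtain F where "F \<in> arcs.oriented_cycle_sets" "x = mult_theta \<theta> (G \<restriction> (verts G - tail G ` F)) arev w V" by auto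
    then show "x \<in> (\<lambda>C. mult_theta \<theta> (G \<restriction> (verts G - verts C)) arev w V) ` two_regular_subgraphs G arev"
      using 2 by (metis (no_types, lifting) image_eqI)
  qed
qed

definition weight_bound :: real where
  "weight_bound = (\<Sum>e\<in>arcs G. cmod (w e)) + (\<Sum>v\<in>verts G. \<bar>V v\<bar>)"

lemma w_le_weight_bound: "e \<in> arcs G \<Longrightarrow> cmod (w e) \<le> weight_bound"
  using member_le_sum[of e "arcs G" "\<lambda>e. cmod (w e)"] sum_nonneg[of "verts G" "\<lambda>v. \<bar>V v\<bar>"]
  unfolding weight_bound_def by (simp add: add_increasing2)

lemma V_le_weight_bound: "v \<in> verts G \<Longrightarrow> \<bar>V v\<bar> \<le> weight_bound"
  using member_le_sum[of v "verts G" "\<lambda>v. \<bar>V v\<bar>"] sum_nonneg[of "arcs G" "\<lambda>e. cmod (w e)"]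
  unfolding weight_bound_def by (simp add: add_increasing)

text \<open>The constant of \<open>schrodinger_op_bounded\<close>. Degrees and weights of the cover
  are those of the base and twists have modulus 1, so it serves the cover and all fibres.\<close>

definition norm_bound :: real where
  "norm_bound = (real (card (arcs G) + 1) * weight_bound)\<^sup>2"

definition kernel :: "('e \<Rightarrow> complex) \<Rightarrow> 'v \<Rightarrow> 'v \<Rightarrow> complex" where
  "kernel z x y = (\<Sum>e | e \<in> arcs G \<and> tail G e = x \<and> head G e = y. w e * z e) + (if x = y then of_real (V x) else 0)"

lemma hermitian_kernel:
  assumes z: "\<And>e. e \<in> arcs G \<Longrightarrow> cmod (z e) = 1" "\<And>e. e \<in> arcs G \<Longrightarrow> z (arev e) = cnj (z e)"
  shows "hermitian_kernel (verts G) (kernel z) (schrodinger_op G (\<lambda>e. w e * z e) V) norm_bound"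
proof
  let ?F = "schrodinger_op G (\<lambda>e. w e * z e) V"
  show "finite (verts G)" by simp
  show k: "?F f x = (\<Sum>y\<in>verts G. kernel z x y * f y)" if x: "x \<in> verts G" for f x
  proof -
    have fin: "finite (out_arcs G x)" by (simp add: out_arcs_def)
    have sub: "head G ` out_arcs G x \<subseteq> verts G" by auto
    have "(\<Sum>e\<in>out_arcs G x. w e * z e * f (head G e))
      = (\<Sum>y\<in>verts G. \<Sum>e\<in>{e \<in> out_arcs G x. head G e = y}. w e * z e * f (head G e))"
      by (rule sum.group[symmetric, OF fin _ sub]) simp
    also have "\<dots> = (\<Sum>y\<in>verts G. (\<Sum>e | e \<in> arcs G \<and> tail G e = x \<and> head G e = y. w e * z e) * f y)"
      by (intro sum.cong refl) (auto simp: sum_distrib_right intro!: sum.cong)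
    finally show ?thesis
      using x by (simp add: schrodinger_op_def kernel_def distrib_right sum.distrib if_distrib[of "\<lambda>c. c * _"] cong: if_cong)
  qed
  show "kernel z y x = cnj (kernel z x y)" if "x \<in> verts G" "y \<in> verts G" for x y
  proof -
    have "(\<Sum>e | e \<in> arcs G \<and> tail G e = y \<and> head G e = x. w e * z e)
      = (\<Sum>e | e \<in> arcs G \<and> tail G e = x \<and> head G e = y. w (arev e) * z (arev e))"
      by (rule sum.reindex_bij_witness[where i = arev and j = arev]) auto
    then show ?thesis by (auto simp: kernel_def w_arev z intro!: sum.cong)
  qed
  show "(\<Sum>x\<in>verts G. (cmod (?F f x))\<^sup>2) \<le> norm_bound * (\<Sum>x\<in>verts G. (cmod (f x))\<^sup>2)" for f
  proof -
    \<comment> \<open>Members of \<open>ell2\<close> vanish off \<open>verts G\<close>, so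
      \<open>f\<close> is truncated; on \<open>verts G\<close> the operator does not see the
      difference.\<close>
    define g where "g x = (if x \<in> verts G then f x else 0)" for x
    have eq: "?F g x = ?F f x" if "x \<in> verts G" for x
      unfolding k[OF that] by (intro sum.cong refl) (simp add: g_def)
    have g: "g \<in> ell2 (verts G)" by (simp add: ell2_def g_def)
    have "(ell2_norm (verts G) (?F g))\<^sup>2 \<le> norm_bound * (ell2_norm (verts G) g)\<^sup>2"
      unfolding norm_bound_def
    proof (rule schrodinger_op_bounded(2)[OF _ _ _ g])
      show "finite (out_arcs G x) \<and> card (out_arcs G x) \<le> card (arcs G)" for x
        by (auto simp: out_arcs_def intro!: card_mono)
      show "cmod (w e * z e) \<le> weight_bound" if "e \<in> arcs G" for e
        using w_le_weight_bound[OF that] z that by (simp add: norm_mult)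
    qed (rule V_le_weight_bound)
    then show ?thesis by (simp add: ell2_norm_power2 eq g_def cong: sum.cong)
  qed
qed

text \<open>The off-diagonal entries of x minus the kernel carry a minus sign and a twist on each
  arc. Both cancel on matched edges, which leaves the untwisted matching polynomial, and both stay
  on the oriented cycles.\<close>

lemma kernel_charpoly_eq:
  assumes z: "\<And>e. e \<in> arcs G \<Longrightarrow> z e * z (arev e) = 1"
  shows "(\<Sum>p | p permutes verts G. of_int (sign p) *
      (\<Prod>v\<in>verts G. (if p v = v then [:0, 1:] else 0) - [:kernel z v (p v):]))
    = (\<Sum>F\<in>arcs.oriented_cycle_sets.
        Polynomial.smult (of_int (sign (arcs.successor F)) * (\<Prod>e\<in>F. - w e) * (\<Prod>e\<in>F. z e))
          (matching_poly (G \<restriction> (verts G - tail G ` F)) arev w V))"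
proof -
  let ?b = "\<lambda>e. [:- (w e * z e):]" and ?a = "\<lambda>v. [:- of_real (V v), 1:]"
  have entry: "(if p v = v then [:0, 1:] else 0) - [:kernel z v (p v):]
      = (if p v = v then ?a v else 0) + (\<Sum>e | e \<in> arcs G \<and> tail G e = v \<and> head G e = p v. ?b e)" for p v
  proof -
    have "(\<Sum>e\<in>S. ?b e) = [:- (\<Sum>e\<in>S. w e * z e):]" for S
      by (induction S rule: infinite_finite_induct) auto
    then show ?thesis by (auto simp: kernel_def)
  qed
  have mp: "(\<Sum>M\<in>arcs.edge_matchings Y. (-1) ^ card M * (\<Prod>e\<in>\<Union>M. ?b e) * (\<Prod>v\<in>Y - tail G ` \<Union>M. ?a v))
      = matching_poly (G \<restriction> Y) arev w V" for Y
    unfolding matching_poly_restrict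
  proof (intro sum.cong refl)
    fix M assume M: "M \<in> arcs.edge_matchings Y"
    have "(\<Prod>e\<in>\<Union>M. ?b e) = (\<Prod>e\<in>\<Union>M. [:w e:])"
    proof (rule arcs.prod_matching_cong[OF M])
      fix e assume e: "e \<in> arcs G"
      have "w e * z e * (w (arev e) * z (arev e)) = w e * w (arev e) * (z e * z (arev e))" by (simp add: mult_ac)
      then show "?b e * ?b (arev e) = [:w e:] * [:w (arev e):]" using z[OF e] by (simp add: mult.commute)
    qed
    then have "(-1) ^ card M * (\<Prod>e\<in>\<Union>M. ?b e) = [:(-1) ^ card M * (\<Prod>e\<in>\<Union>M. w e):]"
      by (cases "even (card M)") (simp_all add: prod_const_poly)
    then show "(-1) ^ card M * (\<Prod>e\<in>\<Union>M. ?b e) * (\<Prod>v\<in>Y - tail G ` \<Union>M. ?a v) =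
      Polynomial.smult ((-1) ^ card M * (\<Prod>e\<in>\<Union>M. w e)) (\<Prod>u\<in>Y - tail G ` \<Union>M. [:- of_real (V u), 1:])"
      by simp
  qed
  have "of_int (sign (arcs.successor F)) * (\<Prod>e\<in>F. ?b e)
      = [:of_int (sign (arcs.successor F)) * (\<Prod>e\<in>F. - w e) * (\<Prod>e\<in>F. z e):]" for F
    unfolding prod_const_poly by (simp add: of_int_poly prod.distrib[symmetric] mult.assoc)
  then show ?thesis
    unfolding entry arcs.permutation_sum_oriented mp by simp
qed

end

section \<open>The atom of the spectral measure\<close>

text \<open>The parallelogram law for \<open>H f\<close> and \<theta> times
  \<open>f\<close>.\<close>

lemma (in ell2_spectral) shifted_norm_bound:
  assumes f: "f \<in> ell2 X" and H: "(ell2_norm X (H f))\<^sup>2 \<le> B * (ell2_norm X f)\<^sup>2"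
  shows "(ell2_norm X (shifted \<theta> f))\<^sup>2 \<le> (2 * B + 2 * \<theta>\<^sup>2) * (ell2_norm X f)\<^sup>2"
proof -
  have Hf: "H f \<in> ell2 X" using H_ell2 f .
  define g where "g c = (\<lambda>x. 1 * H f x + c * f x)" for c
  have g: "g c \<in> ell2 X" for c unfolding g_def by (rule ell2_lincomb[OF Hf f])
  define t where "t = complex_of_real \<theta>"
  have "ell2_inner X (g (- t)) (g (- t)) + ell2_inner X (g t) (g t)
      = 2 * ell2_inner X (H f) (H f) + 2 * t * cnj t * ell2_inner X f f"
    unfolding g_def ell2_inner_lincomb_both[OF Hf f Hf f] by (simp add: algebra_simps)
  then have "complex_of_real ((ell2_norm X (g (- t)))\<^sup>2 + (ell2_norm X (g t))\<^sup>2)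
      = of_real (2 * (ell2_norm X (H f))\<^sup>2 + 2 * \<theta>\<^sup>2 * (ell2_norm X f)\<^sup>2)"
    by (simp add: ell2_inner_self g f Hf t_def power2_eq_square)
  then have "(ell2_norm X (g (- t)))\<^sup>2 + (ell2_norm X (g t))\<^sup>2
      = 2 * (ell2_norm X (H f))\<^sup>2 + 2 * \<theta>\<^sup>2 * (ell2_norm X f)\<^sup>2"
    using of_real_eq_iff by blast
  then have "(ell2_norm X (g (- t)))\<^sup>2 \<le> 2 * (ell2_norm X (H f))\<^sup>2 + 2 * \<theta>\<^sup>2 * (ell2_norm X f)\<^sup>2"
    using zero_le_power2[of "ell2_norm X (g t)"] by linarith
  also have "g (- t) = shifted \<theta> f" by (simp add: g_def shifted_def t_def)
  finally show ?thesis using H by (simp add: algebra_simps)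
qed

lemma sum_list_power_tendsto:
  fixes xs :: "real list"
  assumes "\<And>x. x \<in> set xs \<Longrightarrow> 0 < x \<and> x \<le> 1"
  shows "(\<lambda>k. \<Sum>x\<leftarrow>xs. x ^ k) \<longlonglongrightarrow> real (count_list xs 1)"
  using assms
proof (induction xs)
  case (Cons x xs)
  have "(\<lambda>k. x ^ k) \<longlonglongrightarrow> (if x = 1 then 1 else 0)"
    using Cons.prems[of x] by (auto intro!: LIMSEQ_realpow_zero)
  then have "(\<lambda>k. x ^ k + (\<Sum>x\<leftarrow>xs. x ^ k)) \<longlonglongrightarrow> (if x = 1 then 1 else 0) + real (count_list xs 1)"
    using Cons by (intro tendsto_add) auto
  then show ?case by (cases "x = 1") (auto simp: add.commute)
qed simp

lemma sum_list_power_bounds: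
  fixes xs :: "real list"
  assumes "\<And>x. x \<in> set xs \<Longrightarrow> 0 < x \<and> x \<le> 1"
  shows "0 \<le> (\<Sum>x\<leftarrow>xs. x ^ k) \<and> (\<Sum>x\<leftarrow>xs. x ^ k) \<le> length xs"
  using assms
proof (induction xs)
  case (Cons x xs)
  have "0 \<le> x ^ k \<and> x ^ k \<le> 1" using Cons.prems[of x] by (auto intro: power_le_one)
  then show ?case using Cons by auto
qed simp

text \<open>The powers of 3 give distinct oriented cycle sets distinct frequencies in the common
  phase, as \<open>cycle_exponent_inj\<close> shows.\<close>

locale schrodinger_cover = finite_schrodinger G arev w V + finite_abelian_cover G arev G' arev' pV pE N
  for G :: "('v, 'e) pre_digraph" and arev w V and G' :: "('x, 'a) pre_digraph" and arev' pV pE N +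
  assumes N: "\<exists>h. bij_betw h {..<card (arcs G)} (arcs G) \<and> (\<forall>i<card (arcs G). N (h i) = 3 ^ i)"
begin

definition cycle_exponent :: "'e set \<Rightarrow> 'e \<Rightarrow> int" where
  "cycle_exponent F e = of_bool (e \<in> F) - of_bool (arev e \<in> F)"

lemma prod_edge_phase:
  assumes F: "F \<subseteq> arcs G"
  shows "(\<Prod>e\<in>F. edge_phase N arev \<omega> e) = character (arcs G) N (cycle_exponent F) \<omega>"
proof -
  have finF: "finite F" using F finite_arcs finite_subset by blast
  have "(\<Prod>e\<in>F. edge_phase N arev \<omega> e) = cis (\<Sum>e\<in>F. phase N \<omega> e - phase N \<omega> (arev e))"
    using finF by (induction F rule: finite_induct) (auto simp: edge_phase_def cis_mult)
  also have "(\<Sum>e\<in>F. phase N \<omega> e - phase N \<omega> (arev e)) = (\<Sum>e\<in>F. phase N \<omega> e) - (\<Sum>e\<in>F. phase N \<omega> (arev e))"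
    by (simp add: sum_subtractf)
  also have "(\<Sum>e\<in>F. phase N \<omega> e) = (\<Sum>e\<in>arcs G. phase N \<omega> e * of_bool (e \<in> F))"
    using F by (intro sum.mono_neutral_cong_left) auto
  also have "(\<Sum>e\<in>F. phase N \<omega> (arev e)) = (\<Sum>e\<in>arev ` F. phase N \<omega> e)"
    by (subst sum.reindex) auto
  also have "\<dots> = (\<Sum>e\<in>arcs G. phase N \<omega> e * of_bool (arev e \<in> F))"
    using F by (intro sum.mono_neutral_cong_left) (auto, metis arev_arev image_eqI)
  also have "(\<Sum>e\<in>arcs G. phase N \<omega> e * of_bool (e \<in> F)) - (\<Sum>e\<in>arcs G. phase N \<omega> e * of_bool (arev e \<in> F))
      = (\<Sum>e\<in>arcs G. phase N \<omega> e * real_of_int (cycle_exponent F e))"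
    unfolding sum_subtractf[symmetric] by (intro sum.cong refl) (simp add: cycle_exponent_def of_bool_def)
  finally show ?thesis by (simp add: character_def)
qed

text \<open>Exponents are in {-1, 0, 1}, so equal ternary sums force equal exponents. As
  \<open>F\<close> has no opposite arcs, it consists of the arcs with exponent 1.\<close>

lemma cycle_exponent_inj:
  "inj_on (\<lambda>F. \<Sum>e\<in>arcs G. int (N e) * cycle_exponent F e) arcs.oriented_cycle_sets"
proof (rule inj_onI)
  fix F F' assume F: "F \<in> arcs.oriented_cycle_sets" and F': "F' \<in> arcs.oriented_cycle_sets"
    and eq: "(\<Sum>e\<in>arcs G. int (N e) * cycle_exponent F e) = (\<Sum>e\<in>arcs G. int (N e) * cycle_exponent F' e)"
  obtain h where h: "bij_betw h {..<card (arcs G)} (arcs G)" "\<And>i. i < card (arcs G) \<Longrightarrow> N (h i) = 3 ^ i"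
    using N by blast
  define d where "d i = cycle_exponent F (h i) - cycle_exponent F' (h i)" for i
  have "(\<Sum>i<card (arcs G). 3 ^ i * d i) = (\<Sum>i<card (arcs G). int (N (h i)) * (cycle_exponent F (h i) - cycle_exponent F' (h i)))"
    by (intro sum.cong) (auto simp: h(2) d_def)
  also have "\<dots> = (\<Sum>e\<in>arcs G. int (N e) * (cycle_exponent F e - cycle_exponent F' e))"
    by (rule sum.reindex_bij_betw[OF h(1)])
  also have "\<dots> = 0" using eq by (simp add: right_diff_distrib sum_subtractf)
  finally have dz: "d i = 0" if "i < card (arcs G)" for i
    by (rule ternary_sum_zero[rotated]) (use that in \<open>auto simp: d_def cycle_exponent_def\<close>)
  then have ce: "cycle_exponent F e = cycle_exponent F' e" if "e \<in> arcs G" for e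
  proof -
    have "e \<in> h ` {..<card (arcs G)}" using that h(1) by (simp add: bij_betw_def)
    then obtain i where "i < card (arcs G)" "e = h i" by auto
    then show ?thesis using dz[of i] by (simp add: d_def)
  qed
  have mem: "e \<in> K \<longleftrightarrow> cycle_exponent K e = 1" if "K \<in> arcs.oriented_cycle_sets" for K e
    using that by (auto simp: cycle_exponent_def arcs.oriented_cycle_sets_def)
  have "e \<in> F \<longleftrightarrow> e \<in> F'" if "e \<in> arcs G" for e
    using mem[OF F, of e] mem[OF F', of e] ce[OF that] by simp
  moreover have "F \<subseteq> arcs G" "F' \<subseteq> arcs G" using F F' by (auto simp: arcs.oriented_cycle_sets_def arcs.cycle_sets_def)
  ultimately show "F = F'" by blast
qed

abbreviation "fibre_op \<omega> \<equiv> schrodinger_op G (\<lambda>e. w e * edge_phase N arev \<omega> e) V"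

lemma fibre_hermitian_kernel:
  "hermitian_kernel (verts G) (kernel (edge_phase N arev \<omega>)) (fibre_op \<omega>) norm_bound"
  by (rule hermitian_kernel) (auto simp: edge_phase_def cis_cnj)

definition min_mult :: "real \<Rightarrow> nat" where
  "min_mult \<theta> = Min ((\<lambda>C. mult_theta \<theta> (G \<restriction> (verts G - verts C)) arev w V) ` two_regular_subgraphs G arev)"

text \<open>Dividing by the common power of the linear factor at \<theta> and evaluating there
  leaves a combination of distinct characters with some nonzero coefficient, hence almost surely a
  nonzero number.\<close>

lemma AE_order_charpoly:
  "AE \<omega> in phase_space (arcs G).
     Polynomial.order (of_real \<theta>) (hermitian_kernel.kernel_charpoly (verts G) (kernel (edge_phase N arev \<omega>))) = min_mult \<theta>"
proof -
  let ?O = "arcs.oriented_cycle_sets"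
  define q where "q F = matching_poly (G \<restriction> (verts G - tail G ` F)) arev w V" for F
  define k where "k F = of_int (sign (arcs.successor F)) * (\<Prod>e\<in>F. - w e)" for F
  have fin: "finite ?O" using arcs.finite_cycle_sets by (auto simp: arcs.oriented_cycle_sets_def)
  have ne: "?O \<noteq> {}" by (auto simp: arcs.oriented_cycle_sets_def arcs.cycle_sets_def)
  have q: "q F \<noteq> 0" for F unfolding q_def by (rule matching_poly_nonzero) auto
  have FA: "F \<subseteq> arcs G" if "F \<in> ?O" for F using that by (auto simp: arcs.oriented_cycle_sets_def arcs.cycle_sets_def)
  have k: "k F \<noteq> 0" if "F \<in> ?O" for F
  proof -
    have "finite F" using FA[OF that] finite_arcs finite_subset by blast
    then show ?thesis using FA[OF that] w_nonzero by (auto simp: k_def sign_def)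
  qed
  have mm: "min_mult \<theta> = Min ((\<lambda>F. Polynomial.order (of_real \<theta>) (q F)) ` ?O)"
    unfolding min_mult_def two_regular_mult_theta by (simp add: mult_theta_def q_def)
  have cp: "hermitian_kernel.kernel_charpoly (verts G) (kernel (edge_phase N arev \<omega>))
    = (\<Sum>F\<in>?O. Polynomial.smult (k F * character (arcs G) N (cycle_exponent F) \<omega>) (q F))" for \<omega>
  proof -
    interpret hk: hermitian_kernel "verts G" "kernel (edge_phase N arev \<omega>)" "fibre_op \<omega>" norm_bound
      by (rule fibre_hermitian_kernel)
    have "hk.kernel_charpoly = (\<Sum>F\<in>?O. Polynomial.smult (k F * (\<Prod>e\<in>F. edge_phase N arev \<omega> e)) (q F))"
      unfolding hk.kernel_charpoly_def k_def q_def
      by (rule kernel_charpoly_eq) (simp add: edge_phase_def cis_mult)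
    also have "\<dots> = (\<Sum>F\<in>?O. Polynomial.smult (k F * character (arcs G) N (cycle_exponent F) \<omega>) (q F))"
      by (intro sum.cong refl) (simp add: prod_edge_phase FA)
    finally show ?thesis .
  qed
  obtain d where d: "\<exists>F\<in>?O. d F \<noteq> 0"
    "\<And>c. (\<Sum>F\<in>?O. c F * d F) \<noteq> 0 \<Longrightarrow>
      Polynomial.order (of_real \<theta>) (\<Sum>F\<in>?O. Polynomial.smult (c F) (q F)) = min_mult \<theta>"
    by (rule order_generic_sum[of ?O q "of_real \<theta>", OF fin ne q, folded mm]; rule that; assumption)
  have "AE \<omega> in phase_space (arcs G). (\<Sum>F\<in>?O. (k F * d F) * character (arcs G) N (cycle_exponent F) \<omega>) \<noteq> 0"
    by (rule AE_character_sum_nonzero[OF fin cycle_exponent_inj]) (use d(1) k in auto)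
  then show ?thesis
  proof eventually_elim
    case (elim \<omega>)
    then have "(\<Sum>F\<in>?O. (k F * character (arcs G) N (cycle_exponent F) \<omega>) * d F) \<noteq> 0"
      by (simp add: mult_ac)
    then show ?case unfolding cp by (rule d(2))
  qed
qed

text \<open>For each fixed phase the limit is identified for the trace, not for single diagonal
  entries, so the sum over the vertices is moved under the integral first.\<close>

lemma integral_trace_tendsto:
  assumes R: "R > 2 * norm_bound + 2 * \<theta>\<^sup>2" "R > 0"
    and int: "\<And>v k. v \<in> verts G \<Longrightarrow> integrable (phase_space (arcs G)) (\<lambda>\<omega>. (peak_op (fibre_op \<omega>) \<theta> R ^^ k) (delta v) v)"
  shows "(\<lambda>k. \<Sum>v\<in>verts G. \<integral>\<omega>. (peak_op (fibre_op \<omega>) \<theta> R ^^ k) (delta v) v \<partial>phase_space (arcs G))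
    \<longlonglongrightarrow> of_nat (min_mult \<theta>)"
proof -
  interpret prob_space "phase_space (arcs G)" by (rule prob_space_phase_space)
  define tr where "tr k \<omega> = (\<Sum>v\<in>verts G. (peak_op (fibre_op \<omega>) \<theta> R ^^ k) (delta v) v)" for k \<omega>
  have tr: "(\<forall>k. cmod (tr k \<omega>) \<le> card (verts G)) \<and>
      (\<lambda>k. tr k \<omega>) \<longlonglongrightarrow> of_nat (Polynomial.order (of_real \<theta>)
        (hermitian_kernel.kernel_charpoly (verts G) (kernel (edge_phase N arev \<omega>))))" for \<omega>
  proof -
    interpret hk: hermitian_kernel "verts G" "kernel (edge_phase N arev \<omega>)" "fibre_op \<omega>" norm_bound
      by (rule fibre_hermitian_kernel)
    obtain xs where xs: "\<And>k. tr k \<omega> = of_real (\<Sum>x\<leftarrow>xs. x ^ k)"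
      "\<And>x. x \<in> set xs \<Longrightarrow> 0 < x \<and> x \<le> 1" "length xs = card (verts G)"
      "count_list xs 1 = Polynomial.order (of_real \<theta>) hk.kernel_charpoly"
      by (rule hk.trace_peak_op[OF R, folded tr_def]; rule that; assumption)
    have "cmod (tr k \<omega>) \<le> card (verts G)" for k
      unfolding xs(1) norm_of_real using sum_list_power_bounds[of xs k] xs(2,3) by auto
    moreover have "(\<lambda>k. tr k \<omega>) \<longlonglongrightarrow> of_real (real (count_list xs 1))"
      unfolding xs(1) by (intro tendsto_of_real sum_list_power_tendsto xs(2))
    ultimately show ?thesis using xs(4) by simp
  qed
  have "(\<lambda>k. \<integral>\<omega>. tr k \<omega> \<partial>phase_space (arcs G)) \<longlonglongrightarrow> (\<integral>\<omega>. of_nat (min_mult \<theta>) \<partial>phase_space (arcs G))"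
  proof (rule integral_dominated_convergence[where w = "\<lambda>_. real (card (verts G))"])
    show "tr k \<in> borel_measurable (phase_space (arcs G))" for k
      unfolding tr_def by (intro borel_measurable_sum borel_measurable_integrable int)
    show "AE \<omega> in phase_space (arcs G). (\<lambda>k. tr k \<omega>) \<longlonglongrightarrow> of_nat (min_mult \<theta>)"
      using AE_order_charpoly[of \<theta>] by eventually_elim (use tr in metis)
  qed (use tr in auto)
  moreover have "(\<integral>\<omega>. tr k \<omega> \<partial>phase_space (arcs G))
    = (\<Sum>v\<in>verts G. \<integral>\<omega>. (peak_op (fibre_op \<omega>) \<theta> R ^^ k) (delta v) v \<partial>phase_space (arcs G))" for k
    unfolding tr_def by (intro Bochner_Integration.integral_sum int)
  ultimately show ?thesis using prob_space by simp
qed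

text \<open>One sequence of averaged traces has two limits, one computed on the cover and one in the
  fibres.\<close>

lemma atom_mass:
  assumes lft: "\<And>v. v \<in> verts G \<Longrightarrow> lft v \<in> verts G' \<and> pV (lft v) = v"
    and E: "spectral_resolution (verts G') (schrodinger_op G' (w \<circ> pE) (V \<circ> pV)) E"
  shows "(\<Sum>v\<in>verts G. ell2_inner (verts G') (E {\<theta>} (delta (lft v))) (delta (lft v))) = of_nat (min_mult \<theta>)"
proof -
  let ?H = "schrodinger_op G' (w \<circ> pE) (V \<circ> pV)" and ?X = "verts G'"
  have deg: "finite (out_arcs G' x) \<and> card (out_arcs G' x) \<le> card (arcs G)" for x
    using finite_out_arcs[OF finite_arcs] by blast
  have wb: "cmod ((w \<circ> pE) e) \<le> weight_bound" if "e \<in> arcs G'" for e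
    using w_le_weight_bound pE_arcs(1)[OF that] by simp
  have Vb: "\<bar>(V \<circ> pV) x\<bar> \<le> weight_bound" if "x \<in> verts G'" for x
    using V_le_weight_bound pV_verts[OF that] by simp
  have H: "?H f \<in> ell2 ?X" "(ell2_norm ?X (?H f))\<^sup>2 \<le> norm_bound * (ell2_norm ?X f)\<^sup>2" if "f \<in> ell2 ?X" for f
    unfolding norm_bound_def
    by (rule cover.schrodinger_op_bounded[where D = "card (arcs G)" and W = weight_bound];
        use that deg wb Vb in simp)+
  interpret S: ell2_spectral ?X ?H E
    by unfold_locales (use H(1) E schrodinger_op_lincomb in auto)
  \<comment> \<open>The summand 1 makes the inequality strict and \<open>R\<close> positive.\<close>
  define R where "R = 2 * norm_bound + 2 * \<theta>\<^sup>2 + 1"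
  have "norm_bound \<ge> 0" by (simp add: norm_bound_def)
  then have R: "R > 2 * norm_bound + 2 * \<theta>\<^sup>2" "R > 0" by (auto simp: R_def add_nonneg_pos)
  have bound: "(ell2_norm ?X (S.shifted \<theta> g))\<^sup>2 \<le> R * (ell2_norm ?X g)\<^sup>2" if "g \<in> ell2 ?X" for g
  proof -
    have "(ell2_norm ?X (S.shifted \<theta> g))\<^sup>2 \<le> (2 * norm_bound + 2 * \<theta>\<^sup>2) * (ell2_norm ?X g)\<^sup>2"
      by (rule S.shifted_norm_bound[OF that H(2)[OF that]])
    also have "\<dots> \<le> R * (ell2_norm ?X g)\<^sup>2" using R by (intro mult_right_mono) auto
    finally show ?thesis .
  qed
  have "(\<lambda>k. \<integral>\<omega>. (peak_op (fibre_op \<omega>) \<theta> R ^^ k) (delta v) v \<partial>phase_space (arcs G))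
      \<longlonglongrightarrow> ell2_inner ?X (E {\<theta>} (delta (lft v))) (delta (lft v))" if v: "v \<in> verts G" for v
  proof -
    have l: "lft v \<in> ?X" "pV (lft v) = v" using lft[OF v] by auto
    have "(\<lambda>k. ell2_inner ?X ((peak_op ?H \<theta> R ^^ k) (delta (lft v))) (delta (lft v)))
      \<longlonglongrightarrow> ell2_inner ?X (E {\<theta>} (delta (lft v))) (delta (lft v))"
      by (rule S.peak_op_pow_tendsto[OF R(2) delta_ell2[OF l(1)] bound])
    then show ?thesis
      unfolding ell2_inner_delta[OF l(1)] peak_op_return(1)[OF l(1)] l(2) .
  qed
  then have "(\<lambda>k. \<Sum>v\<in>verts G. \<integral>\<omega>. (peak_op (fibre_op \<omega>) \<theta> R ^^ k) (delta v) v \<partial>phase_space (arcs G))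
      \<longlonglongrightarrow> (\<Sum>v\<in>verts G. ell2_inner ?X (E {\<theta>} (delta (lft v))) (delta (lft v)))"
    by (intro tendsto_sum)
  moreover have "(\<lambda>k. \<Sum>v\<in>verts G. \<integral>\<omega>. (peak_op (fibre_op \<omega>) \<theta> R ^^ k) (delta v) v \<partial>phase_space (arcs G))
      \<longlonglongrightarrow> of_nat (min_mult \<theta>)"
  proof (rule integral_trace_tendsto[OF R])
    fix v k assume v: "v \<in> verts G"
    then show "integrable (phase_space (arcs G)) (\<lambda>\<omega>. (peak_op (fibre_op \<omega>) \<theta> R ^^ k) (delta v) v)"
      using peak_op_return(2)[of "lft v"] lft[OF v] by simp
  qed
  ultimately show ?thesis by (rule LIMSEQ_unique)
qed

end

theorem theorem4p1:
  fixes G :: "('v, 'e) pre_digraph" and arev :: "'e \<Rightarrow> 'e"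
    and w :: "'e \<Rightarrow> complex" and V :: "'v \<Rightarrow> real"
    and Gab :: "('x, 'a) pre_digraph" and arevab :: "'a \<Rightarrow> 'a"
    and pV :: "'x \<Rightarrow> 'v" and pE :: "'a \<Rightarrow> 'e"
    and lft :: "'v \<Rightarrow> 'x"
    and E :: "real set \<Rightarrow> ('x \<Rightarrow> complex) \<Rightarrow> 'x \<Rightarrow> complex"
    and \<theta> :: real
  assumes "fin_digraph G" and "bidirected_digraph G arev"
    and "schrodinger_data G arev w"
    and "max_abelian_cover G arev Gab arevab pV pE"
    and "\<forall>v\<in>verts G. lft v \<in> verts Gab \<and> pV (lft v) = v"
    and "spectral_resolution (verts Gab) (schrodinger_op Gab (w \<circ> pE) (V \<circ> pV)) E"
  shows "cover_spectral_measure (verts G) lft (verts Gab) E {\<theta>} =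
    1 / real (card (verts G)) *
      real (Min ((\<lambda>C. mult_theta \<theta> (G \<restriction> (verts G - verts C)) arev w V)
                   ` two_regular_subgraphs G arev))"
proof -
  have cov: "graph_covering G arev Gab arevab pV pE" using assms(4) by (simp add: max_abelian_cover_def)
  have bid: "bidirected_digraph Gab arevab" using cov by (simp add: graph_covering_def)
  have finA: "finite (arcs G)" by (rule fin_digraph.finite_arcs[OF assms(1)])
  obtain h where h: "bij_betw h {..<card (arcs G)} (arcs G)"
    using ex_bij_betw_nat_finite[OF finA] by (auto simp: atLeast0LessThan)
  define N :: "'e \<Rightarrow> nat" where "N e = 3 ^ the_inv_into {..<card (arcs G)} h e" for e
  have N: "N (h i) = 3 ^ i" if "i < card (arcs G)" for i
    using h that by (simp add: N_def bij_betw_def the_inv_into_f_f)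
  interpret schrodinger_cover G arev w V Gab arevab pV pE N
  proof (intro schrodinger_cover.intro finite_schrodinger.intro finite_abelian_cover.intro
      abelian_cover.intro graph_cover.intro assms bid)
    show "finite_schrodinger_axioms G arev w" using assms(3) by unfold_locales
    show "graph_cover_axioms G arev Gab arevab pV pE" using cov by unfold_locales
    show "abelian_cover_axioms G arev Gab arevab pV pE"
      using assms(4) unfolding max_abelian_cover_def by unfold_locales blast
    show "phases (arcs G)" using finA by unfold_locales
    show "schrodinger_cover_axioms G N" using h N by unfold_locales blast
  qed
  have "(\<Sum>v\<in>verts G. Re (ell2_inner (verts Gab) (E {\<theta>} (delta (lft v))) (delta (lft v)))) = real (min_mult \<theta>)"
    using arg_cong[OF atom_mass[of lft E \<theta>], of Re] assms(5,6) by simp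
  then show ?thesis by (simp add: cover_spectral_measure_def min_mult_def)
qed

end
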